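(* Let $\pi:D\to G$ be a proper holomorphic map between domains in $\mathbb{C}^n$ with multiplicity $m$, and let $\phi\in L^\infty_{\mathrm{loc}}(G,\mathbb{R}_{>0})$. Let $\Gamma:\mathbb{A}^2_\phi(G)\to\mathbb{A}^2_{\phi\circ\pi}(D)$ be the linear operator $\Gamma f=\frac{1}{\sqrt m}\,(f\circ\pi)\,J\pi$. Then the Hilbert subspace $\Gamma\mathbb{A}^2_\phi(G)$ of $\mathbb{A}^2_{\phi\circ\pi}(D)$ is isometrically isomorphic with $\mathbb{A}^2_\phi(G)$. The orthogonal projection $P$ of $\mathbb{A}^2_{\phi\circ\pi}(D)$ onto $\Gamma\mathbb{A}^2_\phi(G)$ is given by the formula $$Pg=\frac1m\sum_{k=1}^m (g\circ\pi^k\circ\pi)\,J(\pi^k\circ\pi)$$ for $g\in\mathbb{A}^2_{\phi\circ\pi}(D)$, where $\pi^1,\dots,\pi^m$ are the local inverses of $\pi$.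
   Context: For a domain $G\subset\mathbb{C}^n$ and a positive function $\phi\in L^\infty_{\mathrm{loc}}(G)$, the weighted Bergman space $\mathbb{A}^2_\phi(G)$ is the space of holomorphic functions $f$ on $G$ with $\int_G|f|^2\phi\,dV<\infty$, where $dV$ is Lebesgue measure, with inner product $\langle f,h\rangle=\int_G f\overline h\,\phi\,dV$. For a holomorphic map $F$ between open subsets of $\mathbb{C}^n$, $JF$ denotes its complex Jacobian determinant, and $N(J\pi)=\{z\in D: J\pi(z)=0\}$. A proper holomorphic map $\pi:D\to G$ between domains in $\mathbb{C}^n$ is surjective, and its multiplicity is the number $m$ such that every point of $G\setminus\pi(N(J\pi))$ has exactly $m$ preimages. Near each point of $G\setminus\pi(N(J\pi))$ there are exactly $m$ holomorphic local inverses $\pi^1,\dots,\pi^m$ of $\pi$ (so $\pi\circ\pi^k=\mathrm{id}$ locally), whose values at each point are the $m$ distinct preimages. The sum in the claim is symmetric in the local inverses, so it is well defined on the dense open set $D\setminus\pi^{-1}(\pi(N(J\pi)))$, and the formula for $Pg$ is read there.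
   Formalization: For a general positive locally bounded weight, the weighted Bergman space need not be complete, so "Hilbert subspace" is proved as: the image of Γ is a closed linear subspace of the weighted Bergman space of D, and it is complete whenever the weighted Bergman space of G is. *)

theory Defs
  imports "HOL-Analysis.Analysis" "HOL-Library.Function_Algebras"
begin

definition holomorphic_fun_on :: "(complex^'n \<Rightarrow> complex) \<Rightarrow> (complex^'n) set \<Rightarrow> bool" where
  "holomorphic_fun_on f S \<longleftrightarrow>
     (\<forall>z\<in>S. \<exists>f'. (f has_derivative f') (at z) \<and> Vector_Spaces.linear (*s) (*) f')"

definition holomorphic_map_on :: "(complex^'n \<Rightarrow> complex^'n) \<Rightarrow> (complex^'n) set \<Rightarrow> bool" where
  "holomorphic_map_on F S \<longleftrightarrow>
     (\<forall>z\<in>S. \<exists>F'. (F has_derivative F') (at z) \<and> Vector_Spaces.linear (*s) (*s) F')"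

text \<open>The complex Jacobian determinant: \<^const>\<open>matrix\<close> is taken over the complex scalars,
  so this is an \<open>n \<times> n\<close> complex determinant.\<close>

definition cjacobian :: "(complex^'n \<Rightarrow> complex^'n) \<Rightarrow> complex^'n \<Rightarrow> complex" where
  "cjacobian F z = det (matrix (frechet_derivative F (at z)) :: complex^'n^'n)"

definition cdomain :: "(complex^'n) set \<Rightarrow> bool" where
  "cdomain S \<longleftrightarrow> open S \<and> connected S \<and> S \<noteq> {}"

definition proper_holomorphic ::
  "(complex^'n) set \<Rightarrow> (complex^'n) set \<Rightarrow> (complex^'n \<Rightarrow> complex^'n) \<Rightarrow> bool" where
  "proper_holomorphic D G p \<longleftrightarrow>
     p \<in> D \<rightarrow> G \<and> holomorphic_map_on p D \<and> proper_map (top_of_set D) (top_of_set G) p"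

definition crit :: "(complex^'n) set \<Rightarrow> (complex^'n \<Rightarrow> complex^'n) \<Rightarrow> (complex^'n) set" where
  "crit D p = {z \<in> D. cjacobian p z = 0}"

definition has_multiplicity ::
  "(complex^'n) set \<Rightarrow> (complex^'n) set \<Rightarrow> (complex^'n \<Rightarrow> complex^'n) \<Rightarrow> nat \<Rightarrow> bool" where
  "has_multiplicity D G p m \<longleftrightarrow>
     (\<forall>w \<in> G - p ` crit D p. finite {z \<in> D. p z = w} \<and> card {z \<in> D. p z = w} = m)"

definition local_inverses ::
  "(complex^'n) set \<Rightarrow> (complex^'n) set \<Rightarrow> (complex^'n \<Rightarrow> complex^'n) \<Rightarrow> nat \<Rightarrow>
   (complex^'n) set \<Rightarrow> (nat \<Rightarrow> complex^'n \<Rightarrow> complex^'n) \<Rightarrow> bool" where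
  "local_inverses D G p m U \<rho> \<longleftrightarrow>
     open U \<and> U \<subseteq> G - p ` crit D p \<and>
     (\<forall>k\<in>{1..m}. holomorphic_map_on (\<rho> k) U \<and> (\<forall>w\<in>U. p (\<rho> k w) = w)) \<and>
     (\<forall>w\<in>U. bij_betw (\<lambda>k. \<rho> k w) {1..m} {z \<in> D. p z = w})"

definition Linf_loc_pos :: "(complex^'n) set \<Rightarrow> (complex^'n \<Rightarrow> real) \<Rightarrow> bool" where
  "Linf_loc_pos G \<phi> \<longleftrightarrow>
     \<phi> \<in> borel_measurable (lebesgue_on G) \<and> (\<forall>z\<in>G. 0 < \<phi> z) \<and>
     (\<forall>K. compact K \<and> K \<subseteq> G \<longrightarrow> (\<exists>M. AE z in lebesgue_on K. \<phi> z \<le> M))"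

text \<open>A function on \<open>G\<close> is represented by its extension by zero, so that equality of members of
  the space is equality of functions on \<open>G\<close> and the space is closed under pointwise operations.\<close>

definition bergman ::
  "(complex^'n) set \<Rightarrow> (complex^'n \<Rightarrow> real) \<Rightarrow> (complex^'n \<Rightarrow> complex) set" where
  "bergman G \<phi> =
     {f. holomorphic_fun_on f G \<and> (\<forall>z. z \<notin> G \<longrightarrow> f z = 0) \<and>
         integrable (lebesgue_on G) (\<lambda>z. (cmod (f z))\<^sup>2 * \<phi> z)}"

definition bergman_inner ::
  "(complex^'n) set \<Rightarrow> (complex^'n \<Rightarrow> real) \<Rightarrow>
   (complex^'n \<Rightarrow> complex) \<Rightarrow> (complex^'n \<Rightarrow> complex) \<Rightarrow> complex" where
  "bergman_inner G \<phi> f h =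
     (\<integral>z. f z * cnj (h z) * complex_of_real (\<phi> z) \<partial>(lebesgue_on G))"

definition fscale :: "complex \<Rightarrow> ('a \<Rightarrow> complex) \<Rightarrow> ('a \<Rightarrow> complex)" where
  "fscale c f = (\<lambda>z. c * f z)"

lemma vector_space_fscale: "vector_space fscale"
  by unfold_locales (auto simp: fscale_def fun_eq_iff algebra_simps)

text \<open>In what follows \<open>ip\<close> is a complex inner product on a space of complex-valued functions.\<close>

definition ip_norm ::
  "(('a \<Rightarrow> complex) \<Rightarrow> ('a \<Rightarrow> complex) \<Rightarrow> complex) \<Rightarrow> ('a \<Rightarrow> complex) \<Rightarrow> real" where
  "ip_norm ip f = sqrt (Re (ip f f))"

definition ip_complete ::
  "(('a \<Rightarrow> complex) \<Rightarrow> ('a \<Rightarrow> complex) \<Rightarrow> complex) \<Rightarrow> ('a \<Rightarrow> complex) set \<Rightarrow> bool" where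
  "ip_complete ip V \<longleftrightarrow>
     (\<forall>f::nat \<Rightarrow> 'a \<Rightarrow> complex. range f \<subseteq> V \<and>
        (\<forall>e>0. \<exists>N. \<forall>i\<ge>N. \<forall>j\<ge>N. ip_norm ip (f i - f j) < e) \<longrightarrow>
        (\<exists>l\<in>V. (\<lambda>k. ip_norm ip (f k - l)) \<longlonglongrightarrow> 0))"

definition closed_subspace_of ::
  "(('a \<Rightarrow> complex) \<Rightarrow> ('a \<Rightarrow> complex) \<Rightarrow> complex) \<Rightarrow>
   ('a \<Rightarrow> complex) set \<Rightarrow> ('a \<Rightarrow> complex) set \<Rightarrow> bool" where
  "closed_subspace_of ip V W \<longleftrightarrow>
     module.subspace fscale W \<and> W \<subseteq> V \<and>
     (\<forall>f::nat \<Rightarrow> 'a \<Rightarrow> complex. \<forall>l\<in>V.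
        range f \<subseteq> W \<and> (\<lambda>k. ip_norm ip (f k - l)) \<longlonglongrightarrow> 0 \<longrightarrow> l \<in> W)"

definition linear_operator_on ::
  "('a \<Rightarrow> complex) set \<Rightarrow> ('b \<Rightarrow> complex) set \<Rightarrow>
   (('a \<Rightarrow> complex) \<Rightarrow> ('b \<Rightarrow> complex)) \<Rightarrow> bool" where
  "linear_operator_on V W T \<longleftrightarrow>
     T \<in> V \<rightarrow> W \<and> (\<forall>f\<in>V. \<forall>h\<in>V. T (f + h) = T f + T h) \<and>
     (\<forall>c. \<forall>f\<in>V. T (fscale c f) = fscale c (T f))"

definition isometric_isomorphism ::
  "(('a \<Rightarrow> complex) \<Rightarrow> ('a \<Rightarrow> complex) \<Rightarrow> complex) \<Rightarrow> ('a \<Rightarrow> complex) set \<Rightarrow>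
   (('b \<Rightarrow> complex) \<Rightarrow> ('b \<Rightarrow> complex) \<Rightarrow> complex) \<Rightarrow> ('b \<Rightarrow> complex) set \<Rightarrow>
   (('a \<Rightarrow> complex) \<Rightarrow> ('b \<Rightarrow> complex)) \<Rightarrow> bool" where
  "isometric_isomorphism ip V ip' W T \<longleftrightarrow>
     linear_operator_on V W T \<and> bij_betw T V W \<and>
     (\<forall>f\<in>V. \<forall>h\<in>V. ip' (T f) (T h) = ip f h)"

definition orthogonal_projection ::
  "(('a \<Rightarrow> complex) \<Rightarrow> ('a \<Rightarrow> complex) \<Rightarrow> complex) \<Rightarrow> ('a \<Rightarrow> complex) set \<Rightarrow>
   ('a \<Rightarrow> complex) set \<Rightarrow> (('a \<Rightarrow> complex) \<Rightarrow> ('a \<Rightarrow> complex)) \<Rightarrow> bool" where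
  "orthogonal_projection ip V W P \<longleftrightarrow>
     (\<forall>g\<in>V. P g \<in> W \<and> (\<forall>h\<in>W. ip (g - P g) h = 0))"

definition Gamma_op ::
  "(complex^'n) set \<Rightarrow> (complex^'n \<Rightarrow> complex^'n) \<Rightarrow> nat \<Rightarrow>
   (complex^'n \<Rightarrow> complex) \<Rightarrow> (complex^'n \<Rightarrow> complex)" where
  "Gamma_op D p m f =
     (\<lambda>z. if z \<in> D then 1 / complex_of_real (sqrt (real m)) * f (p z) * cjacobian p z else 0)"

end

(*
By the change of variables formula, |J\<pi>|^2 is the real Jacobian of \<pi> and each regular
value has m preimages, so \<Gamma> preserves inner products. The same formula gives <g, \<Gamma>
h> = <F, h> / sqrt m with the fibre sum F(w) = (sum of g / J\<pi> over the fibre of w), so F /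
sqrt m is the adjoint \<Gamma>* g and the projection is \<Gamma> \<Gamma>* g; writing the fibre as
the values of the local inverses gives the stated formula.

The point is that F, defined off the critical values, extends holomorphically to G. No removable
singularity theorem is used. For a radial bump b_l supported in the ball |x| < l^(-1/2), put
T_l(w) = integral of g(z) conj(J\<pi>(z)) b_l(\<pi>(z) - w) over D. On regular values this is the
convolution of F with b_l. By the Piola identity for the conjugated cofactors of the Jacobian
matrix, conj(J\<pi>) (d\<psi>/d(conj w_k))(\<pi>(z)) is a sum of derivatives d/d(conj z_j) of
compactly supported functions, so its integral against the holomorphic g vanishes. Applied to
\<psi> = b_l this says that T_l is holomorphic; applied to d b_l / d l, which is a sum of
derivatives d/d(conj w_k), it says that T_l does not depend on l. Hence T_l extends F up to the
mass of b_l.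
*)
theory Submission
  imports Defs "HOL-Complex_Analysis.Complex_Analysis"
begin

text \<open>A priori the Jacobian could vanish identically and \<open>m\<close> could be 0, leaving
  \<open>1 / m\<close> meaningless. Excluding this is a separate argument: a perturbation of \<pi>
  combined with the same invariance in \<open>l\<close>. For this reason the mollified trace is set
  up for any open set and holomorphic map with compact preimages of balls; for the identity map it
  also shows that the mass of the bump is constant in \<open>l\<close>. That the extended fibre sum
  lies in the weighted space comes from Cauchy-Schwarz on each fibre of \<open>m\<close> points,
  followed by the change of variables. With the adjoint explicit, the projection and the closedness
  of the image follow by elementary inner product arguments. The bump is a power of \<open>l\<close>
  times the square of the positive part of \<open>1 - l * |x|^2\<close>: the square makes it C^1,
  enough for one integration by parts, and the power keeps its mass fixed. Holomorphy is defined as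
  pointwise complex differentiability; the symmetry of second derivatives, on which the Piola
  identity rests, comes from Cauchy's formula on complex lines.\<close>

no_notation fps_nth (infixl "$" 75)

subsection \<open>Differentiation under the integral sign\<close>

lemma has_derivative_directional_limit:
  fixes f :: "'a::real_normed_vector \<Rightarrow> 'b::real_normed_vector"
  assumes "(f has_derivative f') (at x)"
  shows "((\<lambda>t. (f (x + t *\<^sub>R h) - f x) /\<^sub>R t) \<longlongrightarrow> f' h) (at (0::real))"
proof -
  interpret f': bounded_linear f' using assms by (rule has_derivative_bounded_linear)
  have "((\<lambda>t. x + t *\<^sub>R h) has_derivative (\<lambda>t. t *\<^sub>R h)) (at 0)"
    by (auto intro!: derivative_eq_intros)
  from has_derivative_compose[OF this, of f f'] assms
  have "((\<lambda>t. f (x + t *\<^sub>R h)) has_derivative (\<lambda>t. t *\<^sub>R f' h)) (at (0::real))"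
    by (simp add: f'.scaleR)
  then have "((\<lambda>t. norm (f (x + t *\<^sub>R h) - f x - t *\<^sub>R f' h) / norm t) \<longlongrightarrow> 0) (at (0::real))"
    by (simp add: has_derivative_iff_norm)
  moreover have "eventually (\<lambda>t. norm (f (x + t *\<^sub>R h) - f x - t *\<^sub>R f' h) / norm t
      = norm ((f (x + t *\<^sub>R h) - f x) /\<^sub>R t - f' h)) (at (0::real))"
    unfolding eventually_at_filter
  proof (intro always_eventually allI impI)
    fix t :: real assume "t \<noteq> 0"
    then have "(f (x + t *\<^sub>R h) - f x) /\<^sub>R t - f' h = (f (x + t *\<^sub>R h) - f x - t *\<^sub>R f' h) /\<^sub>R t"
      by (simp add: scaleR_diff_right)
    then show "norm (f (x + t *\<^sub>R h) - f x - t *\<^sub>R f' h) / norm t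
      = norm ((f (x + t *\<^sub>R h) - f x) /\<^sub>R t - f' h)"
      by (simp add: divide_inverse mult.commute)
  qed
  ultimately have "((\<lambda>t. norm ((f (x + t *\<^sub>R h) - f x) /\<^sub>R t - f' h)) \<longlongrightarrow> 0) (at (0::real))"
    by (rule Lim_transform_eventually)
  then show ?thesis
    by (simp add: tendsto_norm_zero_iff LIM_zero_iff)
qed

text \<open>The Lipschitz bound at the single point \<open>a\<close> passes to the directional
  limits. Through it the dominating function \<open>L\<close> below controls the derivative as well
  as the increments.\<close>

lemma has_derivative_norm_le:
  fixes f :: "'a::real_normed_vector \<Rightarrow> 'b::real_normed_vector"
  assumes der: "(f has_derivative f') (at a)" and "e > 0"
    and lip: "\<And>x. dist x a < e \<Longrightarrow> norm (f x - f a) \<le> L * norm (x - a)"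
  shows "norm (f' h) \<le> L * norm h"
proof (cases "h = 0")
  case True
  then show ?thesis using has_derivative_linear[OF der] by (simp add: linear_0)
next
  case False
  have lim: "((\<lambda>t. norm ((f (a + t *\<^sub>R h) - f a) /\<^sub>R t)) \<longlongrightarrow> norm (f' h)) (at (0::real))"
    by (intro tendsto_norm has_derivative_directional_limit der)
  have "eventually (\<lambda>t::real. t \<in> ball 0 (e / norm h) - {0}) (at 0)"
    using \<open>e > 0\<close> False by (intro eventually_at_in_open) auto
  then have "eventually (\<lambda>t. norm ((f (a + t *\<^sub>R h) - f a) /\<^sub>R t) \<le> L * norm h) (at (0::real))"
  proof eventually_elim
    case (elim t)
    then have "norm (f (a + t *\<^sub>R h) - f a) \<le> L * norm (t *\<^sub>R h)"
      using lip[of "a + t *\<^sub>R h"] False by (simp add: dist_norm field_simps)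
    moreover have "norm ((f (a + t *\<^sub>R h) - f a) /\<^sub>R t) = norm (f (a + t *\<^sub>R h) - f a) / \<bar>t\<bar>"
      by (simp add: divide_inverse mult.commute)
    moreover have "0 < \<bar>t\<bar>" using elim by auto
    ultimately show ?case by (simp only: pos_divide_le_eq) (simp add: algebra_simps)
  qed
  with lim show ?thesis
    by (rule tendsto_upperbound) simp
qed

text \<open>Difference quotients are dominated by \<open>L\<close>, so dominated convergence applies
  along every sequence tending to \<open>a\<close>. The Lipschitz hypothesis compares with the base
  point only, so derivatives at other points never enter.\<close>

lemma has_derivative_integral_dominated:
  fixes k :: "'a::real_normed_vector \<Rightarrow> 'b \<Rightarrow> 'c::{banach, second_countable_topology}"
  assumes "e > 0"
    and int: "\<And>x. dist x a < e \<Longrightarrow> integrable M (k x)"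
    and der: "\<And>z. z \<in> space M \<Longrightarrow> ((\<lambda>x. k x z) has_derivative k' z) (at a)"
    and L: "integrable M L"
    and lip: "\<And>x z. dist x a < e \<Longrightarrow> z \<in> space M \<Longrightarrow> norm (k x z - k a z) \<le> L z * norm (x - a)"
  shows "\<And>h. integrable M (\<lambda>z. k' z h)"
    and "((\<lambda>x. \<integral>z. k x z \<partial>M) has_derivative (\<lambda>h. \<integral>z. k' z h \<partial>M)) (at a)"
proof -
  have bd: "norm (k' z h) \<le> L z * norm h" if "z \<in> space M" for z h
    by (rule has_derivative_norm_le[OF der[OF that] \<open>e > 0\<close>]) (use lip that in auto)
  have a: "integrable M (k a)" using int \<open>e > 0\<close> by auto
  have meas: "(\<lambda>z. k' z h) \<in> borel_measurable M" for h
  proof -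
    \<comment> \<open>Measurability of the derivative comes from a sequential limit of difference
      quotients; the shift by \<open>N\<close> keeps the sample points in the ball where
      \<open>k\<close> is integrable.\<close>
    obtain N where N: "inverse (real (Suc n)) * norm h < e" if "n \<ge> N" for n
    proof -
      have "(\<lambda>n. inverse (real (Suc n)) * norm h) \<longlonglongrightarrow> 0 * norm h"
        by (intro tendsto_intros LIMSEQ_inverse_real_of_nat)
      then have "eventually (\<lambda>n. inverse (real (Suc n)) * norm h < e) sequentially"
        using \<open>e > 0\<close> by (auto dest: order_tendstoD)
      then show ?thesis using that by (auto simp: eventually_sequentially)
    qed
    let ?t = "\<lambda>n. inverse (real (Suc (n + N)))"
    have "(\<lambda>n. (k (a + ?t n *\<^sub>R h) z - k a z) /\<^sub>R ?t n) \<longlonglongrightarrow> k' z h" if z: "z \<in> space M" for z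
    proof -
      have lim: "((\<lambda>t. (k (a + t *\<^sub>R h) z - k a z) /\<^sub>R t) \<longlongrightarrow> k' z h) (at (0::real))"
        using has_derivative_directional_limit[OF der[OF z]] .
      have "filterlim ?t (at 0) sequentially"
        unfolding filterlim_at
        using LIMSEQ_ignore_initial_segment[OF LIMSEQ_inverse_real_of_nat, of N] by auto
      from filterlim_compose[OF lim this] show ?thesis .
    qed
    moreover have "(\<lambda>z. (k (a + ?t n *\<^sub>R h) z - k a z) /\<^sub>R ?t n) \<in> borel_measurable M" for n
      using int[of "a + ?t n *\<^sub>R h"] a N[of "n + N"] by (auto simp: dist_norm)
    ultimately show ?thesis
      by (rule borel_measurable_LIMSEQ_metric[rotated])
  qed
  show int': "integrable M (\<lambda>z. k' z h)" for h
    by (rule Bochner_Integration.integrable_bound[OF integrable_mult_left[OF L, of "norm h"] meas])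
       (use bd in \<open>auto intro!: AE_I2 order.trans[OF _ abs_ge_self]\<close>)
  have lin: "bounded_linear (\<lambda>h. \<integral>z. k' z h \<partial>M)"
  proof (rule bounded_linear_intro[where K = "\<integral>z. L z \<partial>M"])
    fix h h' :: 'a and c :: real
    have "(\<integral>z. k' z (h + h') \<partial>M) = (\<integral>z. k' z h + k' z h' \<partial>M)"
      by (rule Bochner_Integration.integral_cong)
         (auto simp: linear_add[OF has_derivative_linear[OF der]])
    then show "(\<integral>z. k' z (h + h') \<partial>M) = (\<integral>z. k' z h \<partial>M) + (\<integral>z. k' z h' \<partial>M)"
      by (simp add: int')
    have "(\<integral>z. k' z (c *\<^sub>R h) \<partial>M) = (\<integral>z. c *\<^sub>R k' z h \<partial>M)"
      by (rule Bochner_Integration.integral_cong)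
         (auto simp: linear_cmul[OF has_derivative_linear[OF der]])
    then show "(\<integral>z. k' z (c *\<^sub>R h) \<partial>M) = c *\<^sub>R (\<integral>z. k' z h \<partial>M)"
      by simp
    have "norm (\<integral>z. k' z h \<partial>M) \<le> (\<integral>z. norm (k' z h) \<partial>M)"
      by (rule integral_norm_bound)
    also have "\<dots> \<le> (\<integral>z. L z * norm h \<partial>M)"
      by (rule integral_mono) (use bd int' L in auto)
    finally have "norm (\<integral>z. k' z h \<partial>M) \<le> (\<integral>z. L z * norm h \<partial>M)" .
    then show "norm (\<integral>z. k' z h \<partial>M) \<le> norm h * (\<integral>z. L z \<partial>M)"
      by (simp add: mult.commute)
  qed
  have "((\<lambda>y. ((\<integral>z. k y z \<partial>M) - (\<integral>z. k a z \<partial>M) - (\<integral>z. k' z (y - a) \<partial>M)) /\<^sub>R norm (y - a)) \<longlongrightarrow> 0) (at a)"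
    unfolding tendsto_at_iff_sequentially comp_def
  proof (intro allI impI)
    fix y :: "nat \<Rightarrow> 'a" assume y: "\<forall>i. y i \<in> UNIV - {a}" "y \<longlonglongrightarrow> a"
    obtain N where N: "dist (y n) a < e" if "n \<ge> N" for n
      using y(2) \<open>e > 0\<close> unfolding lim_sequentially by blast
    define q where "q = (\<lambda>n z. (k (y (n + N)) z - k a z - k' z (y (n + N) - a)) /\<^sub>R norm (y (n + N) - a))"
    have iq: "(\<integral>z. q n z \<partial>M) = ((\<integral>z. k (y (n + N)) z \<partial>M) - (\<integral>z. k a z \<partial>M) - (\<integral>z. k' z (y (n + N) - a) \<partial>M)) /\<^sub>R norm (y (n + N) - a)" for n
      unfolding q_def using int[OF N[of "n + N"]] a int' by simp
    have "(\<lambda>n. \<integral>z. q n z \<partial>M) \<longlonglongrightarrow> (\<integral>z. 0 \<partial>M)"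
    proof (rule integral_dominated_convergence[where w = "\<lambda>z. 2 * L z"])
      show "q n \<in> borel_measurable M" for n
        unfolding q_def using int[OF N[of "n + N"]] a int' by (intro measurable) auto
      show "integrable M (\<lambda>z. 2 * L z)" using L by simp
      show "AE z in M. (\<lambda>n. q n z) \<longlonglongrightarrow> 0"
      proof (rule AE_I2)
        fix z assume z: "z \<in> space M"
        have "((\<lambda>y. (k y z - k a z - k' z (y - a)) /\<^sub>R norm (y - a)) \<longlongrightarrow> 0) (at a)"
          using der[OF z] by (simp add: has_derivative_at_within)
        then show "(\<lambda>n. q n z) \<longlonglongrightarrow> 0"
          unfolding q_def tendsto_at_iff_sequentially comp_def using y
            LIMSEQ_ignore_initial_segment[OF y(2), of N] by auto
      qed
      \<comment> \<open>One \<open>L\<close> bounds the increment, the other the linear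
        part.\<close>
      show "AE z in M. norm (q n z) \<le> 2 * L z" for n
      proof (rule AE_I2)
        fix z assume z: "z \<in> space M"
        let ?d = "norm (y (n + N) - a)"
        have "norm (k (y (n + N)) z - k a z - k' z (y (n + N) - a)) \<le> L z * ?d + L z * ?d"
          by (rule order.trans[OF norm_triangle_ineq4 add_mono[OF lip bd]]) (use N z in auto)
        moreover have "?d > 0" using y(1) by auto
        moreover have "norm (q n z) = norm (k (y (n + N)) z - k a z - k' z (y (n + N) - a)) / ?d"
          by (simp add: q_def divide_inverse mult.commute)
        ultimately show "norm (q n z) \<le> 2 * L z"
          by (simp only: pos_divide_le_eq)
      qed
    qed simp
    then have "(\<lambda>n. ((\<integral>z. k (y (n + N)) z \<partial>M) - (\<integral>z. k a z \<partial>M) - (\<integral>z. k' z (y (n + N) - a) \<partial>M)) /\<^sub>R norm (y (n + N) - a)) \<longlonglongrightarrow> 0"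
      by (simp add: iq)
    then show "(\<lambda>n. ((\<integral>z. k (y n) z \<partial>M) - (\<integral>z. k a z \<partial>M) - (\<integral>z. k' z (y n - a) \<partial>M)) /\<^sub>R norm (y n - a)) \<longlonglongrightarrow> 0"
      by (rule LIMSEQ_offset)
  qed
  then show "((\<lambda>x. \<integral>z. k x z \<partial>M) has_derivative (\<lambda>h. \<integral>z. k' z h \<partial>M)) (at a)"
    using lin by (simp add: has_derivative_at_within)
qed

subsection \<open>Holomorphic functions of several variables\<close>

lemma norm_vector_smult: "norm (c *s v) = cmod c * norm v" for v :: "complex^'n"
  by (simp add: norm_vec_def L2_set_def norm_mult power_mult_distrib sum_distrib_left[symmetric] real_sqrt_mult)

lemma scaleR_eq_vector_smult: "r *\<^sub>R v = complex_of_real r *s v" for v :: "complex^'n"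
  by (simp only: vec_eq_iff vector_scaleR_component vector_smult_component) (simp add: scaleR_conv_of_real)

lemma bounded_linear_vector_smult: "bounded_linear (\<lambda>t. t *s v)" for v :: "complex^'n"
  by (rule bounded_linear_intro[where K = "norm v"])
     (simp_all add: vector_sadd_rdistrib scaleR_eq_vector_smult norm_vector_smult
        scaleR_conv_of_real vector_smult_assoc)

lemmas continuous_on_vector_smult [continuous_intros] =
  bounded_linear.continuous_on[OF bounded_linear_vector_smult]

lemma linear_vector_smult_iff:
  "Vector_Spaces.linear (*s) (*) f' \<longleftrightarrow> (\<forall>v w. f' (v + w) = f' v + f' w) \<and> (\<forall>c v. f' (c *s v) = c * f' v)"
  for f' :: "complex^'n \<Rightarrow> complex"
  by (simp add: Vector_Spaces.linear_def module_hom_def module_hom_axioms_def vec.vector_space_axioms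
      vec.module_axioms vector_space_def module_def algebra_simps)

text \<open>Fixing the direction keeps the result a scalar function on the same space, so
  derivatives can be iterated and tested for holomorphy again.\<close>

definition ddir :: "(complex^'n \<Rightarrow> complex) \<Rightarrow> complex^'n \<Rightarrow> complex^'n \<Rightarrow> complex" where
  "ddir f v z = frechet_derivative f (at z) v"

lemma ddir_eqI: "(f has_derivative f') (at z) \<Longrightarrow> ddir f v z = f' v"
  by (simp add: ddir_def frechet_derivative_at[symmetric])

lemma holomorphic_fun_onI:
  assumes "\<And>z. z \<in> S \<Longrightarrow> (f has_derivative f' z) (at z)"
    and "\<And>z c v. z \<in> S \<Longrightarrow> f' z (c *s v) = c * f' z v"
  shows "holomorphic_fun_on f S"
  unfolding holomorphic_fun_on_def linear_vector_smult_iff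
  using assms by (metis has_derivative_linear linear_add)

lemma ddir_has_derivative:
  assumes "holomorphic_fun_on f S" "z \<in> S"
  shows "(f has_derivative (\<lambda>v. ddir f v z)) (at z)"
  using assms unfolding holomorphic_fun_on_def ddir_def
  by (metis frechet_derivative_at)

lemma ddir_smult:
  assumes "holomorphic_fun_on f S" "z \<in> S"
  shows "ddir f (c *s v) z = c * ddir f v z"
  using assms unfolding holomorphic_fun_on_def linear_vector_smult_iff
  by (metis ddir_eqI)

lemma ddir_add:
  assumes "holomorphic_fun_on f S" "z \<in> S"
  shows "ddir f (v + w) z = ddir f v z + ddir f w z"
  using ddir_has_derivative[OF assms] has_derivative_linear linear_add by blast

lemma ddir_expand:
  assumes "holomorphic_fun_on f S" "z \<in> S"
  shows "ddir f v z = (\<Sum>j\<in>UNIV. v $ j * ddir f (axis j 1) z)"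
proof -
  have lin: "linear (\<lambda>v. ddir f v z)"
    using ddir_has_derivative[OF assms] by (rule has_derivative_linear)
  have "v = (\<Sum>j\<in>UNIV. v $ j *s axis j 1)"
    by (simp add: basis_expansion)
  then have "ddir f v z = ddir f (\<Sum>j\<in>UNIV. v $ j *s axis j 1) z" by simp
  also have "\<dots> = (\<Sum>j\<in>UNIV. ddir f (v $ j *s axis j 1) z)"
    using linear_sum[OF lin] by blast
  finally show ?thesis by (simp add: ddir_smult[OF assms])
qed

lemma holomorphic_fun_on_imp_continuous_on:
  "holomorphic_fun_on f S \<Longrightarrow> continuous_on S f"
  by (meson continuous_at_imp_continuous_on ddir_has_derivative has_derivative_continuous)

lemma holomorphic_fun_on_transform:
  assumes "holomorphic_fun_on f S" "open S" "\<And>z. z \<in> S \<Longrightarrow> f z = g z"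
  shows "holomorphic_fun_on g S"
proof (rule holomorphic_fun_onI[where f' = "\<lambda>z v. ddir f v z"])
  show "(g has_derivative (\<lambda>v. ddir f v z)) (at z)" if "z \<in> S" for z
    using has_derivative_transform_within_open[OF ddir_has_derivative[OF assms(1) that] assms(2) that]
      assms(3) by blast
qed (simp add: ddir_smult[OF assms(1)])

section \<open>Cauchy's formula on complex lines and its consequences\<close>

lemma has_field_derivative_line:
  assumes "holomorphic_fun_on f S" "z + t *s v \<in> S"
  shows "((\<lambda>t. f (z + t *s v)) has_field_derivative ddir f v (z + t *s v)) (at t)"
proof -
  have "((\<lambda>t. z + t *s v) has_derivative (\<lambda>t. t *s v)) (at t)"
    using has_derivative_add[OF has_derivative_const
        bounded_linear.has_derivative[OF bounded_linear_vector_smult has_derivative_ident]] by simp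
  from has_derivative_compose[OF this ddir_has_derivative[OF assms]]
  show ?thesis
    by (simp add: has_field_derivative_def ddir_smult[OF assms] mult_commute_abs)
qed

text \<open>Cauchy's formula for the derivative at 0 of the one-variable function sending
  \<open>t\<close> to \<open>f (z + t *s v)\<close>. Parametrizing the circle over [0,1] absorbs
  \<open>2 * pi * \<i>\<close> and yields a parameter integral that can be differentiated in
  \<open>z\<close>.\<close>

lemma ddir_Cauchy:
  assumes f: "holomorphic_fun_on f S" and S: "open S" and r: "r > 0"
    and sub: "\<And>t. cmod t \<le> r \<Longrightarrow> z + t *s v \<in> S"
  shows "integrable (lebesgue_on {0..1})
           (\<lambda>x. f (z + (r * cis (2 * pi * x)) *s v) * (cis (- (2 * pi * x)) / r))" (is "integrable _ ?k")
    and "ddir f v z = (\<integral>x. f (z + (r * cis (2 * pi * x)) *s v) * (cis (- (2 * pi * x)) / r) \<partial>lebesgue_on {0..1})"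
proof -
  let ?g = "\<lambda>t. f (z + t *s v)"
  define T where "T = (\<lambda>t. z + t *s v) -` S"
  have "open T"
    unfolding T_def using S by (rule open_vimage) (intro continuous_intros)
  have der: "(?g has_field_derivative ddir f v (z + t *s v)) (at t)" if "t \<in> T" for t
    using has_field_derivative_line[OF f] that by (simp add: T_def)
  have hol: "?g holomorphic_on T"
    using der by (auto simp: holomorphic_on_open[OF \<open>open T\<close>])
  have cb: "cball 0 r \<subseteq> T" using sub by (auto simp: T_def)
  have dv: "deriv ?g 0 = ddir f v z"
  proof -
    have "0 \<in> T" using cb r by auto
    then show ?thesis using DERIV_imp_deriv[OF der[of 0]] by simp
  qed
  have cont: "continuous_on {0..1} ?k"
  proof -
    have "continuous_on ((\<lambda>x. r * cis (2 * pi * x)) ` {0..1}) ?g"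
      by (rule continuous_on_subset[OF holomorphic_on_imp_continuous_on[OF hol]])
        (use r cb in \<open>auto simp: norm_mult image_subset_iff subset_iff\<close>)
    from continuous_on_compose[OF _ this]
    have "continuous_on {0..1} (\<lambda>x. ?g (r * cis (2 * pi * x)))"
      by (simp add: o_def continuous_intros)
    then show ?thesis using r by (intro continuous_intros) auto
  qed
  show int: "integrable (lebesgue_on {0..1}) ?k"
    by (rule continuous_imp_integrable_real[OF cont])
  have "contour_integral (circlepath 0 r) (\<lambda>u. ?g u / (u - 0)\<^sup>2) = 2 * pi * \<i> * deriv ?g 0"
  proof (rule Cauchy_contour_integral_circlepath_2)
    show "continuous_on (cball 0 r) ?g"
      using holomorphic_on_imp_continuous_on[OF hol] cb by (rule continuous_on_subset)
    show "?g holomorphic_on ball 0 r"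
      using hol cb by (meson ball_subset_cball holomorphic_on_subset subset_trans)
  qed (use r in auto)
  also have "contour_integral (circlepath 0 r) (\<lambda>u. ?g u / (u - 0)\<^sup>2) = integral {0..1} (\<lambda>x. 2 * pi * \<i> * ?k x)"
    unfolding contour_integral_integral
  proof (rule integral_cong)
    fix x :: real
    have e: "exp (2 * of_real pi * \<i> * of_real x) = cis (2 * pi * x)"
      by (simp add: cis_conv_exp mult_ac)
    have "cis (2 * pi * x) / (cis (2 * pi * x))\<^sup>2 = cis (- (2 * pi * x))"
      by (simp add: power2_eq_square cis_inverse[symmetric] field_simps)
    then have "(2 * pi * \<i> * r * cis (2 * pi * x)) / (r * cis (2 * pi * x))\<^sup>2 = 2 * pi * \<i> * (cis (- (2 * pi * x)) / r)"
      using r by (simp add: power2_eq_square field_simps)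
    moreover have "circlepath 0 r x = r * cis (2 * pi * x)"
      by (simp only: circlepath e) simp
    moreover have "vector_derivative (circlepath 0 r) (at x) = 2 * pi * \<i> * r * cis (2 * pi * x)"
      by (simp only: vector_derivative_circlepath e)
    ultimately show "?g (circlepath 0 r x) / (circlepath 0 r x - 0)\<^sup>2 * vector_derivative (circlepath 0 r) (at x) = 2 * pi * \<i> * ?k x"
      by (simp only: times_divide_eq_left diff_zero) (metis (no_types, lifting) mult.left_commute times_divide_eq_right)
  qed
  also have "\<dots> = 2 * pi * \<i> * integral {0..1} ?k"
    by simp
  finally have "integral {0..1} ?k = ddir f v z"
    by (simp only: dv mult_cancel_left) simp
  then show "ddir f v z = (\<integral>x. ?k x \<partial>lebesgue_on {0..1})"
    by (subst lebesgue_integral_eq_integral[OF int]) auto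
qed

lemma ddir_bound:
  assumes f: "holomorphic_fun_on f S" and S: "open S" and r: "r > 0"
    and sub: "cball z r \<subseteq> S" and B: "\<And>y. y \<in> cball z r \<Longrightarrow> cmod (f y) \<le> B"
  shows "cmod (ddir f v z) \<le> B / r * norm v"
proof (cases "v = 0")
  case True
  have "z \<in> S" using sub r by auto
  then show ?thesis using True linear_0[OF has_derivative_linear[OF ddir_has_derivative[OF f]]] by auto
next
  case False
  \<comment> \<open>With this radius the circle on the complex line stays in
    \<open>cball z r\<close>, and \<open>1 / s\<close> produces the factor
    \<open>norm v\<close>.\<close>
  define s where "s = r / norm v"
  have s: "s > 0" using False r by (simp add: s_def)
  have in_cb: "z + t *s v \<in> cball z r" if "cmod t \<le> s" for t
    using that False by (simp add: s_def dist_norm norm_vector_smult field_simps)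
  let ?k = "\<lambda>x. f (z + (s * cis (2 * pi * x)) *s v) * (cis (- (2 * pi * x)) / s)"
  have C: "integrable (lebesgue_on {0..1}) ?k" "ddir f v z = (\<integral>x. ?k x \<partial>lebesgue_on {0..1})"
    using ddir_Cauchy[OF f S s, of z v] subsetD[OF sub in_cb] by blast+
  have "cmod (ddir f v z) \<le> (\<integral>x. cmod (?k x) \<partial>lebesgue_on {0..1})"
    by (subst C(2)) (rule integral_norm_bound)
  also have "\<dots> \<le> (\<integral>x. B / s \<partial>lebesgue_on {0..1::real})"
  proof (rule integral_mono)
    show "integrable (lebesgue_on {0..1}) (\<lambda>x. cmod (?k x))"
      using C(1) by (rule integrable_norm)
    show "integrable (lebesgue_on {0..1::real}) (\<lambda>x. B / s)"
      by (rule continuous_imp_integrable_real) simp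
    show "cmod (?k x) \<le> B / s" for x
      using B[OF in_cb[of "s * cis (2 * pi * x)"]] s
      by (simp add: norm_mult norm_divide divide_right_mono)
  qed
  also have "\<dots> = B / r * norm v"
    using False r by (simp add: s_def measure_restrict_space)
  finally show ?thesis .
qed

text \<open>Continuity bounds \<open>f\<close> on a compact ball; the Cauchy estimate turns this
  into a bound on derivatives over half the radius, and convexity of the ball gives the Lipschitz
  bound.\<close>

lemma holomorphic_fun_on_locally_Lipschitz:
  assumes f: "holomorphic_fun_on f S" and S: "open S" and z: "z \<in> S"
  obtains r B where "r > 0" "B \<ge> 0" "cball z r \<subseteq> S"
    "\<And>y v. y \<in> cball z r \<Longrightarrow> cmod (ddir f v y) \<le> B * norm v"
    "\<And>x y. x \<in> cball z r \<Longrightarrow> y \<in> cball z r \<Longrightarrow> cmod (f x - f y) \<le> B * norm (x - y)"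
proof -
  obtain e where e: "e > 0" "cball z e \<subseteq> S"
    using S z open_contains_cball by blast
  have "compact (f ` cball z e)"
    using holomorphic_fun_on_imp_continuous_on[OF f] e
    by (intro compact_continuous_image) (auto intro: continuous_on_subset)
  then obtain M where M: "M > 0" "\<And>y. y \<in> cball z e \<Longrightarrow> cmod (f y) \<le> M"
    using compact_imp_bounded bounded_pos by (metis image_eqI)
  define r where "r = e / 2"
  have r: "r > 0" using e by (simp add: r_def)
  have cb: "cball y r \<subseteq> cball z e" if "y \<in> cball z r" for y
  proof
    fix x assume "x \<in> cball y r"
    then show "x \<in> cball z e"
      using that dist_triangle[of z x y] by (simp add: r_def)
  qed
  have 1: "cmod (ddir f v y) \<le> M / r * norm v" if "y \<in> cball z r" for y v
    by (rule ddir_bound[OF f S r]) (use cb[OF that] e M in auto)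
  have 2: "cmod (f x - f y) \<le> M / r * norm (x - y)" if "x \<in> cball z r" "y \<in> cball z r" for x y
  proof (rule differentiable_bound[where S = "cball z r"])
    show "(f has_derivative (\<lambda>v. ddir f v x)) (at x within cball z r)" if "x \<in> cball z r" for x
    proof (rule has_derivative_at_withinI[OF ddir_has_derivative[OF f]])
      show "x \<in> S" using centre_in_cball[of x r] cb[OF that] e(2) r by (meson less_imp_le subsetD)
    qed
    show "onorm (\<lambda>v. ddir f v x) \<le> M / r" if "x \<in> cball z r" for x
      by (rule onorm_le) (rule 1[OF that])
  qed (fact that convex_cball)+
  have "cball z r \<subseteq> S" using e r by (auto simp: r_def)
  show ?thesis
  proof (rule that[of r "M / r"])
    show "0 \<le> M / r" using r M(1) by simp
  qed fact+
qed

text \<open>Both claims come from differentiating Cauchy's formula for \<open>ddir f v\<close> in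
  its centre under the integral sign. The result at \<open>h\<close> is the Cauchy integral of
  \<open>ddir f h\<close> in direction \<open>v\<close>: it is complex linear in \<open>h\<close>,
  hence holomorphy, and once that is known it equals \<open>ddir (ddir f h) v\<close>, hence
  symmetry.\<close>

lemma
  assumes f: "holomorphic_fun_on f S" and S: "open S"
  shows holomorphic_ddir: "holomorphic_fun_on (ddir f v) S"
    and ddir_commute: "z \<in> S \<Longrightarrow> ddir (ddir f v) w z = ddir (ddir f w) v z"
proof -
  have *: "\<exists>s>0. (\<forall>t. cmod t \<le> s \<longrightarrow> z + t *s v \<in> S) \<and> (ddir f v has_derivative
      (\<lambda>h. \<integral>x. ddir f h (z + (s * cis (2 * pi * x)) *s v) * (cis (- (2 * pi * x)) / s) \<partial>lebesgue_on {0..1})) (at z)"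
    if z: "z \<in> S" for z v
  proof -
    obtain r B where rB: "r > 0" "B \<ge> 0" "cball z r \<subseteq> S"
      "\<And>y v. y \<in> cball z r \<Longrightarrow> cmod (ddir f v y) \<le> B * norm v"
      "\<And>x y. x \<in> cball z r \<Longrightarrow> y \<in> cball z r \<Longrightarrow> cmod (f x - f y) \<le> B * norm (x - y)"
      using holomorphic_fun_on_locally_Lipschitz[OF f S z] by blast
    \<comment> \<open>Adding 1 covers \<open>v = 0\<close>. The choice gives
      \<open>s * norm v \<le> r / 2\<close>, so the circles about all centres within
      \<open>r / 2\<close> of \<open>z\<close> stay in the Lipschitz ball.\<close>
    define s where "s = r / 2 / (norm v + 1)"
    have s: "s > 0" using rB by (simp add: s_def add_nonneg_pos)
    have "s * norm v \<le> s * (norm v + 1)"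
      using s by (intro mult_left_mono) auto
    also have "\<dots> = r / 2"
    proof -
      have "norm v + 1 \<noteq> 0" using norm_ge_zero[of v] by linarith
      then show ?thesis
        unfolding s_def using nonzero_eq_divide_eq by blast
    qed
    finally have sv: "s * norm v \<le> r / 2" .
    have in_cb: "y + t *s v \<in> cball z r" if "dist y z < r / 2" "cmod t \<le> s" for y t
    proof -
      have "norm (t *s v) \<le> r / 2"
        using sv mult_right_mono[OF that(2), of "norm v"] by (simp add: norm_vector_smult)
      moreover have "dist z (y + t *s v) \<le> dist z y + dist y (y + t *s v)"
        by (rule dist_triangle)
      ultimately show ?thesis using that(1) by (simp add: dist_norm norm_minus_commute)
    qed
    let ?c = "\<lambda>x. cis (- (2 * pi * x)) / s"
    let ?k = "\<lambda>y x. f (y + (s * cis (2 * pi * x)) *s v) * ?c x"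
    have cm: "cmod (s * cis (2 * pi * x)) \<le> s" for x using s by (simp add: norm_mult)
    have C: "integrable (lebesgue_on {0..1}) (?k y)" "ddir f v y = (\<integral>x. ?k y x \<partial>lebesgue_on {0..1})"
      if "dist y z < r / 2" for y
      using ddir_Cauchy[OF f S s, of y v] subsetD[OF rB(3) in_cb[OF that]] by blast+
    have "((\<lambda>y. \<integral>x. ?k y x \<partial>lebesgue_on {0..1}) has_derivative
        (\<lambda>h. \<integral>x. ddir f h (z + (s * cis (2 * pi * x)) *s v) * ?c x \<partial>lebesgue_on {0..1})) (at z)"
    proof (rule has_derivative_integral_dominated(2)[where e = "r / 2" and L = "\<lambda>_. B / s"])
      fix x :: real
      show "((\<lambda>y. ?k y x) has_derivative (\<lambda>h. ddir f h (z + (s * cis (2 * pi * x)) *s v) * ?c x)) (at z)"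
      proof (rule has_derivative_mult_left)
        have "z + (s * cis (2 * pi * x)) *s v \<in> S"
          using in_cb[of z, OF _ cm] rB by auto
        from ddir_has_derivative[OF f this]
        show "((\<lambda>y. f (y + (s * cis (2 * pi * x)) *s v)) has_derivative
            (\<lambda>h. ddir f h (z + (s * cis (2 * pi * x)) *s v))) (at z)"
          by (rule has_derivative_compose[rotated]) (auto intro!: derivative_eq_intros)
      qed
      fix y assume y: "dist y z < r / 2"
      have "cmod (f (y + (s * cis (2 * pi * x)) *s v) - f (z + (s * cis (2 * pi * x)) *s v)) \<le> B * norm (y - z)"
        using rB(5)[OF in_cb[OF y cm[of x]] in_cb[of z, OF _ cm[of x]]] rB(1) by simp
      moreover have "cmod (?c x) = 1 / s"
        using s by (simp add: norm_divide)
      ultimately show "cmod (?k y x - ?k z x) \<le> B / s * norm (y - z)"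
        using s by (simp only: left_diff_distrib[symmetric] norm_mult) (simp add: divide_right_mono)
    next
      show "integrable (lebesgue_on {0..1::real}) (\<lambda>_. B / s)"
        by (rule continuous_imp_integrable_real) simp
    qed (use rB C in auto)
    then have "(ddir f v has_derivative
        (\<lambda>h. \<integral>x. ddir f h (z + (s * cis (2 * pi * x)) *s v) * ?c x \<partial>lebesgue_on {0..1})) (at z)"
      by (rule has_derivative_transform_within_open[where s = "ball z (r / 2)"])
         (use rB C in \<open>auto simp: dist_commute\<close>)
    moreover have "z + t *s v \<in> S" if "cmod t \<le> s" for t
      using in_cb[of z t] that rB by auto
    ultimately show ?thesis using s by blast
  qed
  show hol: "holomorphic_fun_on (ddir f v) S" for v
    unfolding holomorphic_fun_on_def linear_vector_smult_iff
  proof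
    fix z assume z: "z \<in> S"
    obtain s where s: "s > 0" "\<And>t. cmod t \<le> s \<Longrightarrow> z + t *s v \<in> S" and
      der: "(ddir f v has_derivative (\<lambda>h. \<integral>x. ddir f h (z + (s * cis (2 * pi * x)) *s v) * (cis (- (2 * pi * x)) / s)
        \<partial>lebesgue_on {0..1})) (at z)" (is "(_ has_derivative ?D) _")
      using *[OF z, of v] by blast
    have "?D (c *s h) = c * ?D h" for c h
    proof -
      have "?D (c *s h) = (\<integral>x. c * (ddir f h (z + (s * cis (2 * pi * x)) *s v) * (cis (- (2 * pi * x)) / s)) \<partial>lebesgue_on {0..1})"
        by (rule Bochner_Integration.integral_cong)
           (use s in \<open>auto simp: ddir_smult[OF f s(2)] norm_mult\<close>)
      then show ?thesis by simp
    qed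
    then show "\<exists>f'. (ddir f v has_derivative f') (at z) \<and>
        (\<forall>v w. f' (v + w) = f' v + f' w) \<and> (\<forall>c v. f' (c *s v) = c * f' v)"
      using der linear_add[OF has_derivative_linear[OF der]] by (intro exI[of _ ?D]) simp
  qed
  show "ddir (ddir f v) w z = ddir (ddir f w) v z" if z: "z \<in> S"
  proof -
    obtain s where s: "s > 0" "\<And>t. cmod t \<le> s \<Longrightarrow> z + t *s v \<in> S" and
      der: "(ddir f v has_derivative (\<lambda>h. \<integral>x. ddir f h (z + (s * cis (2 * pi * x)) *s v) * (cis (- (2 * pi * x)) / s)
        \<partial>lebesgue_on {0..1})) (at z)"
      using *[OF z, of v] by blast
    show ?thesis
      \<comment> \<open>The derivative just computed is Cauchy's formula for the holomorphic
        function \<open>ddir f w\<close> in direction \<open>v\<close>.\<close>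
      unfolding ddir_eqI[OF der] by (rule ddir_Cauchy(2)[OF hol S s, symmetric])
  qed
qed

section \<open>Algebraic operations and determinants of holomorphic functions\<close>

lemma holomorphic_fun_on_const: "holomorphic_fun_on (\<lambda>z. c) S"
  by (rule holomorphic_fun_onI[where f' = "\<lambda>z v. 0"]) auto

lemma holomorphic_fun_on_add:
  assumes "holomorphic_fun_on f S" "holomorphic_fun_on g S"
  shows "holomorphic_fun_on (\<lambda>z. f z + g z) S"
  by (rule holomorphic_fun_onI[where f' = "\<lambda>z v. ddir f v z + ddir g v z"])
     (auto intro!: has_derivative_add ddir_has_derivative[OF assms(1)] ddir_has_derivative[OF assms(2)]
       simp: ddir_smult[OF assms(1)] ddir_smult[OF assms(2)] algebra_simps)

lemma holomorphic_fun_on_mult: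
  assumes "holomorphic_fun_on f S" "holomorphic_fun_on g S"
  shows "holomorphic_fun_on (\<lambda>z. f z * g z) S"
proof (rule holomorphic_fun_onI)
  show "((\<lambda>z. f z * g z) has_derivative (\<lambda>v. f z * ddir g v z + ddir f v z * g z)) (at z)" if "z \<in> S" for z
    by (rule has_derivative_mult[OF ddir_has_derivative[OF assms(1) that] ddir_has_derivative[OF assms(2) that]])
qed (simp add: ddir_smult[OF assms(1)] ddir_smult[OF assms(2)] algebra_simps)

lemma holomorphic_fun_on_sum:
  "(\<And>i. i \<in> I \<Longrightarrow> holomorphic_fun_on (f i) S) \<Longrightarrow> holomorphic_fun_on (\<lambda>z. \<Sum>i\<in>I. f i z) S"
  by (induction I rule: infinite_finite_induct)
     (auto intro: holomorphic_fun_on_const holomorphic_fun_on_add)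

lemma holomorphic_fun_on_prod:
  "(\<And>i. i \<in> I \<Longrightarrow> holomorphic_fun_on (f i) S) \<Longrightarrow> holomorphic_fun_on (\<lambda>z. \<Prod>i\<in>I. f i z) S"
  by (induction I rule: infinite_finite_induct)
     (auto intro: holomorphic_fun_on_const holomorphic_fun_on_mult)

lemma holomorphic_fun_on_det:
  "(\<And>i j. holomorphic_fun_on (M i j) S) \<Longrightarrow> holomorphic_fun_on (\<lambda>z. det (\<chi> i j. M i j z)) S"
  unfolding det_def
  by (simp, intro holomorphic_fun_on_sum holomorphic_fun_on_mult holomorphic_fun_on_prod holomorphic_fun_on_const)

text \<open>Every Leibniz term has one factor from each row, so the product rule regroups into one
  determinant for each differentiated row.\<close>

lemma has_derivative_det:
  fixes M :: "'n::finite \<Rightarrow> 'n \<Rightarrow> 'a::real_normed_vector \<Rightarrow> 'b::real_normed_field"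
  assumes "\<And>i j. (M i j has_derivative M' i j) (at z)"
  shows "((\<lambda>z. det (\<chi> i j. M i j z)) has_derivative
     (\<lambda>v. \<Sum>i\<in>UNIV. det (\<chi> i'. if i' = i then \<chi> j. M' i j v else \<chi> j. M i' j z))) (at z)"
proof -
  have "((\<lambda>z. \<Sum>p | p permutes (UNIV :: 'n set). of_int (sign p) * (\<Prod>i\<in>UNIV. M i (p i) z)) has_derivative
    (\<lambda>v. \<Sum>p | p permutes (UNIV :: 'n set). of_int (sign p) *
       (\<Sum>i\<in>UNIV. M' i (p i) v * (\<Prod>i'\<in>UNIV - {i}. M i' (p i') z)))) (at z)"
    by (intro has_derivative_sum has_derivative_mult_right has_derivative_prod assms)
  moreover have "(\<Sum>p | p permutes (UNIV :: 'n set). of_int (sign p) *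
       (\<Sum>i\<in>UNIV. M' i (p i) v * (\<Prod>i'\<in>UNIV - {i}. M i' (p i') z)))
     = (\<Sum>i\<in>UNIV. det (\<chi> i'. if i' = i then \<chi> j. M' i j v else \<chi> j. M i' j z))" for v
  proof -
    have "(\<Prod>i'\<in>UNIV. (if i' = i then \<chi> j. M' i j v else \<chi> j. M i' j z) $ p i')
       = M' i (p i) v * (\<Prod>i'\<in>UNIV - {i}. M i' (p i') z)" for i and p :: "'n \<Rightarrow> 'n"
    proof -
      have "(\<Prod>i'\<in>UNIV - {i}. (if i' = i then \<chi> j. M' i j v else \<chi> j. M i' j z) $ p i')
          = (\<Prod>i'\<in>UNIV - {i}. M i' (p i') z)"
        by (rule prod.cong) auto
      then show ?thesis by (subst prod.remove[of _ i]) auto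
    qed
    then show ?thesis
      by (simp add: det_def sum_distrib_left mult.assoc) (rule sum.swap)
  qed
  ultimately show ?thesis by (simp add: det_def)
qed

section \<open>Holomorphic maps, Jacobian matrices and the chain rule\<close>

definition jac_matrix :: "(complex^'n \<Rightarrow> complex^'n) \<Rightarrow> complex^'n \<Rightarrow> complex^'n^'n" where
  "jac_matrix F z = (\<chi> i j. ddir (\<lambda>z. F z $ i) (axis j 1) z)"

lemma linear_vector_smult_iff':
  "Vector_Spaces.linear (*s) (*s) f' \<longleftrightarrow> (\<forall>v w. f' (v + w) = f' v + f' w) \<and> (\<forall>c v. f' (c *s v) = c *s f' v)"
  for f' :: "complex^'n \<Rightarrow> complex^'m"
  by (simp add: Vector_Spaces.linear_def module_hom_def module_hom_axioms_def vec.vector_space_axioms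
      vec.module_axioms)

lemma has_derivative_vec_iff:
  fixes F :: "'a::real_normed_vector \<Rightarrow> complex^'n"
  shows "(F has_derivative F') (at z) \<longleftrightarrow> (\<forall>i. ((\<lambda>z. F z $ i) has_derivative (\<lambda>v. F' v $ i)) (at z))"
proof
  assume "(F has_derivative F') (at z)"
  then show "\<forall>i. ((\<lambda>z. F z $ i) has_derivative (\<lambda>v. F' v $ i)) (at z)"
    using bounded_linear.has_derivative[OF bounded_linear_vec_nth] by blast
next
  assume *: "\<forall>i. ((\<lambda>z. F z $ i) has_derivative (\<lambda>v. F' v $ i)) (at z)"
  show "(F has_derivative F') (at z)"
  proof (subst has_derivative_componentwise_within, rule ballI)
    fix b :: "complex^'n" assume "b \<in> Basis"
    then obtain i u where "b = axis i u" by (auto simp: Basis_vec_def)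
    then show "((\<lambda>z. F z \<bullet> b) has_derivative (\<lambda>v. F' v \<bullet> b)) (at z)"
      using has_derivative_inner_left[OF *[rule_format, of i], of u] by (simp add: inner_axis)
  qed
qed

lemma holomorphic_map_on_iff:
  "holomorphic_map_on F S \<longleftrightarrow> (\<forall>i. holomorphic_fun_on (\<lambda>z. F z $ i) S)"
proof
  assume F: "holomorphic_map_on F S"
  show "\<forall>i. holomorphic_fun_on (\<lambda>z. F z $ i) S"
    unfolding holomorphic_fun_on_def
  proof (intro allI ballI)
    fix i z assume "z \<in> S"
    with F obtain F' where F': "(F has_derivative F') (at z)" "Vector_Spaces.linear (*s) (*s) F'"
      unfolding holomorphic_map_on_def by blast
    then have "((\<lambda>z. F z $ i) has_derivative (\<lambda>v. F' v $ i)) (at z)"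
      using has_derivative_vec_iff by blast
    moreover have "Vector_Spaces.linear (*s) (*) (\<lambda>v. F' v $ i)"
      using F'(2) by (simp add: linear_vector_smult_iff linear_vector_smult_iff')
    ultimately show "\<exists>f'. ((\<lambda>z. F z $ i) has_derivative f') (at z) \<and> Vector_Spaces.linear (*s) (*) f'"
      by blast
  qed
next
  assume *: "\<forall>i. holomorphic_fun_on (\<lambda>z. F z $ i) S"
  show "holomorphic_map_on F S"
    unfolding holomorphic_map_on_def
  proof
    fix z assume z: "z \<in> S"
    let ?F' = "\<lambda>v. \<chi> i. ddir (\<lambda>z. F z $ i) v z"
    have "(F has_derivative ?F') (at z)"
      unfolding has_derivative_vec_iff using ddir_has_derivative[OF _ z] * by simp
    moreover have "Vector_Spaces.linear (*s) (*s) ?F'"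
      unfolding linear_vector_smult_iff'
      using ddir_add[OF _ z] ddir_smult[OF _ z] * by (simp add: vec_eq_iff)
    ultimately show "\<exists>F'. (F has_derivative F') (at z) \<and> Vector_Spaces.linear (*s) (*s) F'"
      by blast
  qed
qed

lemma jac_matrix_has_derivative:
  assumes "holomorphic_map_on F S" "z \<in> S"
  shows "(F has_derivative (\<lambda>v. jac_matrix F z *v v)) (at z)"
proof -
  have "holomorphic_fun_on (\<lambda>z. F z $ i) S" for i using assms(1) holomorphic_map_on_iff by blast
  note f = this
  have "(\<lambda>v. ddir (\<lambda>z. F z $ i) v z) = (\<lambda>v. (jac_matrix F z *v v) $ i)" for i
    by (rule ext, subst ddir_expand[OF f assms(2)])
       (simp add: jac_matrix_def matrix_vector_mult_def mult.commute)
  then show ?thesis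
    unfolding has_derivative_vec_iff using ddir_has_derivative[OF f assms(2)] by simp
qed

lemma matrix_vector_mult_axis: "(A *v axis k 1) $ i = A $ i $ k"
  for A :: "'a::comm_semiring_1^'n^'m"
proof -
  have "A $ i $ j * axis k 1 $ j = (if j = k then A $ i $ k else 0)" for j
    by (simp add: axis_def)
  then show ?thesis
    by (simp add: matrix_vector_mult_def)
qed

lemma cjacobian_eq: "(F has_derivative (\<lambda>v. A *v v)) (at z) \<Longrightarrow> cjacobian F z = det A"
  unfolding cjacobian_def by (simp add: frechet_derivative_at[symmetric])

lemma cjacobian_eq_det_jac_matrix:
  "holomorphic_map_on F S \<Longrightarrow> z \<in> S \<Longrightarrow> cjacobian F z = det (jac_matrix F z)"
  by (rule cjacobian_eq[OF jac_matrix_has_derivative])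

lemma holomorphic_map_on_imp_continuous_on:
  "holomorphic_map_on F S \<Longrightarrow> continuous_on S F"
  by (meson continuous_at_imp_continuous_on jac_matrix_has_derivative has_derivative_continuous)

lemma holomorphic_map_on_subset:
  "holomorphic_map_on f S \<Longrightarrow> T \<subseteq> S \<Longrightarrow> holomorphic_map_on f T"
  by (auto simp: holomorphic_map_on_def)

lemma holomorphic_jac_matrix:
  assumes "holomorphic_map_on F S" "open S"
  shows "holomorphic_fun_on (\<lambda>z. jac_matrix F z $ i $ j) S"
  using holomorphic_ddir[OF _ assms(2)] assms(1) by (simp add: holomorphic_map_on_iff jac_matrix_def)

lemma holomorphic_cjacobian:
  assumes "holomorphic_map_on F S" "open S"
  shows "holomorphic_fun_on (cjacobian F) S"
proof -
  have "holomorphic_fun_on (\<lambda>z. det (\<chi> i j. jac_matrix F z $ i $ j)) S"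
    by (intro holomorphic_fun_on_det holomorphic_jac_matrix assms)
  then show ?thesis
    by (rule holomorphic_fun_on_transform[OF _ assms(2)])
       (simp add: cjacobian_eq_det_jac_matrix[OF assms(1)])
qed

lemma holomorphic_fun_on_compose:
  assumes "holomorphic_map_on F S" "holomorphic_fun_on f T" "F ` S \<subseteq> T"
  shows "holomorphic_fun_on (\<lambda>z. f (F z)) S"
proof (rule holomorphic_fun_onI[where f' = "\<lambda>z v. ddir f (jac_matrix F z *v v) (F z)"])
  fix z assume z: "z \<in> S"
  then have Fz: "F z \<in> T" using assms(3) by auto
  show "((\<lambda>z. f (F z)) has_derivative (\<lambda>v. ddir f (jac_matrix F z *v v) (F z))) (at z)"
    by (rule has_derivative_compose[OF jac_matrix_has_derivative[OF assms(1) z] ddir_has_derivative[OF assms(2) Fz]])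
  show "ddir f (jac_matrix F z *v (c *s v)) (F z) = c * ddir f (jac_matrix F z *v v) (F z)" for c v
    by (simp add: ddir_smult[OF assms(2) Fz] matrix_vector_mult_scaleR vector_scalar_commute)
qed

lemma cjacobian_compose:
  assumes F: "holomorphic_map_on F S" "z \<in> S" and G: "holomorphic_map_on G T" "F z \<in> T"
  shows "cjacobian (G \<circ> F) z = cjacobian G (F z) * cjacobian F z"
proof -
  have "((G \<circ> F) has_derivative (\<lambda>v. (jac_matrix G (F z) ** jac_matrix F z) *v v)) (at z)"
    using diff_chain_at[OF jac_matrix_has_derivative[OF F] jac_matrix_has_derivative[OF G]]
    by (simp add: o_def matrix_vector_mul_assoc)
  from cjacobian_eq[OF this] show ?thesis
    by (simp add: det_mul cjacobian_eq_det_jac_matrix[OF F] cjacobian_eq_det_jac_matrix[OF G])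
qed

subsection \<open>Cofactors and the Piola identity\<close>

text \<open>The (k, j) cofactor as a determinant of full size, which avoids minors and signs and
  lets \<open>has_derivative_det\<close> and \<open>det_identical_rows\<close> apply
  directly.\<close>

definition cofac :: "(complex^'n \<Rightarrow> complex^'n) \<Rightarrow> 'n \<Rightarrow> 'n \<Rightarrow> complex^'n \<Rightarrow> complex" where
  "cofac F k j z = det (\<chi> i. if i = k then axis j 1 else jac_matrix F z $ i)"

lemma det_replace_row_expand:
  fixes r :: "'a::comm_ring_1^'n"
  shows "det (\<chi> i. if i = k then r else c i) = (\<Sum>j\<in>UNIV. r $ j * det (\<chi> i. if i = k then axis j 1 else c i))"
proof -
  have "det (\<chi> i. if i = k then r else c i) = det (\<chi> i. if i = k then (\<Sum>j\<in>UNIV. r $ j *s axis j 1) else c i)"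
    by (simp only: basis_expansion)
  also have "\<dots> = (\<Sum>j\<in>UNIV. det (\<chi> i. if i = k then r $ j *s axis j 1 else c i))"
    by (rule det_linear_row_sum) simp
  finally show ?thesis by (simp only: det_row_mul)
qed

text \<open>Expansion along row \<open>k\<close> after replacing that row by row \<open>i\<close>;
  for \<open>i \<noteq> k\<close> two rows then agree.\<close>

lemma jac_matrix_times_cofac:
  "(\<Sum>j\<in>UNIV. jac_matrix F z $ i $ j * cofac F k j z) = (if i = k then det (jac_matrix F z) else 0)"
proof -
  have "(\<Sum>j\<in>UNIV. jac_matrix F z $ i $ j * cofac F k j z)
      = det (\<chi> i'. if i' = k then jac_matrix F z $ i else jac_matrix F z $ i')"
    unfolding cofac_def by (rule det_replace_row_expand[symmetric])
  also have "\<dots> = (if i = k then det (jac_matrix F z) else 0)"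
  proof (cases "i = k")
    case True
    then have "(\<chi> i'. if i' = k then jac_matrix F z $ i else jac_matrix F z $ i') = jac_matrix F z"
      by (simp add: vec_eq_iff)
    then show ?thesis using True by simp
  next
    case False
    have "det (\<chi> i'. if i' = k then jac_matrix F z $ i else jac_matrix F z $ i') = 0"
      by (rule det_identical_rows[OF False]) (use False in \<open>simp add: row_def\<close>)
    then show ?thesis using False by simp
  qed
  finally show ?thesis .
qed

lemma cofac_entries:
  "cofac F k j z = det (\<chi> i l. if i = k then axis j 1 $ l else jac_matrix F z $ i $ l)"
proof -
  have "(\<chi> i. if i = k then axis j 1 else jac_matrix F z $ i) =
      (\<chi> i l. if i = k then axis j 1 $ l else jac_matrix F z $ i $ l)"
    by (simp add: vec_eq_iff)
  then show ?thesis by (simp add: cofac_def)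
qed

lemma holomorphic_cofac:
  assumes "holomorphic_map_on F S" "open S"
  shows "holomorphic_fun_on (cofac F k j) S"
proof -
  have "holomorphic_fun_on (\<lambda>z. det (\<chi> i l. if i = k then axis j 1 $ l else jac_matrix F z $ i $ l)) S"
  proof (rule holomorphic_fun_on_det)
    fix i l
    show "holomorphic_fun_on (\<lambda>z. if i = k then axis j 1 $ l else jac_matrix F z $ i $ l) S"
      using holomorphic_jac_matrix[OF assms] by (cases "i = k") (simp_all add: holomorphic_fun_on_const)
  qed
  then show ?thesis by (simp add: cofac_entries[abs_def])
qed

lemma det_swap_rows:
  fixes A :: "'a::comm_ring_1^'n^'n"
  assumes "i \<noteq> k"
  shows "det (\<chi> r. A $ Transposition.transpose i k r) = - det A"
  using det_permute_rows[of "Transposition.transpose i k" A] assms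
  by (simp add: permutes_swap_id sign_swap_id)

text \<open>The Piola identity. Differentiating the cofactor pairs second derivatives, symmetric in
  \<open>j\<close> and \<open>l\<close>, with determinants having two unit rows, antisymmetric in
  \<open>j\<close> and \<open>l\<close>; the contraction cancels.\<close>

lemma cofac_divergence_free:
  fixes F :: "complex^'n \<Rightarrow> complex^'n"
  assumes F: "holomorphic_map_on F S" and S: "open S" and z: "z \<in> S"
  shows "(\<Sum>j\<in>UNIV. ddir (cofac F k j) (axis j 1) z) = 0"
proof -
  let ?A = "jac_matrix F z"
  define H where "H = (\<lambda>i l j. ddir (ddir (\<lambda>z. F z $ i) (axis l 1)) (axis j 1) z)"
  define d :: "'n \<Rightarrow> 'n \<Rightarrow> 'n \<Rightarrow> complex" where
    "d = (\<lambda>i j l. det (\<chi> r. if r = i then axis l 1 else if r = k then axis j 1 else ?A $ r))"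
  have Fi: "holomorphic_fun_on (\<lambda>z. F z $ i) S" for i
    using F holomorphic_map_on_iff by blast
  have "ddir (cofac F k j) (axis j 1) z = (\<Sum>i\<in>UNIV - {k}. \<Sum>l\<in>UNIV. H i l j * d i j l)" for j
  proof -
    define M where "M = (\<lambda>i l z. if i = k then axis j 1 $ l else jac_matrix F z $ i $ l)"
    define M' where "M' = (\<lambda>i l v. if i = k then 0 else ddir (ddir (\<lambda>z. F z $ i) (axis l 1)) v z)"
    have "(M i l has_derivative M' i l) (at z)" for i l
      using ddir_has_derivative[OF holomorphic_ddir[OF Fi S] z]
      by (cases "i = k") (simp_all add: M_def M'_def jac_matrix_def)
    from ddir_eqI[OF has_derivative_det[OF this]]
    have "ddir (cofac F k j) (axis j 1) z =
      (\<Sum>i\<in>UNIV. det (\<chi> r. if r = i then \<chi> l. M' i l (axis j 1) else \<chi> l. M r l z))"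
      by (simp add: cofac_entries[abs_def] M_def)
    also have "\<dots> = (\<Sum>i\<in>UNIV - {k}. det (\<chi> r. if r = i then \<chi> l. M' i l (axis j 1) else \<chi> l. M r l z))"
    proof -
      \<comment> \<open>Row \<open>k\<close> of the cofactor matrix is a constant unit vector, so
        differentiating it contributes nothing.\<close>
      have "(\<chi> l. M' k l (axis j 1)) = 0" by (simp add: M'_def vec_eq_iff)
      then have "det (\<chi> r. if r = k then \<chi> l. M' k l (axis j 1) else \<chi> l. M r l z) = 0"
        by (simp only: det_row_0)
      then show ?thesis
        by (subst sum.remove[of _ k]) auto
    qed
    also have "\<dots> = (\<Sum>i\<in>UNIV - {k}. \<Sum>l\<in>UNIV. H i l j * d i j l)"
    proof (rule sum.cong[OF refl])
      fix i assume "i \<in> UNIV - {k}"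
      then have "det (\<chi> r. if r = i then \<chi> l. M' i l (axis j 1) else \<chi> l. M r l z)
        = (\<Sum>l\<in>UNIV. H i l j * det (\<chi> r. if r = i then axis l 1 else \<chi> l. M r l z))"
        by (subst det_replace_row_expand) (simp add: M'_def H_def)
      moreover have "(\<chi> r. if r = i then axis l 1 else \<chi> l. M r l z) =
          (\<chi> r. if r = i then axis l 1 else if r = k then axis j 1 else ?A $ r)" for l
        by (simp add: M_def vec_eq_iff)
      ultimately show "det (\<chi> r. if r = i then \<chi> l. M' i l (axis j 1) else \<chi> l. M r l z)
        = (\<Sum>l\<in>UNIV. H i l j * d i j l)"
        by (simp add: d_def)
    qed
    finally show ?thesis .
  qed
  then have "(\<Sum>j\<in>UNIV. ddir (cofac F k j) (axis j 1) z)
      = (\<Sum>j\<in>UNIV. \<Sum>i\<in>UNIV - {k}. \<Sum>l\<in>UNIV. H i l j * d i j l)" by simp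
  also have "\<dots> = (\<Sum>i\<in>UNIV - {k}. \<Sum>j\<in>UNIV. \<Sum>l\<in>UNIV. H i l j * d i j l)"
    by (rule sum.swap)
  also have "\<dots> = 0"
  proof (rule sum.neutral, rule ballI)
    fix i assume i: "i \<in> UNIV - {k}"
    have anti: "d i j l = - d i l j" for j l
    proof -
      have "(\<chi> r. (\<chi> r. if r = i then axis j 1 else if r = k then axis l 1 else ?A $ r) $ Transposition.transpose i k r)
        = (\<chi> r. if r = i then axis l 1 else if r = k then axis j 1 else ?A $ r)"
        using i by (auto simp: vec_eq_iff Transposition.transpose_def)
      with det_swap_rows[of i k "\<chi> r. if r = i then axis j 1 else if r = k then axis l 1 else ?A $ r"] i
      show ?thesis unfolding d_def by auto
    qed
    have sym: "H i l j = H i j l" for j l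
      unfolding H_def by (rule ddir_commute[OF Fi S z])
    let ?S = "\<Sum>j\<in>UNIV. \<Sum>l\<in>UNIV. H i l j * d i j l"
    have "?S = (\<Sum>j\<in>UNIV. \<Sum>l\<in>UNIV. H i j l * d i l j)" by (rule sum.swap)
    also have "\<dots> = (\<Sum>j\<in>UNIV. \<Sum>l\<in>UNIV. - (H i l j * d i j l))"
      using anti sym by (intro sum.cong refl) (metis mult_minus_right)
    also have "\<dots> = - ?S" by (simp add: sum_negf)
    finally show "?S = 0" by simp
  qed
  finally show ?thesis .
qed

subsection \<open>Integration by parts and pullback of the Cauchy-Riemann operator\<close>

lemma set_integrable_compact_support:
  fixes u :: "'a::euclidean_space \<Rightarrow> 'b::{banach, second_countable_topology}"
  assumes "compact K" "K \<subseteq> S" "continuous_on K u" "\<And>z. z \<in> S - K \<Longrightarrow> u z = 0"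
  shows "set_integrable lborel S u"
proof -
  have "(\<lambda>z. indicator S z *\<^sub>R u z) = (\<lambda>z. indicator K z *\<^sub>R u z)"
    using assms(2,4) by (intro ext) (auto simp: indicator_def)
  then show ?thesis
    using borel_integrable_compact[OF assms(1,3)] unfolding set_integrable_def by simp
qed

text \<open>By translation invariance the integral of \<open>\<Phi> (z + t *\<^sub>R v)\<close> does
  not depend on \<open>t\<close>; differentiating at \<open>t = 0\<close> under the integral sign
  gives the claim.\<close>

lemma integral_directional_derivative_eq_0:
  fixes \<Phi> :: "'a::euclidean_space \<Rightarrow> 'b::{banach, second_countable_topology}"
  assumes der: "\<And>z. (\<Phi> has_derivative \<Phi>' z) (at z)" and K: "compact K"
    and supp: "\<And>z. z \<notin> K \<Longrightarrow> \<Phi> z = 0" and C: "\<And>z. norm (\<Phi>' z v) \<le> C"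
  shows "integrable lborel (\<lambda>z. \<Phi>' z v)" and "(\<integral>z. \<Phi>' z v \<partial>lborel) = 0"
proof -
  have cont: "continuous_on S \<Phi>" for S
    using der has_derivative_continuous continuous_at_imp_continuous_on by blast
  \<comment> \<open>Contains the support of every translate with parameter in [-1,1]; its indicator
    times \<open>C\<close> is the dominating function.\<close>
  define K' where "K' = (\<lambda>(z, t). z - t *\<^sub>R v) ` (K \<times> {-1..1::real})"
  have "compact K'"
    unfolding K'_def using K
    by (intro compact_continuous_image compact_Times) (auto simp: split_def intro!: continuous_intros)
  have K': "z \<in> K'" if "z + t *\<^sub>R v \<in> K" "\<bar>t\<bar> \<le> 1" for z t
    unfolding K'_def using that by (intro image_eqI[of _ _ "(z + t *\<^sub>R v, t)"]) auto
  have C0: "C \<ge> 0" using C[of undefined] norm_ge_zero order_trans by blast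
  have intK: "integrable lborel (\<lambda>z. \<Phi> (z + t *\<^sub>R v))" if "\<bar>t\<bar> \<le> 1" for t
  proof -
    have "set_integrable lborel UNIV (\<lambda>z. \<Phi> (z + t *\<^sub>R v))"
      using \<open>compact K'\<close>
      by (rule set_integrable_compact_support)
         (use K'[of _ t] that supp in \<open>auto intro!: continuous_intros continuous_on_compose2[OF cont[of UNIV]]\<close>)
    then show ?thesis by (simp add: set_integrable_def)
  qed
  have lip: "norm (\<Phi> (z + t *\<^sub>R v) - \<Phi> (z + 0 *\<^sub>R v)) \<le> (C * indicator K' z) * norm (t - 0)"
    if "dist t 0 < 1" for z and t :: real
  proof (cases "z \<in> K'")
    case True
    have "norm (\<Phi> (z + t *\<^sub>R v) - \<Phi> (z + 0 *\<^sub>R v)) \<le> C * norm (t - 0)"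
    proof (rule differentiable_bound[where S = UNIV and f = "\<lambda>t. \<Phi> (z + t *\<^sub>R v)"
          and f' = "\<lambda>t s. s *\<^sub>R \<Phi>' (z + t *\<^sub>R v) v"])
      show "((\<lambda>t. \<Phi> (z + t *\<^sub>R v)) has_derivative (\<lambda>s. s *\<^sub>R \<Phi>' (z + t *\<^sub>R v) v)) (at t within UNIV)" for t
      proof -
        have "((\<lambda>t. z + t *\<^sub>R v) has_derivative (\<lambda>s. s *\<^sub>R v)) (at t)"
          by (auto intro!: derivative_eq_intros)
        from has_derivative_compose[OF this der] show ?thesis
          by (simp add: linear_cmul[OF has_derivative_linear[OF der]])
      qed
      show "onorm (\<lambda>s. s *\<^sub>R \<Phi>' (z + t *\<^sub>R v) v) \<le> C" for t
        by (rule onorm_le) (use C in \<open>simp add: mult.commute[of C] mult_left_mono\<close>)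
    qed auto
    then show ?thesis using True by simp
  next
    case False
    then have "z + t *\<^sub>R v \<notin> K" "z \<notin> K" using K'[of z t] K'[of z 0] that by (auto simp: dist_norm)
    then show ?thesis using supp C0 by simp
  qed
  have L: "integrable lborel (\<lambda>z. C * indicator K' z)"
    using \<open>compact K'\<close> by (intro integrable_mult_right) (auto simp: emeasure_lborel_cbox_finite
        intro!: integrable_real_indicator emeasure_compact_finite borel_compact)
  have derk: "((\<lambda>t. \<Phi> (z + t *\<^sub>R v)) has_derivative (\<lambda>s. s *\<^sub>R \<Phi>' z v)) (at 0)" for z
  proof -
    have "((\<lambda>t. z + t *\<^sub>R v) has_derivative (\<lambda>s. s *\<^sub>R v)) (at 0)"
      by (auto intro!: derivative_eq_intros)
    from has_derivative_compose[OF this der] show ?thesis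
      by (simp add: linear_cmul[OF has_derivative_linear[OF der]])
  qed
  note dom = has_derivative_integral_dominated[where M = lborel and e = 1 and a = "0::real"
      and k = "\<lambda>t z. \<Phi> (z + t *\<^sub>R v)" and k' = "\<lambda>z s. s *\<^sub>R \<Phi>' z v" and L = "\<lambda>z. C * indicator K' z",
      OF zero_less_one intK derk L lip]
  show "integrable lborel (\<lambda>z. \<Phi>' z v)"
    using dom(1)[of 1] by simp
  have "(\<integral>z. \<Phi> (z + t *\<^sub>R v) \<partial>lborel) = (\<integral>z. \<Phi> z \<partial>lborel)" for t
  proof -
    have "(\<integral>z. \<Phi> z \<partial>distr lborel borel ((+) (t *\<^sub>R v))) = (\<integral>z. \<Phi> (t *\<^sub>R v + z) \<partial>lborel)"
      using cont[of UNIV] by (intro integral_distr) (auto intro: borel_measurable_continuous_onI)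
    then show ?thesis by (simp add: lborel_distr_plus add.commute)
  qed
  then have "((\<lambda>t::real. \<integral>z. \<Phi> z \<partial>lborel) has_derivative (\<lambda>s. \<integral>z. s *\<^sub>R \<Phi>' z v \<partial>lborel)) (at 0)"
    using dom(2) by simp
  from has_derivative_unique[OF this has_derivative_const]
  have "(\<integral>z. 1 *\<^sub>R \<Phi>' z v \<partial>lborel) = 0" by meson
  then show "(\<integral>z. \<Phi>' z v \<partial>lborel) = 0" by simp
qed

text \<open>Twice the Wirtinger derivative with respect to the conjugate variable in direction
  \<open>v\<close>. It takes a real-linear derivative as argument and vanishes on complex-linear
  ones.\<close>

definition dbar :: "(complex^'n \<Rightarrow> complex) \<Rightarrow> complex^'n \<Rightarrow> complex" where
  "dbar f' v = f' v + \<i> * f' (\<i> *s v)"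

text \<open>Conjugate-linearity in the direction, although \<open>f'\<close> is only real-linear;
  this is why conjugated cofactors appear in the pullback formula.\<close>

lemma dbar_smult:
  assumes "linear f'"
  shows "dbar f' (c *s v) = cnj c * dbar f' v"
proof -
  have "c *s v = Re c *\<^sub>R v + Im c *\<^sub>R (\<i> *s v)" "\<i> *s (c *s v) = Re c *\<^sub>R (\<i> *s v) + (- Im c) *\<^sub>R v"
    by (simp_all add: vec_eq_iff complex_eq_iff)
  then have "f' (c *s v) = Re c *\<^sub>R f' v + Im c *\<^sub>R f' (\<i> *s v)"
      "f' (\<i> *s (c *s v)) = Re c *\<^sub>R f' (\<i> *s v) + (- Im c) *\<^sub>R f' v"
    by (simp_all only: linear_add[OF assms] linear_cmul[OF assms])
  then show ?thesis
    by (simp add: dbar_def complex_eq_iff algebra_simps)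
qed

lemma dbar_sum:
  assumes "linear f'"
  shows "dbar f' (\<Sum>j\<in>J. v j) = (\<Sum>j\<in>J. dbar f' (v j))"
  unfolding dbar_def vec.scale_sum_right linear_sum[OF assms]
  by (simp add: sum.distrib sum_distrib_left)

lemma continuous_on_matrix_vector_mult:
  fixes A :: "'a::topological_space \<Rightarrow> complex^'n^'m"
  assumes "\<And>i j. continuous_on S (\<lambda>z. A z $ i $ j)"
  shows "continuous_on S (\<lambda>z. A z *v v)"
  unfolding matrix_vector_mult_def by (intro continuous_intros assms)

lemma holomorphic_ddir_continuous:
  "holomorphic_fun_on f S \<Longrightarrow> open S \<Longrightarrow> continuous_on S (\<lambda>z. ddir f v z)"
  using holomorphic_fun_on_imp_continuous_on[OF holomorphic_ddir] by (simp add: eta_contract_eq)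

text \<open>The integrand is the sum over \<open>j\<close> of the conjugate derivatives in direction
  \<open>axis j 1\<close> of \<open>g z * cnj (cofac h k j z) * \<psi> (h z)\<close>. The derivative
  of \<open>g\<close> drops out by holomorphy, that of the cofactors by the Piola identity, and the
  cofactors contract the chain rule for \<open>\<psi>\<close> to the conjugated Jacobian
  determinant.\<close>

lemma integral_dbar_pullback_eq_0:
  fixes h :: "complex^'n \<Rightarrow> complex^'n" and k :: 'n
  assumes S: "open S" and h: "holomorphic_map_on h S" and g: "holomorphic_fun_on g S"
    and \<psi>: "\<And>x. (\<psi> has_derivative \<psi>' x) (at x)"
    and cont: "continuous_on UNIV (\<lambda>p. \<psi>' (fst p) (snd p))"
    and K: "compact {z\<in>S. h z \<in> C}" and supp: "\<And>x. x \<notin> C \<Longrightarrow> \<psi> x = 0"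
  shows "set_integrable lborel S (\<lambda>z. g z * cnj (cjacobian h z) * dbar (\<psi>' (h z)) (axis k 1))"
    and "(LINT z:S|lborel. g z * cnj (cjacobian h z) * dbar (\<psi>' (h z)) (axis k 1)) = 0"
proof -
  let ?K = "{z\<in>S. h z \<in> C}"
  let ?V = "cofac h k"
  define \<Phi> where "\<Phi> = (\<lambda>j z. if z \<in> S then g z * cnj (?V j z) * \<psi> (h z) else 0)"
  define \<Phi>' where "\<Phi>' = (\<lambda>j z v. if z \<in> S then
      g z * cnj (?V j z) * \<psi>' (h z) (jac_matrix h z *v v)
      + (g z * cnj (ddir (?V j) v z) + ddir g v z * cnj (?V j z)) * \<psi> (h z) else 0)"
  have V: "holomorphic_fun_on (?V j) S" for j
    by (rule holomorphic_cofac[OF h S])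
  have opn: "open (- ?K)" using K by (simp add: compact_imp_closed open_Compl)
  have zero: "\<Phi> j z = 0" if "z \<in> - ?K" for j z
    using that supp by (auto simp: \<Phi>_def)
  \<comment> \<open>The complement of the compact support is open, so this also covers boundary
    points of \<open>S\<close>, where the extension by zero has to be differentiable.\<close>
  have zero_der: "(\<Phi> j has_derivative (\<lambda>v. 0)) (at z)" if "z \<in> - ?K" for j z
    by (rule has_derivative_transform_within_open[OF has_derivative_const opn that]) (simp add: zero)
  have derS: "(\<Phi> j has_derivative \<Phi>' j z) (at z)" if z: "z \<in> S" for j z
  proof -
    have "((\<lambda>z. g z * cnj (?V j z) * \<psi> (h z)) has_derivative \<Phi>' j z) (at z)"
      unfolding \<Phi>'_def if_P[OF z]
      by (rule has_derivative_mult[OF has_derivative_mult[OF ddir_has_derivative[OF g z]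
            has_derivative_cnj[OF ddir_has_derivative[OF V z]]]
            has_derivative_compose[OF jac_matrix_has_derivative[OF h z] \<psi>]])
    then show ?thesis
      by (rule has_derivative_transform_within_open[OF _ S z]) (simp add: \<Phi>_def)
  qed
  have zero': "\<Phi>' j z v = 0" if "z \<in> - ?K" for j z v
  proof (cases "z \<in> S")
    case True
    from has_derivative_unique[OF derS[OF True] zero_der[OF that]] show ?thesis by metis
  qed (simp add: \<Phi>'_def)
  have der: "(\<Phi> j has_derivative \<Phi>' j z) (at z)" for j z
  proof (cases "z \<in> S")
    case False
    then have "\<Phi>' j z = (\<lambda>v. 0)" by (simp add: \<Phi>'_def)
    then show ?thesis using zero_der[of z j] False by simp
  qed (rule derS)
  have contK: "continuous_on ?K (\<lambda>z. \<Phi>' j z v)" for j v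
  proof -
    have ch: "continuous_on S h" by (rule holomorphic_map_on_imp_continuous_on[OF h])
    have c\<psi>: "continuous_on UNIV \<psi>"
      using \<psi> has_derivative_continuous continuous_at_imp_continuous_on by blast
    have cA: "continuous_on S (\<lambda>z. jac_matrix h z *v v)"
      by (rule continuous_on_matrix_vector_mult)
         (rule holomorphic_fun_on_imp_continuous_on[OF holomorphic_jac_matrix[OF h S]])
    have "continuous_on S (\<lambda>z. \<psi>' (h z) (jac_matrix h z *v v))"
      using continuous_on_compose2[OF cont continuous_on_Pair[OF ch cA]] by simp
    then have "continuous_on S (\<lambda>z. g z * cnj (?V j z) * \<psi>' (h z) (jac_matrix h z *v v)
      + (g z * cnj (ddir (?V j) v z) + ddir g v z * cnj (?V j z)) * \<psi> (h z))"
      by (intro continuous_intros continuous_on_compose2[OF c\<psi> ch] holomorphic_fun_on_imp_continuous_on[OF g]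
          holomorphic_fun_on_imp_continuous_on[OF V] holomorphic_ddir_continuous[OF V S]
          holomorphic_ddir_continuous[OF g S]) auto
    then have "continuous_on ?K (\<lambda>z. g z * cnj (?V j z) * \<psi>' (h z) (jac_matrix h z *v v)
      + (g z * cnj (ddir (?V j) v z) + ddir g v z * cnj (?V j z)) * \<psi> (h z))"
      by (rule continuous_on_subset) auto
    then show ?thesis
      by (rule continuous_on_cong[THEN iffD1, rotated 2]) (auto simp: \<Phi>'_def)
  qed
  have bdd: "\<exists>B. \<forall>z. norm (\<Phi>' j z v) \<le> B" for j v
  proof -
    have "bounded ((\<lambda>z. \<Phi>' j z v) ` ?K)"
      by (intro compact_imp_bounded compact_continuous_image contK K)
    then obtain B where B: "B > 0" "\<forall>z\<in>?K. norm (\<Phi>' j z v) \<le> B"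
      unfolding bounded_pos by auto
    have "norm (\<Phi>' j z v) \<le> B" for z
      using B zero'[of z j v] by (cases "z \<in> ?K") auto
    then show ?thesis by blast
  qed
  have int: "integrable lborel (\<lambda>z. \<Phi>' j z v)" and int0: "(\<integral>z. \<Phi>' j z v \<partial>lborel) = 0" for j v
  proof -
    obtain B where "\<And>z. norm (\<Phi>' j z v) \<le> B" using bdd by blast
    from integral_directional_derivative_eq_0[OF der K zero[unfolded Compl_iff] this]
    show "integrable lborel (\<lambda>z. \<Phi>' j z v)" and "(\<integral>z. \<Phi>' j z v \<partial>lborel) = 0" by auto
  qed
  have eq: "indicator S z *\<^sub>R (g z * cnj (cjacobian h z) * dbar (\<psi>' (h z)) (axis k 1))
      = (\<Sum>j\<in>UNIV. \<Phi>' j z (axis j 1) + \<i> * \<Phi>' j z (\<i> *s axis j 1))" for z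
  proof (cases "z \<in> S")
    case True
    note z = True
    let ?A = "jac_matrix h z"
    have lin: "linear (\<psi>' (h z))" using \<psi> by (rule has_derivative_linear)
    \<comment> \<open>The two terms with the derivative of \<open>g\<close> cancel; the two with the
      conjugated derivative of the cofactor coincide, whence the factor 2.\<close>
    have summand: "\<Phi>' j z (axis j 1) + \<i> * \<Phi>' j z (\<i> *s axis j 1)
        = g z * (cnj (?V j z) * dbar (\<psi>' (h z)) (?A *v axis j 1))
          + 2 * g z * \<psi> (h z) * cnj (ddir (?V j) (axis j 1) z)" for j
      using z by (simp add: \<Phi>'_def dbar_def ddir_smult[OF g z] ddir_smult[OF V z]
          vector_scalar_commute algebra_simps)
    have AV: "(\<Sum>j\<in>UNIV. ?V j z *s (?A *v axis j 1)) = det ?A *s axis k 1"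
    proof -
      have "(axis k 1 :: complex^'n) $ i = (if i = k then 1 else 0)" for i
        by (simp add: axis_def)
      then show ?thesis
        using jac_matrix_times_cofac[of h z _ k]
        by (simp add: vec_eq_iff matrix_vector_mult_axis mult.commute)
    qed
    have "(\<Sum>j\<in>UNIV. cnj (?V j z) * dbar (\<psi>' (h z)) (?A *v axis j 1))
        = dbar (\<psi>' (h z)) (\<Sum>j\<in>UNIV. ?V j z *s (?A *v axis j 1))"
      by (simp add: dbar_sum[OF lin] dbar_smult[OF lin])
    also have "\<dots> = cnj (det ?A) * dbar (\<psi>' (h z)) (axis k 1)"
      by (simp add: AV dbar_smult[OF lin])
    finally have 1: "(\<Sum>j\<in>UNIV. cnj (?V j z) * dbar (\<psi>' (h z)) (?A *v axis j 1))
        = cnj (det ?A) * dbar (\<psi>' (h z)) (axis k 1)" .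
    have 2: "(\<Sum>j\<in>UNIV. cnj (ddir (?V j) (axis j 1) z)) = 0"
      using cofac_divergence_free[OF h S z, of k] by (simp add: cnj_sum[symmetric])
    show ?thesis
      using z by (simp add: summand sum.distrib sum_distrib_left[symmetric] 1 2
          cjacobian_eq_det_jac_matrix[OF h z])
  qed (simp add: \<Phi>'_def)
  show "set_integrable lborel S (\<lambda>z. g z * cnj (cjacobian h z) * dbar (\<psi>' (h z)) (axis k 1))"
    unfolding set_integrable_def eq using int by simp
  show "(LINT z:S|lborel. g z * cnj (cjacobian h z) * dbar (\<psi>' (h z)) (axis k 1)) = 0"
    unfolding set_lebesgue_integral_def eq using int int0 by simp
qed

subsection \<open>The mollified trace\<close>

text \<open>The square makes the positive part continuously differentiable across the sphere where
  it vanishes. The factor \<open>l ^ CARD('n)\<close> compensates the scaling of \<open>x\<close> by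
  \<open>sqrt l\<close> in real dimension \<open>2 * CARD('n)\<close>, so the mass is constant for
  \<open>l > 0\<close>.\<close>

definition bump :: "real \<Rightarrow> complex^'n \<Rightarrow> real" where
  "bump l x = l ^ CARD('n) * (max 0 (1 - l * (norm x)\<^sup>2))\<^sup>2"

definition dbump :: "real \<Rightarrow> complex^'n \<Rightarrow> complex^'n \<Rightarrow> real" where
  "dbump l x v = - 4 * l ^ Suc CARD('n) * max 0 (1 - l * (norm x)\<^sup>2) * (x \<bullet> v)"

text \<open>The derivative of \<open>bump l x\<close> in \<open>l\<close>. It equals the sum over \<open>k\<close> of the derivatives of
  \<open>cnj x_k * l^(n-1) * (max 0 (1 - l |x|^2))^2\<close> with respect to \<open>cnj x_k\<close>.\<close>

definition bump_rate :: "real \<Rightarrow> complex^'n \<Rightarrow> real" where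
  "bump_rate l x = real CARD('n) * l ^ (CARD('n) - 1) * (max 0 (1 - l * (norm x)\<^sup>2))\<^sup>2
     - 2 * l ^ CARD('n) * max 0 (1 - l * (norm x)\<^sup>2) * (norm x)\<^sup>2"

lemma has_real_derivative_max_0_power2:
  "((\<lambda>y. (max 0 y)\<^sup>2) has_real_derivative 2 * max 0 y) (at (y::real))"
proof -
  consider "y > 0" | "y < 0" | "y = 0" by linarith
  then show ?thesis
  proof cases
    case 1
    have "((\<lambda>y. y\<^sup>2) has_real_derivative 2 * max 0 y) (at y)"
      using 1 by (auto intro!: derivative_eq_intros)
    then show ?thesis
      by (rule has_field_derivative_transform_within_open[where S = "{0<..}"]) (use 1 in auto)
  next
    case 2
    have "((\<lambda>y. 0) has_real_derivative 2 * max 0 y) (at y)"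
      using 2 by (auto intro!: derivative_eq_intros)
    then show ?thesis
      by (rule has_field_derivative_transform_within_open[where S = "{..<0}"]) (use 2 in auto)
  next
    case 3
    have "((\<lambda>h::real. ((max 0 (0 + h))\<^sup>2 - (max 0 0)\<^sup>2) / h) \<longlongrightarrow> 0) (at 0)"
    proof (rule Lim_null_comparison)
      show "\<forall>\<^sub>F h in at 0. norm (((max 0 (0 + h))\<^sup>2 - (max 0 0)\<^sup>2) / h) \<le> \<bar>h::real\<bar>"
        by (rule always_eventually) (auto simp: max_def power2_eq_square)
      show "((\<lambda>h::real. \<bar>h\<bar>) \<longlongrightarrow> 0) (at 0)"
        by (intro tendsto_eq_intros) auto
    qed
    then show ?thesis using 3 by (simp add: DERIV_def)
  qed
qed

lemma bump_eq_0: "1 \<le> l * (norm x)\<^sup>2 \<Longrightarrow> bump l x = 0"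
  by (simp add: bump_def)

text \<open>The condition \<open>1 < l * r\<^sup>2\<close>, which recurs below, puts the support
  radius \<open>1 / sqrt l\<close> strictly below \<open>r\<close>; strictness leaves room to vary
  \<open>l\<close>.\<close>

lemma bump_eq_0':
  assumes "0 < r" "1 < l * r\<^sup>2" "r \<le> norm x"
  shows "bump l x = 0"
proof -
  have "l > 0" using assms(1,2) by (metis less_trans zero_less_mult_pos2 zero_less_one zero_less_power)
  then have "l * r\<^sup>2 \<le> l * (norm x)\<^sup>2" using assms by (intro mult_left_mono power_mono) auto
  then show ?thesis using assms(2) by (intro bump_eq_0) simp
qed

lemma bump_shift_eq_0:
  assumes "0 < r" "1 < l * r\<^sup>2" "x \<notin> cball w r"
  shows "bump l (x - w) = 0"
  using assms(3) by (intro bump_eq_0'[OF assms(1,2)]) (auto simp: dist_norm norm_minus_commute)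

lemma bump_has_derivative:
  "(bump l has_derivative dbump l x) (at x)" for x :: "complex^'n"
proof -
  have "((\<lambda>x::complex^'n. 1 - l * (x \<bullet> x)) has_derivative (\<lambda>v. - (l * (x \<bullet> v + v \<bullet> x)))) (at x)"
    by (auto intro!: derivative_eq_intros)
  moreover have "((\<lambda>y. l ^ CARD('n) * (max 0 y)\<^sup>2) has_derivative
      (\<lambda>d. l ^ CARD('n) * (2 * max 0 (1 - l * (x \<bullet> x)) * d))) (at (1 - l * (x \<bullet> x)))"
    using has_real_derivative_max_0_power2[unfolded has_field_derivative_def]
    by (rule has_derivative_mult_right)
  ultimately have "((\<lambda>x. l ^ CARD('n) * (max 0 (1 - l * (x \<bullet> x)))\<^sup>2) has_derivative
      (\<lambda>v. l ^ CARD('n) * (2 * max 0 (1 - l * (x \<bullet> x)) * (- (l * (x \<bullet> v + v \<bullet> x)))))) (at x)"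
    by (rule has_derivative_compose)
  then show ?thesis
    by (simp add: bump_def[abs_def] dbump_def[abs_def] power2_norm_eq_inner inner_commute algebra_simps)
qed

lemma bump_has_real_derivative:
  "((\<lambda>l. bump l x) has_real_derivative bump_rate l x) (at l)" for x :: "complex^'n"
proof -
  have "((\<lambda>l. (max 0 (1 - l * (norm x)\<^sup>2))\<^sup>2) has_real_derivative
      2 * max 0 (1 - l * (norm x)\<^sup>2) * (- (norm x)\<^sup>2)) (at l)"
    by (rule DERIV_chain2[OF has_real_derivative_max_0_power2]) (auto intro!: derivative_eq_intros)
  from DERIV_mult[OF DERIV_pow[of "CARD('n)" l] this] show ?thesis
    by (simp add: bump_def[abs_def] bump_rate_def algebra_simps)
qed

lemma continuous_on_bump [continuous_intros]:
  "continuous_on S f \<Longrightarrow> continuous_on S (\<lambda>z. bump l (f z))"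
  unfolding bump_def by (intro continuous_intros)

lemma continuous_on_dbump [continuous_intros]:
  "continuous_on S f \<Longrightarrow> continuous_on S g \<Longrightarrow> continuous_on S (\<lambda>z. dbump l (f z) (g z))"
  unfolding dbump_def by (intro continuous_intros)

lemma dbump_bound:
  assumes "l > 0"
  obtains B where "B \<ge> 0" "\<And>x v :: complex^'n. \<bar>dbump l x v\<bar> \<le> B * norm v"
proof
  \<comment> \<open>On the support \<open>norm x \<le> 1 / sqrt l\<close>, and the positive part is
    at most 1.\<close>
  let ?B = "4 * l ^ Suc CARD('n) * (1 / sqrt l)"
  show "?B \<ge> 0" using assms by simp
  fix x v :: "complex^'n"
  show "\<bar>dbump l x v\<bar> \<le> ?B * norm v"
  proof (cases "1 - l * (norm x)\<^sup>2 > 0")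
    case True
    have "(norm x)\<^sup>2 \<le> 1 / l"
      using True assms by (simp add: pos_le_divide_eq mult.commute)
    then have "(norm x)\<^sup>2 \<le> (1 / sqrt l)\<^sup>2"
      using assms by (simp add: power_divide)
    then have nx: "norm x \<le> 1 / sqrt l"
      by (rule power2_le_imp_le) (use assms in simp)
    have "\<bar>x \<bullet> v\<bar> \<le> norm x * norm v" by (rule Cauchy_Schwarz_ineq2)
    also have "\<dots> \<le> 1 / sqrt l * norm v" by (rule mult_right_mono[OF nx]) simp
    finally have "\<bar>x \<bullet> v\<bar> \<le> 1 / sqrt l * norm v" .
    moreover have "\<bar>max 0 (1 - l * (norm x)\<^sup>2)\<bar> \<le> 1" using True assms by simp
    ultimately have "\<bar>max 0 (1 - l * (norm x)\<^sup>2)\<bar> * \<bar>x \<bullet> v\<bar> \<le> 1 * (1 / sqrt l * norm v)"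
      by (intro mult_mono) auto
    then have "4 * l ^ Suc CARD('n) * (\<bar>max 0 (1 - l * (norm x)\<^sup>2)\<bar> * \<bar>x \<bullet> v\<bar>)
        \<le> 4 * l ^ Suc CARD('n) * (1 * (1 / sqrt l * norm v))"
      using assms by (intro mult_left_mono) auto
    then show ?thesis using assms
      unfolding dbump_def abs_mult by (simp add: mult.assoc)
  next
    case False
    then show ?thesis using assms by (simp add: dbump_def)
  qed
qed

lemma bump_lipschitz:
  assumes "l > 0"
  obtains B where "B \<ge> 0" "\<And>x y :: complex^'n. \<bar>bump l x - bump l y\<bar> \<le> B * norm (x - y)"
proof -
  obtain B where B: "B \<ge> 0" "\<And>x v :: complex^'n. \<bar>dbump l x v\<bar> \<le> B * norm v"
    using dbump_bound[OF assms] by blast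
  have "norm (bump l x - bump l y) \<le> B * norm (x - y)" for x y :: "complex^'n"
    by (rule differentiable_bound[where S = UNIV and f' = "dbump l"])
       (use B bump_has_derivative in \<open>auto intro!: onorm_le\<close>)
  then show thesis using that B(1) by simp
qed

lemma bump_lipschitz_parameter:
  assumes "l1 > 0"
  obtains B where "B \<ge> 0" "\<And>l (x :: complex^'n). \<bar>l - l1\<bar> < l1 / 2 \<Longrightarrow> \<bar>bump l x - bump l1 x\<bar> \<le> B * \<bar>l - l1\<bar>"
proof -
  let ?n = "CARD('n)"
  \<comment> \<open>For \<open>l\<close> within \<open>l1 / 2\<close> of \<open>l1\<close> one has
    \<open>l \<le> 2 * l1\<close>, and on the support
    \<open>(norm x)\<^sup>2 \<le> 1 / l \<le> 2 / l1\<close>; the two summands bound those of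
    \<open>bump_rate\<close>.\<close>
  define B where "B = real ?n * (2 * l1) ^ (?n - 1) + 2 * (2 * l1) ^ ?n * (2 / l1)"
  have B0: "B \<ge> 0" using assms by (simp add: B_def)
  have rate: "\<bar>bump_rate l x\<bar> \<le> B" if l: "l \<in> ball l1 (l1 / 2)" for l and x :: "complex^'n"
  proof (cases "1 - l * (norm x)\<^sup>2 > 0")
    case True
    let ?M = "1 - l * (norm x)\<^sup>2"
    have l': "l1 / 2 < l" "l \<le> 2 * l1" "l > 0" using l assms by (auto simp: dist_real_def abs_if split: if_splits)
    have M: "0 < ?M" "?M \<le> 1" using True l' by auto
    have "(norm x)\<^sup>2 \<le> 1 / l" using True l'(3) by (simp add: field_simps)
    also have "\<dots> \<le> 2 / l1" using l' assms by (simp add: field_simps)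
    finally have nx: "(norm x)\<^sup>2 \<le> 2 / l1" .
    have p1: "real ?n * l ^ (?n - 1) * ?M\<^sup>2 \<le> real ?n * (2 * l1) ^ (?n - 1) * 1"
      using l' M by (intro mult_mono power_mono) (auto simp: power_le_one)
    have p2: "2 * l ^ ?n * ?M * (norm x)\<^sup>2 \<le> 2 * (2 * l1) ^ ?n * 1 * (2 / l1)"
      using l' M nx assms by (intro mult_mono power_mono) auto
    have p3: "0 \<le> real ?n * l ^ (?n - 1) * ?M\<^sup>2" "0 \<le> 2 * l ^ ?n * ?M * (norm x)\<^sup>2"
      using l' M by auto
    have *: "\<bar>a - b\<bar> \<le> c + d" if "a \<le> c" "b \<le> d" "0 \<le> a" "0 \<le> b" for a b c d :: real
      using that by linarith
    have eq: "bump_rate l x = real ?n * l ^ (?n - 1) * ?M\<^sup>2 - 2 * l ^ ?n * ?M * (norm x)\<^sup>2"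
      using True by (simp add: bump_rate_def)
    show ?thesis
      using *[OF p1 p2 p3] by (simp only: eq B_def mult_1_right)
  next
    case False
    then show ?thesis using B0 by (simp add: bump_rate_def)
  qed
  have "\<bar>bump l x - bump l1 x\<bar> \<le> B * \<bar>l - l1\<bar>" if l: "\<bar>l - l1\<bar> < l1 / 2" for l and x :: "complex^'n"
  proof -
    have der: "((\<lambda>l. bump l x) has_derivative (*) (bump_rate l x)) (at l within ball l1 (l1 / 2))" for l
      using bump_has_real_derivative[of x l] unfolding has_field_derivative_def
      by (rule has_derivative_at_withinI)
    have on: "onorm ((*) (bump_rate l x)) \<le> B" if "l \<in> ball l1 (l1 / 2)" for l
    proof (rule onorm_le)
      show "norm (bump_rate l x * d) \<le> B * norm d" for d
        using mult_right_mono[OF rate[OF that, of x], of "\<bar>d\<bar>"] by (simp only: real_norm_def abs_mult abs_ge_zero)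
    qed
    have "l \<in> ball l1 (l1 / 2)" "l1 \<in> ball l1 (l1 / 2)"
      using l assms by (simp_all add: dist_real_def abs_minus_commute)
    from differentiable_bound[OF convex_ball der on this]
    show ?thesis by (simp only: real_norm_def)
  qed
  then show thesis using that[OF B0] by simp
qed

text \<open>Reduces complex linearity of a derivative to the Cauchy-Riemann equations in the
  coordinate directions.\<close>

lemma linear_complexI:
  fixes D :: "complex^'n \<Rightarrow> complex"
  assumes lin: "linear D" and i: "\<And>k. D (\<i> *s axis k 1) = \<i> * D (axis k 1)"
  shows "D (c *s v) = c * D v"
proof -
  have ax: "D (a *s axis k 1) = a * D (axis k 1)" for a k
  proof -
    have "a *s axis k 1 = Re a *\<^sub>R axis k 1 + Im a *\<^sub>R (\<i> *s (axis k 1 :: complex^'n))"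
      by (simp add: vec_eq_iff complex_eq_iff)
    then have "D (a *s axis k 1) = Re a *\<^sub>R D (axis k 1) + Im a *\<^sub>R D (\<i> *s axis k 1)"
      by (simp only: linear_add[OF lin] linear_cmul[OF lin])
    then show ?thesis by (simp add: i complex_eq_iff algebra_simps)
  qed
  have ex: "D v = (\<Sum>k\<in>UNIV. v $ k * D (axis k 1))" for v
  proof -
    have "D v = D (\<Sum>k\<in>UNIV. v $ k *s axis k 1)" by (simp only: basis_expansion)
    then show ?thesis by (simp only: linear_sum[OF lin] ax)
  qed
  show ?thesis by (simp add: ex[of "c *s v"] ex[of v] sum_distrib_left mult.assoc)
qed

lemma dbar_dbump: "dbar (\<lambda>v. of_real (dbump l x v)) (axis k 1) =
    of_real (- 4 * l ^ Suc CARD('n) * max 0 (1 - l * (norm x)\<^sup>2)) * x $ k" for x :: "complex^'n"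
proof -
  have "\<i> *s axis k 1 = (axis k \<i> :: complex^'n)" by (simp add: vec_eq_iff axis_def)
  \<comment> \<open>The real inner products with \<open>axis k 1\<close> and
    \<open>\<i> *s axis k 1\<close> pick out the real and imaginary parts of
    \<open>x $ k\<close>.\<close>
  then have "complex_of_real (x \<bullet> axis k 1) + \<i> * complex_of_real (x \<bullet> (\<i> *s axis k 1)) = x $ k"
    by (simp add: inner_axis inner_complex_def complex_eq_iff)
  note eq = this
  have "dbar (\<lambda>v. of_real (dbump l x v)) (axis k 1) =
    of_real (- 4 * l ^ Suc CARD('n) * max 0 (1 - l * (norm x)\<^sup>2)) *
      (complex_of_real (x \<bullet> axis k 1) + \<i> * complex_of_real (x \<bullet> (\<i> *s axis k 1)))"
    unfolding dbar_def dbump_def of_real_mult by (simp only: distrib_left mult.left_commute[of \<i>])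
  then show ?thesis by (simp only: eq)
qed

text \<open>Besides the proper map itself, \<open>h\<close> will be the identity, for the mass of
  the bump, and a perturbed map, for the existence of a noncritical point.\<close>

definition mtrace ::
  "(complex^'n) set \<Rightarrow> (complex^'n \<Rightarrow> complex^'n) \<Rightarrow> (complex^'n \<Rightarrow> complex) \<Rightarrow> real \<Rightarrow> complex^'n \<Rightarrow> complex" where
  "mtrace S h g l w = (LINT z:S|lborel. g z * cnj (cjacobian h z) * of_real (bump l (h z - w)))"

section \<open>Differentiability, parameter invariance and holomorphy of the mollified trace\<close>

context
  fixes S :: "(complex^'n) set" and h :: "complex^'n \<Rightarrow> complex^'n" and g :: "complex^'n \<Rightarrow> complex"
  assumes S: "open S" and h: "holomorphic_map_on h S" and g: "holomorphic_fun_on g S"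
begin

lemma continuous_on_density: "continuous_on S (\<lambda>z. g z * cnj (cjacobian h z))"
  by (intro continuous_intros holomorphic_fun_on_imp_continuous_on g holomorphic_cjacobian h S)

text \<open>Properness enters this part as compactness of the preimage of one closed ball; here it
  passes to smaller closed sets.\<close>

lemma compact_preimage_subset:
  assumes "compact {z\<in>S. h z \<in> C}" "closed C'" "C' \<subseteq> C"
  shows "compact {z\<in>S. h z \<in> C'}"
proof -
  have "{z\<in>S. h z \<in> C'} = {z\<in>S. h z \<in> C} \<inter> h -` C'" using assms(3) by auto
  moreover have "closedin (top_of_set {z\<in>S. h z \<in> C}) ({z\<in>S. h z \<in> C} \<inter> h -` C')"
    by (rule continuous_closedin_preimage[OF continuous_on_subset[OF holomorphic_map_on_imp_continuous_on[OF h]] assms(2)])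
      auto
  ultimately show ?thesis using closedin_compact[OF assms(1)] by simp
qed

lemma mtrace_set_integrable:
  assumes K: "compact {z\<in>S. h z \<in> cball w r}" and r: "0 < r" "1 < l * r\<^sup>2"
  shows "set_integrable lborel S (\<lambda>z. g z * cnj (cjacobian h z) * of_real (bump l (h z - w)))"
proof (rule set_integrable_compact_support[OF K])
  show "continuous_on {z\<in>S. h z \<in> cball w r} (\<lambda>z. g z * cnj (cjacobian h z) * of_real (bump l (h z - w)))"
    by (intro continuous_intros continuous_on_subset[OF continuous_on_density]
        continuous_on_subset[OF holomorphic_map_on_imp_continuous_on[OF h]]) auto
  show "g z * cnj (cjacobian h z) * of_real (bump l (h z - w)) = 0" if "z \<in> S - {z\<in>S. h z \<in> cball w r}" for z
  proof -
    have "bump l (h z - w) = 0" using bump_shift_eq_0[OF r] that by blast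
    then show ?thesis by simp
  qed
qed auto

lemma density_integrable:
  assumes "compact {z\<in>S. h z \<in> C}"
  shows "integrable lborel (\<lambda>z. B * (indicator {z\<in>S. h z \<in> C} z *\<^sub>R cmod (g z * cnj (cjacobian h z))))"
proof -
  have "set_integrable lborel {z\<in>S. h z \<in> C} (\<lambda>z. cmod (g z * cnj (cjacobian h z)))"
    unfolding set_integrable_def
    by (rule borel_integrable_compact[OF assms])
       (intro continuous_intros continuous_on_subset[OF continuous_on_density], auto)
  then show ?thesis by (simp add: set_integrable_def)
qed

text \<open>The margin \<open>r\<close> keeps \<open>cball w r\<close> inside
  \<open>cball b R\<close> for \<open>w\<close> near \<open>w0\<close>, so all integrands live on
  one compact set and share an integrable Lipschitz bound.\<close>

lemma mtrace_has_derivative: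
  assumes K: "compact {z\<in>S. h z \<in> cball b R}" and r: "0 < r" "1 < l * r\<^sup>2" and w0: "w0 \<in> ball b (R - r)"
  shows "(mtrace S h g l has_derivative
     (\<lambda>v. LINT z:S|lborel. g z * cnj (cjacobian h z) * of_real (- dbump l (h z - w0) v))) (at w0)"
proof -
  have l: "l > 0" using r by (metis less_trans zero_less_mult_pos2 zero_less_one zero_less_power)
  obtain B where B: "B \<ge> 0" "\<And>x y :: complex^'n. \<bar>bump l x - bump l y\<bar> \<le> B * norm (x - y)"
    using bump_lipschitz[OF l] by blast
  let ?u = "\<lambda>z. g z * cnj (cjacobian h z)"
  let ?K = "{z\<in>S. h z \<in> cball b R}"
  obtain e where e: "e > 0" "ball w0 e \<subseteq> ball b (R - r)"
    using w0 open_ball open_contains_ball by blast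
  have cb: "cball w r \<subseteq> cball b R" if "dist w w0 < e" for w
  proof
    fix x assume x: "x \<in> cball w r"
    have "w \<in> ball b (R - r)" using that e(2) by (auto simp: dist_commute)
    then show "x \<in> cball b R" using x dist_triangle[of b x w] by simp
  qed
  have Kw: "compact {z\<in>S. h z \<in> cball w r}" if "dist w w0 < e" for w
    by (rule compact_preimage_subset[OF K _ cb[OF that]]) simp
  have zero: "bump l (h z - w) = 0" if "z \<in> S" "z \<notin> ?K" "dist w w0 < e" for z w
    using that cb[OF that(3)] by (intro bump_shift_eq_0[OF r]) blast
  show ?thesis
    unfolding mtrace_def[abs_def] set_lebesgue_integral_def
  proof (rule has_derivative_integral_dominated(2)[where e = e
        and L = "\<lambda>z. B * (indicator ?K z *\<^sub>R cmod (?u z))"])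
    fix w assume w: "dist w w0 < e"
    show "integrable lborel (\<lambda>z. indicator S z *\<^sub>R (?u z * of_real (bump l (h z - w))))"
      using mtrace_set_integrable[OF Kw[OF w] r] by (simp add: set_integrable_def)
    fix z
    show "norm (indicator S z *\<^sub>R (?u z * of_real (bump l (h z - w)))
        - indicator S z *\<^sub>R (?u z * of_real (bump l (h z - w0))))
      \<le> B * (indicator ?K z *\<^sub>R cmod (?u z)) * norm (w - w0)"
    proof (cases "z \<in> ?K")
      case True
      have "cmod (?u z) * \<bar>bump l (h z - w) - bump l (h z - w0)\<bar> \<le> cmod (?u z) * (B * norm (w - w0))"
        using B(2)[of "h z - w" "h z - w0"] by (intro mult_left_mono) (auto simp: norm_minus_commute)
      moreover have "norm (?u z * of_real (bump l (h z - w)) - ?u z * of_real (bump l (h z - w0)))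
          = cmod (?u z) * \<bar>bump l (h z - w) - bump l (h z - w0)\<bar>"
        by (simp only: right_diff_distrib[symmetric] of_real_diff[symmetric] norm_mult norm_of_real)
      ultimately show ?thesis using True by (simp add: algebra_simps)
    next
      case False
      show ?thesis
      proof (cases "z \<in> S")
        case True
        have "bump l (h z - w) = 0" "bump l (h z - w0) = 0"
          using zero[OF True False] w e(1) by auto
        then show ?thesis using False by simp
      qed simp
    qed
  next
    fix z
    have "((\<lambda>w. bump l (h z - w)) has_derivative (\<lambda>v. dbump l (h z - w0) (- v))) (at w0)"
      by (rule has_derivative_compose[OF _ bump_has_derivative]) (auto intro!: derivative_eq_intros)
    then have "((\<lambda>w. bump l (h z - w)) has_derivative (\<lambda>v. - dbump l (h z - w0) v)) (at w0)"
      by (simp add: dbump_def)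
    then show "((\<lambda>w. indicator S z *\<^sub>R (?u z * of_real (bump l (h z - w)))) has_derivative
        (\<lambda>v. indicator S z *\<^sub>R (?u z * of_real (- dbump l (h z - w0) v)))) (at w0)"
      by (intro has_derivative_scaleR_right has_derivative_mult_right has_derivative_of_real)
  qed (use e density_integrable[OF K] in auto)
qed

text \<open>The test functions are \<open>bump l (x - w)\<close>, which yields the Cauchy-Riemann
  equations in \<open>w\<close>, and \<open>cnj ((x - w) $ k) * bump l (x - w)\<close>, summed over
  \<open>k\<close>, which yields stationarity in \<open>l\<close>.\<close>

lemma integral_dbar_bump_eq_0:
  assumes K: "compact {z\<in>S. h z \<in> cball w r}" and r: "0 < r" "1 < l * r\<^sup>2"
  shows "(LINT z:S|lborel. g z * cnj (cjacobian h z) * dbar (\<lambda>v. of_real (dbump l (h z - w) v)) (axis k 1)) = 0"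
    and "(LINT z:S|lborel. g z * cnj (cjacobian h z) *
      (\<Sum>k\<in>UNIV. dbar (\<lambda>v. cnj ((h z - w) $ k) * of_real (dbump l (h z - w) v)
          + cnj (v $ k) * of_real (bump l (h z - w))) (axis k 1))) = 0"
proof -
  have supp: "bump l (x - w) = 0" if "x \<notin> cball w r" for x
    using bump_shift_eq_0[OF r that] .
  have sh: "((\<lambda>x. bump l (x - w)) has_derivative dbump l (x - w)) (at x)" for x
    by (rule has_derivative_compose[OF _ bump_has_derivative]) (auto intro!: derivative_eq_intros)
  have 1: "((\<lambda>x. complex_of_real (bump l (x - w))) has_derivative (\<lambda>v. of_real (dbump l (x - w) v))) (at x)" for x
    by (rule has_derivative_of_real[OF sh])
  show "(LINT z:S|lborel. g z * cnj (cjacobian h z) * dbar (\<lambda>v. of_real (dbump l (h z - w) v)) (axis k 1)) = 0"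
    by (rule integral_dbar_pullback_eq_0(2)[OF S h g 1 _ K])
       (use supp in \<open>auto intro!: continuous_intros\<close>)
  have 2: "((\<lambda>x. cnj ((x - w) $ k) * complex_of_real (bump l (x - w))) has_derivative
      (\<lambda>v. cnj ((x - w) $ k) * of_real (dbump l (x - w) v) + cnj (v $ k) * of_real (bump l (x - w)))) (at x)" for x k
    by (rule has_derivative_mult[OF _ 1])
       (auto intro!: has_derivative_cnj bounded_linear.has_derivative[OF bounded_linear_vec_nth] derivative_eq_intros)
  note P = integral_dbar_pullback_eq_0[OF S h g 2 _ K]
  have P: "set_integrable lborel S (\<lambda>z. g z * cnj (cjacobian h z) * dbar (\<lambda>v. cnj ((h z - w) $ k) * of_real (dbump l (h z - w) v)
          + cnj (v $ k) * of_real (bump l (h z - w))) (axis k 1))"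
      "(LINT z:S|lborel. g z * cnj (cjacobian h z) * dbar (\<lambda>v. cnj ((h z - w) $ k) * of_real (dbump l (h z - w) v)
          + cnj (v $ k) * of_real (bump l (h z - w))) (axis k 1)) = 0" for k
    by (rule P; use supp in \<open>auto intro!: continuous_intros\<close>)+
  show "(LINT z:S|lborel. g z * cnj (cjacobian h z) *
      (\<Sum>k\<in>UNIV. dbar (\<lambda>v. cnj ((h z - w) $ k) * of_real (dbump l (h z - w) v)
          + cnj (v $ k) * of_real (bump l (h z - w))) (axis k 1))) = 0"
    using P unfolding sum_distrib_left set_lebesgue_integral_def set_integrable_def scaleR_sum_right
    by (subst Bochner_Integration.integral_sum) auto
qed

text \<open>The summed conjugate derivatives are \<open>2 * l\<close> times
  \<open>bump_rate\<close>: the 2 comes from the normalization of \<open>dbar\<close>, the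
  \<open>l\<close> from using the bump itself, which carries one power of \<open>l\<close> more than
  the primitive of the rate.\<close>

lemma integral_bump_rate_eq_0:
  assumes K: "compact {z\<in>S. h z \<in> cball w r}" and r: "0 < r" "1 < l * r\<^sup>2"
  shows "(LINT z:S|lborel. g z * cnj (cjacobian h z) * of_real (bump_rate l (h z - w))) = 0"
proof -
  have l: "l > 0" using r by (metis less_trans zero_less_mult_pos2 zero_less_one zero_less_power)
  have "(\<Sum>k\<in>UNIV. dbar (\<lambda>v. cnj (x $ k) * of_real (dbump l x v) + cnj (v $ k) * of_real (bump l x)) (axis k 1))
      = of_real (2 * l) * of_real (bump_rate l x)" for x :: "complex^'n"
  proof -
    let ?M = "max 0 (1 - l * (norm x)\<^sup>2)"
    have "dbar (\<lambda>v. cnj (x $ k) * of_real (dbump l x v) + cnj (v $ k) * of_real (bump l x)) (axis k 1)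
        = cnj (x $ k) * dbar (\<lambda>v. of_real (dbump l x v)) (axis k 1) + 2 * of_real (bump l x)" for k
      by (simp add: dbar_def axis_def algebra_simps)
    also have "\<dots> k = of_real (- 4 * l ^ Suc CARD('n) * ?M * (cmod (x $ k))\<^sup>2 + 2 * bump l x)" for k
      unfolding dbar_dbump by (simp add: complex_norm_square[symmetric] mult_ac)
    finally have "(\<Sum>k\<in>UNIV. dbar (\<lambda>v. cnj (x $ k) * of_real (dbump l x v) + cnj (v $ k) * of_real (bump l x)) (axis k 1))
      = of_real (\<Sum>k\<in>UNIV. - 4 * l ^ Suc CARD('n) * ?M * (cmod (x $ k))\<^sup>2 + 2 * bump l x)"
      by simp
    also have "(\<Sum>k\<in>UNIV. - 4 * l ^ Suc CARD('n) * ?M * (cmod (x $ k))\<^sup>2 + 2 * bump l x)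
        = - 4 * l ^ Suc CARD('n) * ?M * (norm x)\<^sup>2 + 2 * CARD('n) * bump l x"
    proof -
      have "(norm x)\<^sup>2 = (\<Sum>k\<in>UNIV. (cmod (x $ k))\<^sup>2)"
        by (simp add: norm_vec_def L2_set_def sum_nonneg)
      then show ?thesis
        by (simp only: sum.distrib sum_distrib_left[symmetric]) simp
    qed
    also have "\<dots> = 2 * l * bump_rate l x"
    proof -
      have "l ^ CARD('n) = l * l ^ (CARD('n) - 1)"
        by (simp add: power_eq_if)
      then show ?thesis
        by (simp add: bump_rate_def bump_def algebra_simps)
    qed
    finally show ?thesis by simp
  qed
  note eq = this
  have "(LINT z:S|lborel. of_real (2 * l) * (g z * cnj (cjacobian h z) * of_real (bump_rate l (h z - w)))) = 0"
    using integral_dbar_bump_eq_0(2)[OF K r] by (simp only: eq mult.left_commute[of _ "complex_of_real (2 * l)"])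
  then have "of_real (2 * l) * (LINT z:S|lborel. g z * cnj (cjacobian h z) * of_real (bump_rate l (h z - w))) = 0"
    by (simp only: set_integral_mult_right)
  then show ?thesis using l by simp
qed

lemma mtrace_parameter_derivative:
  assumes K: "compact {z\<in>S. h z \<in> cball w r}" and r: "0 < r" "1 < l * r\<^sup>2"
  shows "((\<lambda>l. mtrace S h g l w) has_derivative (\<lambda>_. 0)) (at l)"
proof -
  have l: "l > 0" using r by (metis less_trans zero_less_mult_pos2 zero_less_one zero_less_power)
  obtain B where B: "B \<ge> 0" "\<And>l' (x :: complex^'n). \<bar>l' - l\<bar> < l / 2 \<Longrightarrow> \<bar>bump l' x - bump l x\<bar> \<le> B * \<bar>l' - l\<bar>"
    using bump_lipschitz_parameter[OF l] by blast
  let ?u = "\<lambda>z. g z * cnj (cjacobian h z)"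
  let ?K = "{z\<in>S. h z \<in> cball w r}"
  \<comment> \<open>The first bound serves the Lipschitz estimate in the parameter, the second keeps
    \<open>1 < l' * r\<^sup>2\<close>.\<close>
  define e where "e = min (l / 2) (l - 1 / r\<^sup>2)"
  have e: "e > 0" using l r by (simp add: e_def field_simps)
  have r': "1 < l' * r\<^sup>2" if "dist l' l < e" for l'
  proof -
    have "1 / r\<^sup>2 < l'" using that by (auto simp: e_def dist_real_def)
    then show ?thesis using r(1) by (simp add: field_simps)
  qed
  have zero: "bump l' (h z - w) = 0" if "z \<in> S" "z \<notin> ?K" "dist l' l < e" for z l'
    using that by (intro bump_shift_eq_0[OF r(1) r'[OF that(3)]]) blast
  have "((\<lambda>l. mtrace S h g l w) has_derivative
      (\<lambda>d. \<integral>z. indicator S z *\<^sub>R (?u z * of_real (bump_rate l (h z - w) * d)) \<partial>lborel)) (at l)"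
    unfolding mtrace_def set_lebesgue_integral_def
  proof (rule has_derivative_integral_dominated(2)[where e = e
        and L = "\<lambda>z. B * (indicator ?K z *\<^sub>R cmod (?u z))"])
    fix l' assume l': "dist l' l < e"
    show "integrable lborel (\<lambda>z. indicator S z *\<^sub>R (?u z * of_real (bump l' (h z - w))))"
      using mtrace_set_integrable[OF K r(1) r'[OF l']] by (simp add: set_integrable_def)
    fix z
    show "norm (indicator S z *\<^sub>R (?u z * of_real (bump l' (h z - w)))
        - indicator S z *\<^sub>R (?u z * of_real (bump l (h z - w))))
      \<le> B * (indicator ?K z *\<^sub>R cmod (?u z)) * norm (l' - l)"
    proof (cases "z \<in> ?K")
      case True
      have "cmod (?u z) * \<bar>bump l' (h z - w) - bump l (h z - w)\<bar> \<le> cmod (?u z) * (B * \<bar>l' - l\<bar>)"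
        using B(2)[of l' "h z - w"] l' by (intro mult_left_mono) (auto simp: e_def dist_real_def)
      moreover have "norm (?u z * of_real (bump l' (h z - w)) - ?u z * of_real (bump l (h z - w)))
          = cmod (?u z) * \<bar>bump l' (h z - w) - bump l (h z - w)\<bar>"
        by (simp only: right_diff_distrib[symmetric] of_real_diff[symmetric] norm_mult norm_of_real)
      ultimately show ?thesis using True by (simp add: algebra_simps)
    next
      case False
      show ?thesis
      proof (cases "z \<in> S")
        case True
        have "bump l' (h z - w) = 0" "bump l (h z - w) = 0"
          using zero[OF True False] l' e by auto
        then show ?thesis using False by simp
      qed simp
    qed
  next
    fix z
    show "((\<lambda>l. indicator S z *\<^sub>R (?u z * of_real (bump l (h z - w)))) has_derivative
        (\<lambda>d. indicator S z *\<^sub>R (?u z * of_real (bump_rate l (h z - w) * d)))) (at l)"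
      using bump_has_real_derivative[of "h z - w" l]
      by (intro has_derivative_scaleR_right has_derivative_mult_right has_derivative_of_real)
         (simp add: has_field_derivative_def)
  qed (use e density_integrable[OF K] in auto)
  moreover have "(\<integral>z. indicator S z *\<^sub>R (?u z * of_real (bump_rate l (h z - w) * d)) \<partial>lborel) = 0" for d
  proof -
    have eq: "(\<lambda>z. indicator S z *\<^sub>R (?u z * of_real (bump_rate l (h z - w) * d)))
        = (\<lambda>z. indicator S z *\<^sub>R (?u z * of_real (bump_rate l (h z - w))) * of_real d)"
      by (simp add: fun_eq_iff)
    have "(\<integral>z. indicator S z *\<^sub>R (?u z * of_real (bump_rate l (h z - w) * d)) \<partial>lborel)
        = (\<integral>z. indicator S z *\<^sub>R (?u z * of_real (bump_rate l (h z - w))) \<partial>lborel) * of_real d"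
      by (simp only: eq integral_mult_left_zero)
    then show ?thesis
      using integral_bump_rate_eq_0[OF K r] by (simp add: set_lebesgue_integral_def)
  qed
  ultimately show ?thesis by simp
qed

text \<open>The admissible parameters form the interval above \<open>1 / r\<^sup>2\<close>, on which
  the derivative in \<open>l\<close> vanishes.\<close>

lemma mtrace_parameter_independent:
  assumes K: "compact {z\<in>S. h z \<in> cball w r}" and r: "0 < r" "1 < l * r\<^sup>2" "1 < l' * r\<^sup>2"
  shows "mtrace S h g l w = mtrace S h g l' w"
proof -
  have iff: "l \<in> {1 / r\<^sup>2<..} \<longleftrightarrow> 1 < l * r\<^sup>2" for l
    using r(1) by (simp add: pos_divide_less_eq)
  have der: "((\<lambda>l. mtrace S h g l w) has_derivative (\<lambda>_. 0)) (at l within {1 / r\<^sup>2<..})"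
    if "l \<in> {1 / r\<^sup>2<..}" for l
    using that iff has_derivative_at_withinI[OF mtrace_parameter_derivative[OF K r(1)]] by blast
  have "l \<in> {1 / r\<^sup>2<..}" "l' \<in> {1 / r\<^sup>2<..}"
    using r(2,3) iff by blast+
  from has_derivative_zero_unique[OF convex_real_interval(3) der this] show ?thesis .
qed

lemma mtrace_holomorphic:
  assumes K: "compact {z\<in>S. h z \<in> cball b R}" and r: "0 < r" "1 < l * r\<^sup>2"
  shows "holomorphic_fun_on (mtrace S h g l) (ball b (R - r))"
proof (rule holomorphic_fun_onI)
  fix w0 assume w0: "w0 \<in> ball b (R - r)"
  let ?D = "\<lambda>v. LINT z:S|lborel. g z * cnj (cjacobian h z) * of_real (- dbump l (h z - w0) v)"
  show D: "(mtrace S h g l has_derivative ?D) (at w0)"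
    by (rule mtrace_has_derivative[OF K r w0])
  have cb: "cball w0 r \<subseteq> cball b R"
  proof
    fix x assume x: "x \<in> cball w0 r"
    then show "x \<in> cball b R" using w0 dist_triangle[of b x w0] by simp
  qed
  have K': "compact {z\<in>S. h z \<in> cball w0 r}"
    by (rule compact_preimage_subset[OF K _ cb]) simp
  have int: "set_integrable lborel S (\<lambda>z. g z * cnj (cjacobian h z) * of_real (- dbump l (h z - w0) v))" for v
  proof (rule set_integrable_compact_support[OF K'])
    show "continuous_on {z\<in>S. h z \<in> cball w0 r} (\<lambda>z. g z * cnj (cjacobian h z) * of_real (- dbump l (h z - w0) v))"
      by (intro continuous_intros continuous_on_subset[OF continuous_on_density]
          continuous_on_subset[OF holomorphic_map_on_imp_continuous_on[OF h]]) auto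
    fix z assume z: "z \<in> S - {z\<in>S. h z \<in> cball w0 r}"
    have l: "l > 0" using r by (metis less_trans zero_less_mult_pos2 zero_less_one zero_less_power)
    have "r \<le> norm (h z - w0)" using z by (auto simp: dist_norm norm_minus_commute)
    then have "l * r\<^sup>2 \<le> l * (norm (h z - w0))\<^sup>2" using l r by (intro mult_left_mono power_mono) auto
    then show "g z * cnj (cjacobian h z) * of_real (- dbump l (h z - w0) v) = 0"
      using r(2) by (simp add: dbump_def)
  qed auto
  show "?D (c *s v) = c * ?D v" for c v
  proof (rule linear_complexI)
    show "linear ?D" using D by (rule has_derivative_linear)
    fix k
    \<comment> \<open>Since \<open>w\<close> enters through \<open>h z - w\<close>, the
      Cauchy-Riemann expression in \<open>w\<close> is minus the \<open>dbar\<close> integral that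
      vanishes.\<close>
    have "(LINT z:S|lborel. g z * cnj (cjacobian h z) * of_real (- dbump l (h z - w0) (axis k 1))
        + \<i> * (g z * cnj (cjacobian h z) * of_real (- dbump l (h z - w0) (\<i> *s axis k 1))))
      = (LINT z:S|lborel. - (g z * cnj (cjacobian h z) * dbar (\<lambda>v. of_real (dbump l (h z - w0) v)) (axis k 1)))"
      by (simp add: dbar_def algebra_simps)
    also have "\<dots> = 0"
      using integral_dbar_bump_eq_0(1)[OF K' r] by (simp add: set_lebesgue_integral_def)
    finally have "?D (axis k 1) + \<i> * ?D (\<i> *s axis k 1) = 0"
      by (simp only: set_integral_add(2)[OF int set_integrable_mult_right[OF int]] set_integral_mult_right)
    then have "\<i> * (?D (axis k 1) + \<i> * ?D (\<i> *s axis k 1)) = 0" by simp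
    then show "?D (\<i> *s axis k 1) = \<i> * ?D (axis k 1)"
      by (simp add: distrib_left mult.assoc[symmetric])
  qed
qed

end

subsection \<open>Complex vectors as real vectors\<close>

text \<open>The change of variables theorem is stated over \<open>real^'k\<close>, and
  \<open>'n bit0\<close> is an index type with twice as many elements as \<open>'n\<close>. The
  order of the real coordinates is immaterial, hence the choice by \<open>SOME\<close>.\<close>

definition split_index :: "'n::finite bit0 \<Rightarrow> 'n \<times> bool" where
  "split_index = (SOME f. bij f)"

lemma bij_split_index: "bij (split_index :: 'n::finite bit0 \<Rightarrow> 'n \<times> bool)"
proof -
  have "card (UNIV :: 'n bit0 set) = card (UNIV :: ('n \<times> bool) set)"
    by (simp add: card_cartesian_product UNIV_Times_UNIV[symmetric] del: UNIV_Times_UNIV)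
  then have "\<exists>f :: 'n bit0 \<Rightarrow> 'n \<times> bool. bij f"
    using finite_same_card_bij[of "UNIV :: 'n bit0 set" "UNIV :: ('n \<times> bool) set"] by auto
  then show ?thesis unfolding split_index_def by (rule someI_ex)
qed

definition realify :: "complex^'n \<Rightarrow> real^('n bit0)" where
  "realify z = (\<chi> i. if snd (split_index i) then Im (z $ fst (split_index i)) else Re (z $ fst (split_index i)))"

definition complexify :: "real^('n bit0) \<Rightarrow> complex^'n" where
  "complexify x = (\<chi> j. Complex (x $ inv split_index (j, False)) (x $ inv split_index (j, True)))"

lemma split_index_inv [simp]: "split_index (inv split_index p) = p"
  by (simp add: bij_is_surj[OF bij_split_index] surj_f_inv_f)

lemma inv_split_index [simp]: "inv split_index (split_index i) = i"
  by (simp add: bij_is_inj[OF bij_split_index])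

lemma complexify_realify [simp]: "complexify (realify z) = z"
  by (simp add: complexify_def realify_def vec_eq_iff)

lemma realify_complexify [simp]: "realify (complexify x) = x"
proof -
  have "realify (complexify x) $ i = x $ i" for i
  proof (cases "split_index i")
    case (Pair j b)
    then have "inv split_index (j, b) = i" using inv_split_index[of i] by simp
    with Pair show ?thesis by (cases b) (simp_all add: realify_def complexify_def)
  qed
  then show ?thesis by (simp add: vec_eq_iff)
qed

lemma linear_realify: "linear (realify :: complex^'n \<Rightarrow> _)"
  by (rule linearI) (simp_all add: realify_def vec_eq_iff)

lemma linear_complexify: "linear (complexify :: _ \<Rightarrow> complex^'n)"
  by (rule linearI) (simp_all add: complexify_def vec_eq_iff complex_eq_iff)

lemma sum_split_index: "(\<Sum>i\<in>UNIV. f (split_index i)) = (\<Sum>j\<in>UNIV. f (j, False) + f (j, True))"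
  for f :: "'n::finite \<times> bool \<Rightarrow> 'a::comm_monoid_add"
proof -
  have "(\<Sum>i\<in>UNIV. f (split_index i)) = (\<Sum>p\<in>UNIV. f p)"
    by (rule sum.reindex_bij_betw) (rule bij_split_index)
  also have "\<dots> = (\<Sum>j\<in>UNIV. \<Sum>b\<in>UNIV. f (j, b))"
    by (simp add: sum.cartesian_product UNIV_Times_UNIV)
  finally show ?thesis by (simp add: UNIV_bool add.commute)
qed

lemma prod_split_index: "(\<Prod>i\<in>UNIV. f (split_index i)) = (\<Prod>j\<in>UNIV. f (j, False) * f (j, True))"
  for f :: "'n::finite \<times> bool \<Rightarrow> 'a::comm_monoid_mult"
proof -
  have "(\<Prod>i\<in>UNIV. f (split_index i)) = (\<Prod>p\<in>UNIV. f p)"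
    by (rule prod.reindex_bij_betw) (rule bij_split_index)
  also have "\<dots> = (\<Prod>j\<in>UNIV. \<Prod>b\<in>UNIV. f (j, b))"
    by (simp add: prod.cartesian_product UNIV_Times_UNIV)
  finally show ?thesis by (simp add: UNIV_bool mult.commute)
qed

lemma inner_realify: "realify x \<bullet> realify y = x \<bullet> y" for x y :: "complex^'n"
proof -
  have "realify x \<bullet> realify y = (\<Sum>i\<in>UNIV. case split_index i of (j, b) \<Rightarrow>
      if b then Im (x $ j) * Im (y $ j) else Re (x $ j) * Re (y $ j))"
    unfolding inner_vec_def realify_def by (rule sum.cong) (auto simp: split_def)
  also have "\<dots> = x \<bullet> y"
    by (subst sum_split_index) (simp add: inner_vec_def inner_complex_def)
  finally show ?thesis .
qed

section \<open>The real determinant of a complex matrix, by elimination\<close>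

definition real_matrix :: "complex^'n^'n \<Rightarrow> real^('n bit0)^('n bit0)" where
  "real_matrix A = matrix (\<lambda>x. realify (A *v complexify x))"

lemma linear_real_matrix: "linear (\<lambda>x. realify (A *v complexify x))" for A :: "complex^'n^'n"
proof -
  have "linear (\<lambda>z. A *v z)"
    by (rule linearI) (simp_all add: matrix_vector_right_distrib matrix_vector_mult_scaleR scaleR_eq_vector_smult vector_scalar_commute)
  from linear_compose[OF linear_compose[OF linear_complexify this] linear_realify]
  show ?thesis by (simp add: o_def)
qed

lemma real_matrix_works: "real_matrix A *v x = realify (A *v complexify x)"
  using matrix_vector_mul(2)[OF linear_real_matrix[of A]] by (simp add: real_matrix_def fun_eq_iff)

lemma real_matrix_mult: "real_matrix (A ** B) = real_matrix A ** real_matrix B"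
  by (simp add: matrix_eq matrix_vector_mul_assoc[symmetric] real_matrix_works)

lemma real_matrix_1: "real_matrix (mat 1) = mat 1"
  by (simp add: matrix_eq real_matrix_works)

text \<open>The identity with one row exchanged covers both elementary types: shears for
  \<open>r $ k = 1\<close> and scalings for \<open>r = axis k a\<close>. As a right factor it scales
  column \<open>k\<close> and adds multiples of it to the other columns.\<close>

definition replace_row :: "'n \<Rightarrow> 'a^'n \<Rightarrow> 'a::comm_ring_1^'n^'n" where
  "replace_row k r = (\<chi> i. if i = k then r else axis i 1)"

lemma matrix_mult_replace_row:
  "(X ** replace_row k r) $ i $ l = X $ i $ k * r $ l + (if l = k then 0 else X $ i $ l)"
proof -
  have "(X ** replace_row k r) $ i $ l = (\<Sum>j\<in>UNIV. X $ i $ j * replace_row k r $ j $ l)"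
    by (simp add: matrix_matrix_mult_def)
  also have "\<dots> = X $ i $ k * r $ l + (\<Sum>j\<in>UNIV - {k}. X $ i $ j * replace_row k r $ j $ l)"
    by (subst sum.remove[of _ k]) (auto simp: replace_row_def)
  also have "(\<Sum>j\<in>UNIV - {k}. X $ i $ j * replace_row k r $ j $ l) = (\<Sum>j\<in>UNIV - {k}. if j = l then X $ i $ l else 0)"
    by (rule sum.cong) (auto simp: replace_row_def axis_def)
  also have "\<dots> = (if l = k then 0 else X $ i $ l)"
    by (auto simp: sum.delta)
  finally show ?thesis .
qed

lemma det_replace_row: "det (replace_row k r) = r $ k" for r :: "'a::comm_ring_1^'n"
proof -
  have "det ((\<chi> i. if i = k then axis j 1 else axis i 1) :: 'a^'n^'n) = (if j = k then 1 else 0)" for j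
  proof (cases "j = k")
    case True
    have "((\<chi> i. if i = k then axis k 1 else axis i 1) :: 'a^'n^'n) = mat 1"
      by (simp add: vec_eq_iff mat_def axis_def)
    then have "det ((\<chi> i. if i = k then axis k 1 else axis i 1) :: 'a^'n^'n) = 1"
      by (simp only: det_I)
    then show ?thesis by (simp only: True if_True simp_thms)
  next
    case False
    have "det ((\<chi> i. if i = k then axis j 1 else axis i 1) :: 'a^'n^'n) = 0"
      by (rule det_identical_rows[OF False]) (use False in \<open>simp add: row_def\<close>)
    then show ?thesis using False by simp
  qed
  then have "r $ j * det ((\<chi> i. if i = k then axis j 1 else axis i 1) :: 'a^'n^'n) = (if j = k then r $ k else 0)" for j
    by simp
  then show ?thesis
    unfolding replace_row_def det_replace_row_expand[of k r] by (simp only:) simp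
qed

lemma replace_row_mult:
  "replace_row k s ** replace_row k r = replace_row k (\<chi> l. s $ k * r $ l + (if l = k then 0 else s $ l))"
  by (auto simp: vec_eq_iff matrix_mult_replace_row) (auto simp: replace_row_def axis_def)

lemma replace_row_axis: "replace_row k (axis k 1) = mat 1"
  by (simp add: vec_eq_iff replace_row_def mat_def axis_def)

lemma det_real_matrix_nonzero:
  fixes A :: "complex^'n^'n"
  assumes "A ** B = mat 1"
  shows "det (real_matrix A) \<noteq> 0"
proof -
  have "det (real_matrix A) * det (real_matrix B) = 1"
    by (simp add: det_mul[symmetric] real_matrix_mult[symmetric] assms real_matrix_1)
  then show ?thesis by auto
qed

text \<open>A shear \<open>E\<close> is conjugate to \<open>E\<^sup>2\<close> under scaling by 2, hence has real determinant 1.\<close>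

lemma det_real_shear:
  fixes s :: "complex^'n"
  assumes s: "s $ k = 1"
  shows "det (real_matrix (replace_row k s)) = 1"
proof -
  let ?D = "\<lambda>a. replace_row k (axis k a) :: complex^'n^'n"
  let ?\<rho> = "\<lambda>A :: complex^'n^'n. det (real_matrix A)"
  have ax: "axis k a $ l = (if l = k then a else 0)" for a and l :: 'n
    by (simp add: axis_def)
  have inv: "replace_row k s ** replace_row k (2 *s axis k 1 - s) = mat 1"
    unfolding replace_row_mult replace_row_axis[of k, symmetric]
    by (rule arg_cong[of _ _ "replace_row k"]) (auto simp: vec_eq_iff s ax)
  have "?D 2 ** replace_row k s ** ?D (1/2) = replace_row k s ** replace_row k s"
    unfolding replace_row_mult by (rule arg_cong[of _ _ "replace_row k"]) (auto simp: vec_eq_iff s ax)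
  then have "?\<rho> (?D 2) * ?\<rho> (replace_row k s) * ?\<rho> (?D (1/2)) = ?\<rho> (replace_row k s) * ?\<rho> (replace_row k s)"
    by (simp add: det_mul[symmetric] real_matrix_mult[symmetric])
  moreover have "?\<rho> (?D 2) * ?\<rho> (?D (1/2)) = 1"
  proof -
    have "?D 2 ** ?D (1/2) = mat 1"
      unfolding replace_row_mult replace_row_axis[of k, symmetric]
      by (rule arg_cong[of _ _ "replace_row k"]) (auto simp: vec_eq_iff ax)
    then show ?thesis by (simp add: det_mul[symmetric] real_matrix_mult[symmetric] real_matrix_1)
  qed
  ultimately have "?\<rho> (replace_row k s) * 1 = ?\<rho> (replace_row k s) * ?\<rho> (replace_row k s)"
    by (metis mult.assoc mult.commute)
  then show ?thesis
    using det_real_matrix_nonzero[OF inv] by simp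
qed

text \<open>Polar decomposition of \<open>a\<close>: a nonnegative factor gives a real diagonal
  matrix in which it occurs twice, a unit factor acts as an isometry.\<close>

lemma det_real_scaling:
  "\<bar>det (real_matrix (replace_row k (axis k a) :: complex^'n^'n))\<bar> = (cmod a)\<^sup>2"
proof -
  let ?D = "\<lambda>a. replace_row k (axis k a) :: complex^'n^'n"
  let ?\<rho> = "\<lambda>A :: complex^'n^'n. \<bar>det (real_matrix A)\<bar>"
  have ax: "axis k a $ l = (if l = k then a else 0)" for a and l :: 'n
    by (simp add: axis_def)
  have Dv: "(?D a *v z) $ i = (if i = k then a * z $ k else z $ i)" for a z i
  proof -
    have "replace_row k (axis k a) $ i $ j * z $ j = (if j = i then (if i = k then a * z $ k else z $ i) else 0)" for j
      by (auto simp: replace_row_def axis_def)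
    then show ?thesis by (simp add: matrix_vector_mult_def)
  qed
  have pos: "?\<rho> (?D (of_real r)) = r\<^sup>2" if "r \<ge> 0" for r
  proof -
    let ?d = "\<lambda>i :: 'n bit0. if fst (split_index i) = k then r else 1"
    have ent: "real_matrix (?D (of_real r)) $ i $ j = (if i = j then ?d i else 0)" for i j
    proof -
      have "real_matrix (?D (of_real r)) $ i $ j = realify (?D (of_real r) *v complexify (axis j 1)) $ i"
        by (simp add: real_matrix_works[symmetric] matrix_vector_mult_axis)
      also have "\<dots> = ?d i * realify (complexify (axis j 1)) $ i"
        by (simp add: realify_def Dv)
      finally show ?thesis by (simp add: axis_def)
    qed
    then have "det (real_matrix (?D (of_real r))) = (\<Prod>i\<in>UNIV. ?d i)"
      by (subst det_diagonal) (simp_all add: ent)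
    also have "\<dots> = (\<Prod>j\<in>UNIV. (if j = k then r else 1) * (if j = k then r else 1))"
      by (subst prod_split_index[where f = "\<lambda>p. if fst p = k then r else 1"]) simp
    also have "\<dots> = r\<^sup>2"
      by (simp only: prod.distrib) (simp add: power2_eq_square)
    finally show ?thesis by simp
  qed
  have unit: "?\<rho> (?D u) = 1" if "cmod u = 1" for u
  proof -
    have "orthogonal_transformation (\<lambda>x. realify (?D u *v complexify x))"
      unfolding orthogonal_transformation
    proof (intro conjI allI linear_real_matrix)
      fix x
      have "norm (realify (?D u *v complexify x)) = norm (?D u *v complexify x)"
        by (simp add: norm_eq_sqrt_inner inner_realify)
      also have "\<dots> = norm (complexify x)"
        using that by (auto simp: norm_vec_def Dv norm_mult intro!: L2_set_cong)
      also have "\<dots> = norm x"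
        using inner_realify[of "complexify x" "complexify x"] by (simp add: norm_eq_sqrt_inner)
      finally show "norm (realify (?D u *v complexify x)) = norm x" .
    qed
    then have "orthogonal_matrix (real_matrix (?D u))"
      unfolding real_matrix_def orthogonal_transformation_matrix by blast
    then show ?thesis using det_orthogonal_matrix by fastforce
  qed
  show ?thesis
  proof (cases "a = 0")
    case True
    then show ?thesis using pos[of 0] by simp
  next
    case False
    have "?D a = ?D (of_real (cmod a)) ** ?D (sgn a)"
      unfolding replace_row_mult
      by (rule arg_cong[of _ _ "replace_row k"]) (auto simp: vec_eq_iff ax sgn_eq)
    then have "?\<rho> (?D a) = ?\<rho> (?D (of_real (cmod a))) * ?\<rho> (?D (sgn a))"
      by (simp add: real_matrix_mult det_mul abs_mult)
    then show ?thesis using pos[of "cmod a"] unit[of "sgn a"] False by (simp add: norm_sgn)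
  qed
qed

lemma det_real_replace_row:
  fixes r :: "complex^'n"
  assumes "r $ k \<noteq> 0"
  shows "\<bar>det (real_matrix (replace_row k r))\<bar> = (cmod (r $ k))\<^sup>2"
proof -
  have "replace_row k r = replace_row k (axis k (r $ k)) ** replace_row k ((1 / r $ k) *s r)"
    unfolding replace_row_mult using assms
    by (intro arg_cong[of _ _ "replace_row k"]) (auto simp: vec_eq_iff axis_def)
  then show ?thesis
    using det_real_shear[of "(1 / r $ k) *s r" k] assms
    by (simp add: real_matrix_mult det_mul abs_mult det_real_scaling)
qed

text \<open>Induction on the set of rows in which the matrix differs from the identity.\<close>

lemma det_real_matrix_invertible:
  fixes A :: "complex^'n^'n"
  assumes "finite K" "\<And>i. i \<notin> K \<Longrightarrow> A $ i = axis i 1" "det A \<noteq> 0"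
  shows "\<bar>det (real_matrix A)\<bar> = (cmod (det A))\<^sup>2"
  using assms
proof (induction K arbitrary: A rule: finite_induct)
  case empty
  then have "A = mat 1" by (simp add: vec_eq_iff mat_def axis_def)
  then show ?case by (simp add: real_matrix_1)
next
  case (insert k K)
  have rows: "A $ i $ l = (if l = i then 1 else 0)" if "i \<notin> insert k K" "\<And>i. i \<notin> insert k K \<Longrightarrow> A $ i = axis i 1"
    for A :: "complex^'n^'n" and i l
    using that by (simp add: axis_def)
  have pivot: "\<bar>det (real_matrix A)\<bar> = (cmod (det A))\<^sup>2"
    if A: "\<And>i. i \<notin> insert k K \<Longrightarrow> A $ i = axis i 1" "det A \<noteq> 0" "A $ k $ k \<noteq> 0" for A
  proof -
    let ?a = "A $ k $ k"
    \<comment> \<open>Chosen so that \<open>replace_row k ?r\<close> inverts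
      \<open>replace_row k (A $ k)\<close>: multiplying by it turns row \<open>k\<close> of
      \<open>A\<close> into a unit row and fixes the rows that already are unit rows.\<close>
    let ?r = "\<chi> l. if l = k then 1 / ?a else - A $ k $ l / ?a"
    let ?B = "A ** replace_row k ?r"
    have AB: "A = ?B ** replace_row k (A $ k)"
      using A(3) by (auto simp: vec_eq_iff matrix_mult_replace_row field_simps)
    have dr: "det (replace_row k ?r) \<noteq> 0" using A(3) by (simp add: det_replace_row)
    have "?B $ i = axis i 1" if "i \<notin> K" for i
    proof (cases "i = k")
      case True
      then show ?thesis using A(3) by (auto simp: vec_eq_iff matrix_mult_replace_row axis_def)
    next
      case False
      then have i: "i \<notin> insert k K" using that by simp
      show ?thesis using False rows[OF i A(1)] by (auto simp: vec_eq_iff matrix_mult_replace_row axis_def)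
    qed
    moreover have "det ?B \<noteq> 0" using A(2) dr by (simp add: det_mul)
    ultimately have "\<bar>det (real_matrix ?B)\<bar> = (cmod (det ?B))\<^sup>2"
      by (rule insert.IH)
    moreover have "\<bar>det (real_matrix A)\<bar> = \<bar>det (real_matrix ?B)\<bar> * \<bar>det (real_matrix (replace_row k (A $ k)))\<bar>"
      by (subst AB) (simp only: real_matrix_mult det_mul abs_mult)
    moreover have "det A = det ?B * ?a"
      by (subst AB) (simp only: det_mul det_replace_row)
    ultimately show ?thesis
      using det_real_replace_row[OF A(3)] by (simp add: norm_mult power_mult_distrib)
  qed
  show ?case
  proof (cases "A $ k $ k = 0")
    case False
    then show ?thesis using pivot insert.prems by blast
  next
    case True
    \<comment> \<open>Otherwise row \<open>k\<close> would be a combination of the unit rows outside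
      \<open>insert k K\<close>, and the determinant would vanish.\<close>
    have "\<exists>j\<in>K. A $ k $ j \<noteq> 0"
    proof (rule ccontr)
      assume neg: "\<not> (\<exists>j\<in>K. A $ k $ j \<noteq> 0)"
      have "A $ k $ j * det (\<chi> i. if i = k then axis j 1 else A $ i) = 0" for j
      proof (cases "j \<in> insert k K")
        case True
        then show ?thesis using neg \<open>A $ k $ k = 0\<close> by auto
      next
        case False
        then have "det (\<chi> i. if i = k then axis j 1 else A $ i) = 0"
          using insert.prems(1)[OF False] by (intro det_identical_rows[of j k]) (auto simp: row_def vec_eq_iff)
        then show ?thesis by simp
      qed
      then have "det (\<chi> i. if i = k then A $ k else A $ i) = 0"
        by (subst det_replace_row_expand) (intro sum.neutral ballI)
      moreover have "(\<chi> i. if i = k then A $ k else A $ i) = A" by (simp add: vec_eq_iff)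
      ultimately show False using insert.prems(2) by simp
    qed
    then obtain j where j: "j \<in> K" "A $ k $ j \<noteq> 0" by blast
    then have jk: "j \<noteq> k" using insert.hyps by auto
    \<comment> \<open>Right multiplication by \<open>replace_row j ?s\<close> adds column
      \<open>j\<close> to column \<open>k\<close>. This makes the pivot nonzero, is a shear, and
      leaves the unit rows outside \<open>insert k K\<close> alone because
      \<open>j \<in> K\<close>.\<close>
    let ?s = "axis j 1 + axis k 1 :: complex^'n"
    let ?A = "A ** replace_row j ?s"
    have sj: "?s $ j = 1" using jk by (simp add: axis_def)
    have "?A $ i = axis i 1" if "i \<notin> insert k K" for i
      using rows[OF that insert.prems(1)] that j jk
      by (auto simp: vec_eq_iff matrix_mult_replace_row axis_def)
    moreover have "det ?A = det A"
      by (simp only: det_mul det_replace_row sj mult_1_right)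
    moreover have "?A $ k $ k \<noteq> 0"
      using True j jk by (simp add: matrix_mult_replace_row axis_def)
    ultimately have "\<bar>det (real_matrix ?A)\<bar> = (cmod (det ?A))\<^sup>2"
      using pivot[of ?A] insert.prems(2) by simp
    moreover have "det (real_matrix ?A) = det (real_matrix A)"
      by (simp only: real_matrix_mult det_mul det_real_shear[OF sj] mult_1_right)
    ultimately show ?thesis using \<open>det ?A = det A\<close> by simp
  qed
qed

text \<open>Elimination settles the invertible case; in the singular case failure of injectivity
  passes to the real matrix.\<close>

lemma det_real_matrix: "\<bar>det (real_matrix A)\<bar> = (cmod (det A))\<^sup>2" for A :: "complex^'n^'n"
proof (cases "det A = 0")
  case False
  then show ?thesis using det_real_matrix_invertible[of UNIV A] by simp
next
  case True
  have "\<not> inj (\<lambda>z. A *v z)"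
    using True det_nz_iff_inj_gen[of "\<lambda>z. A *v z"] by simp
  then obtain x y where "A *v x = A *v y" "x \<noteq> y" unfolding inj_def by blast
  then have "real_matrix A *v realify x = real_matrix A *v realify y" "realify x \<noteq> realify y"
    by (auto simp: real_matrix_works dest: arg_cong[of _ _ complexify])
  then have "\<not> inj (\<lambda>x. real_matrix A *v x)" unfolding inj_def by blast
  then have "det (real_matrix A) = 0"
    using det_nz_iff_inj_gen[of "\<lambda>x. real_matrix A *v x"] by simp
  then show ?thesis using True by simp
qed

subsection \<open>Change of variables for holomorphic maps\<close>

lemma realify_Basis: "realify ` (Basis :: (complex^'n) set) = Basis"
proof -
  have 1: "realify (axis j 1) = axis (inv split_index (j, False)) 1"
    and 2: "realify (axis j \<i>) = axis (inv split_index (j, True)) 1" for j :: 'n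
  proof -
    have "split_index i = (j, b) \<longleftrightarrow> i = inv split_index (j, b)" for i b
      by (metis inv_split_index split_index_inv)
    note eq = this
    have "realify (axis j 1) $ i = axis (inv split_index (j, False)) 1 $ i"
      and "realify (axis j \<i>) $ i = axis (inv split_index (j, True)) 1 $ i" for i
      using eq[of i False] eq[of i True]
      by (cases "split_index i"; auto simp: realify_def axis_def)+
    then show "realify (axis j 1) = axis (inv split_index (j, False)) 1"
      and "realify (axis j \<i>) = axis (inv split_index (j, True)) 1"
      by (simp_all add: vec_eq_iff)
  qed
  show ?thesis
  proof
    show "realify ` (Basis :: (complex^'n) set) \<subseteq> Basis"
      by (auto simp: Basis_vec_def Basis_complex_def 1 2)
    show "Basis \<subseteq> realify ` (Basis :: (complex^'n) set)"
    proof
      fix b :: "real^'n bit0" assume "b \<in> Basis"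
      then obtain i where b: "b = axis i 1" by (auto simp: Basis_vec_def)
      obtain j c where jc: "split_index i = (j, c)" by fastforce
      then have "i = inv split_index (j, c)" using inv_split_index[of i] by simp
      then have "b = realify (axis j (if c then \<i> else 1))"
        using b by (simp add: 1 2)
      moreover have "axis j (if c then \<i> else 1) \<in> (Basis :: (complex^'n) set)"
        by (auto simp: Basis_vec_def Basis_complex_def)
      ultimately show "b \<in> realify ` (Basis :: (complex^'n) set)" by blast
    qed
  qed
qed

lemma inj_realify: "inj realify"
  by (metis complexify_realify injI)

lemma realify_image_eq: "realify ` S = complexify -` S"
  by (auto simp: image_iff) (metis realify_complexify)

lemma borel_measurable_complexify [measurable]: "complexify \<in> borel_measurable borel"
  by (rule borel_measurable_continuous_onI[OF linear_continuous_on[OF linear_complexify[unfolded linear_conv_bounded_linear]]])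

lemma borel_measurable_realify [measurable]: "realify \<in> borel_measurable borel"
  by (rule borel_measurable_continuous_onI[OF linear_continuous_on[OF linear_realify[unfolded linear_conv_bounded_linear]]])

lemma lborel_distr_complexify: "distr lborel borel complexify = (lborel :: (complex^'n) measure)"
proof (rule lborel_eqI[symmetric])
  fix l u :: "complex^'n" assume le: "\<And>b. b \<in> Basis \<Longrightarrow> l \<bullet> b \<le> u \<bullet> b"
  have B: "b \<in> Basis \<longleftrightarrow> (\<exists>c\<in>Basis. b = realify c)" for b :: "real^'n bit0"
    using realify_Basis[where 'n = 'n] by blast
  have box: "complexify -` box l u = box (realify l) (realify u)"
  proof (rule set_eqI)
    fix x
    show "x \<in> complexify -` box l u \<longleftrightarrow> x \<in> box (realify l) (realify u)"
      unfolding mem_box realify_Basis[symmetric] vimage_eq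
      using inner_realify[of "complexify x"] by (simp add: inner_realify)
  qed
  have "emeasure (distr lborel borel complexify) (box l u) = emeasure lborel (box (realify l) (realify u))"
    by (subst emeasure_distr) (auto simp: box)
  also have "\<dots> = (\<Prod>b\<in>Basis. (realify u - realify l) \<bullet> b)"
    by (rule emeasure_lborel_box) (use le in \<open>auto simp: B inner_realify\<close>)
  also have "(\<Prod>b\<in>Basis. (realify u - realify l) \<bullet> b) = (\<Prod>b\<in>Basis. (u - l) \<bullet> b)"
    unfolding realify_Basis[symmetric]
    by (subst prod.reindex) (auto simp: inner_realify inner_diff_left intro: inj_on_subset[OF inj_realify])
  finally show "emeasure (distr lborel borel complexify) (box l u) = (\<Prod>b\<in>Basis. (u - l) \<bullet> b)" .
qed simp

lemma lborel_distr_realify: "distr lborel borel (realify :: complex^'n \<Rightarrow> _) = lborel"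
proof -
  have "distr (distr lborel borel complexify) borel (realify :: complex^'n \<Rightarrow> _) = distr lborel borel (realify \<circ> complexify)"
    by (rule distr_distr) auto
  also have "\<dots> = distr lborel borel (\<lambda>x. x)" by (rule distr_cong) auto
  also have "\<dots> = lborel" by (rule distr_id2) auto
  finally show ?thesis by (simp add: lborel_distr_complexify)
qed

text \<open>A measure-preserving Borel map pulls null sets back to null sets, so it stays measurable
  and measure preserving after completion.\<close>

lemma lebesgue_distr:
  fixes T :: "'a::euclidean_space \<Rightarrow> 'b::euclidean_space"
  assumes [measurable]: "T \<in> borel_measurable borel" and T: "distr lborel borel T = lborel"
  shows "T \<in> lebesgue \<rightarrow>\<^sub>M lebesgue" and "distr lebesgue lebesgue T = lebesgue"
proof -
  have d: "distr lebesgue lborel T = lborel"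
    using T by (simp add: distr_completion cong: distr_cong)
  have eq: "null_sets (distr lebesgue lborel T) = null_sets lborel"
    by (simp only: d)
  have T': "T \<in> lebesgue \<rightarrow>\<^sub>M lborel" by (simp add: measurable_completion)
  show "T \<in> lebesgue \<rightarrow>\<^sub>M lebesgue"
    by (rule completion.measurable_completion2[OF T']) (simp add: eq)
  show "distr lebesgue lebesgue T = lebesgue"
    using completion.completion_distr_eq[OF T' eq] by (simp add: d)
qed

lemmas lebesgue_complexify = lebesgue_distr[OF borel_measurable_complexify lborel_distr_complexify]
lemmas lebesgue_realify = lebesgue_distr[OF borel_measurable_realify lborel_distr_realify]

lemma lebesgue_integrable_complexify_iff:
  fixes F :: "complex^'n \<Rightarrow> 'b::{banach, second_countable_topology}"
  shows "integrable lebesgue (\<lambda>x. F (complexify x)) \<longleftrightarrow> integrable lebesgue F"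
    and "(\<integral>x. F (complexify x) \<partial>lebesgue) = (\<integral>z. F z \<partial>lebesgue)"
proof -
  have meas: "F \<in> borel_measurable lebesgue" if "(\<lambda>x. F (complexify x)) \<in> borel_measurable lebesgue"
    using measurable_comp[OF lebesgue_realify(1) that] by (simp add: o_def)
  show iff: "integrable lebesgue (\<lambda>x. F (complexify x)) \<longleftrightarrow> integrable lebesgue F"
  proof
    assume "integrable lebesgue (\<lambda>x. F (complexify x))"
    then show "integrable lebesgue F"
      using integrable_distr_eq[OF lebesgue_complexify(1) meas] borel_measurable_integrable
      by (simp add: lebesgue_complexify(2))
  next
    assume "integrable lebesgue F"
    then show "integrable lebesgue (\<lambda>x. F (complexify x))"
      using integrable_distr_eq[OF lebesgue_complexify(1), of F] borel_measurable_integrable[of lebesgue F]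
      by (simp add: lebesgue_complexify(2))
  qed
  show "(\<integral>x. F (complexify x) \<partial>lebesgue) = (\<integral>z. F z \<partial>lebesgue)"
  proof (cases "integrable lebesgue F")
    case True
    then show ?thesis
      using integral_distr[OF lebesgue_complexify(1), of F] by (simp add: lebesgue_complexify(2))
  next
    case False
    then show ?thesis using iff by (simp add: not_integrable_integral_eq)
  qed
qed

lemma set_lebesgue_integrable_realify_iff:
  fixes F :: "complex^'n \<Rightarrow> 'b::{banach, second_countable_topology}"
  shows "set_integrable lebesgue (realify ` S) (\<lambda>x. F (complexify x)) \<longleftrightarrow> set_integrable lebesgue S F"
    and "(LINT x:realify ` S|lebesgue. F (complexify x)) = (LINT z:S|lebesgue. F z)"
  using lebesgue_integrable_complexify_iff[of "\<lambda>z. indicator S z *\<^sub>R F z"]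
  unfolding set_integrable_def set_lebesgue_integral_def realify_image_eq
  by (simp_all add: indicator_vimage comp_def)

text \<open>For coding values as real vectors: a linear map with a linear left inverse preserves and
  reflects integrability.\<close>

lemma set_integrable_inverse_linear_iff:
  fixes F :: "'a \<Rightarrow> 'b::euclidean_space" and v :: "'b \<Rightarrow> 'c::euclidean_space"
  assumes v: "linear v" and w: "linear w" "\<And>x. w (v x) = x"
  shows "set_integrable M S (\<lambda>x. v (F x)) \<longleftrightarrow> set_integrable M S F"
proof
  assume "set_integrable M S (\<lambda>x. v (F x))"
  then show "set_integrable M S F"
    unfolding set_integrable_def
    using integrable_bounded_linear[of w M "\<lambda>x. indicator S x *\<^sub>R v (F x)"] w
    by (simp add: linear_conv_bounded_linear linear_cmul)
next
  assume "set_integrable M S F"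
  then show "set_integrable M S (\<lambda>x. v (F x))"
    unfolding set_integrable_def
    using integrable_bounded_linear[of v M "\<lambda>x. indicator S x *\<^sub>R F x"] v
    by (simp add: linear_conv_bounded_linear linear_cmul)
qed

text \<open>The real theorem carried through \<open>realify\<close> on domain and range;
  \<open>det_real_matrix\<close> identifies the real Jacobian.\<close>

lemma change_of_variables_holomorphic:
  fixes h :: "complex^'n \<Rightarrow> complex^'n" and f :: "complex^'n \<Rightarrow> complex"
  assumes h: "holomorphic_map_on h U" and S: "S \<subseteq> U" "S \<in> sets lebesgue" and inj: "inj_on h S"
  shows "set_integrable lebesgue S (\<lambda>z. (cmod (cjacobian h z))\<^sup>2 *\<^sub>R f (h z)) \<longleftrightarrow> set_integrable lebesgue (h ` S) f"
    and "set_integrable lebesgue (h ` S) f \<Longrightarrow>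
      (LINT z:S|lebesgue. (cmod (cjacobian h z))\<^sup>2 *\<^sub>R f (h z)) = (LINT w:h ` S|lebesgue. f w)"
proof -
  \<comment> \<open>The real theorem is stated for values in some \<open>real^'k\<close>, so complex
    values are coded in \<open>real^(1 bit0)\<close>, with \<open>w\<close> as left inverse.\<close>
  define v :: "complex \<Rightarrow> real^(1 bit0)" where "v = (\<lambda>c. realify (\<chi> i. c))"
  define w :: "real^(1 bit0) \<Rightarrow> complex" where "w = (\<lambda>x. complexify x $ 1)"
  have v: "linear v"
    unfolding v_def by (rule linearI) (simp_all add: realify_def vec_eq_iff)
  have w: "linear w"
    unfolding w_def
    by (intro linearI) (simp_all add: linear_add[OF linear_complexify] linear_cmul[OF linear_complexify])
  have wv: "w (v x) = x" for x by (simp add: v_def w_def)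
  have vint: "set_integrable M T (\<lambda>x. v (F x)) \<longleftrightarrow> set_integrable M T F" for M :: "'x measure" and T F
    by (rule set_integrable_inverse_linear_iff[OF v w wv])
  let ?S = "realify ` S" and ?h = "\<lambda>x. realify (h (complexify x))"
  let ?h' = "\<lambda>x y. realify (jac_matrix h (complexify x) *v complexify y)"
  let ?f = "\<lambda>x. v (f (complexify x))"
  have S': "?S \<in> sets lebesgue"
    using measurable_sets[OF lebesgue_complexify(1) S(2)] by (simp add: realify_image_eq)
  have der: "(?h has_derivative ?h' x) (at x within ?S)" if "x \<in> ?S" for x
  proof -
    have x: "complexify x \<in> U" using that S(1) by auto
    have "((\<lambda>x. h (complexify x)) has_derivative (\<lambda>y. jac_matrix h (complexify x) *v complexify y)) (at x)"
      by (rule has_derivative_compose[OF linear_imp_has_derivative[OF linear_complexify] jac_matrix_has_derivative[OF h x]])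
    from has_derivative_compose[OF this linear_imp_has_derivative[OF linear_realify]]
    show ?thesis by (rule has_derivative_at_withinI)
  qed
  have inj': "inj_on ?h ?S"
    using inj by (auto simp: inj_on_def dest: injD[OF inj_realify])
  have img: "?h ` ?S = realify ` h ` S" by (simp add: image_image)
  have D: "\<bar>det (matrix (?h' x))\<bar> = (cmod (cjacobian h (complexify x)))\<^sup>2" if "x \<in> ?S" for x
  proof -
    have x: "complexify x \<in> U" using that S(1) by auto
    show ?thesis
      using det_real_matrix[of "jac_matrix h (complexify x)"]
      by (simp add: real_matrix_def cjacobian_eq_det_jac_matrix[OF h x])
  qed
  let ?J = "\<lambda>z. (cmod (cjacobian h z))\<^sup>2 *\<^sub>R f (h z)"
  have Jv: "\<bar>det (matrix (?h' x))\<bar> *\<^sub>R ?f (?h x) = v (?J (complexify x))" if "x \<in> ?S" for x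
    using D[OF that] by (simp add: linear_cmul[OF v])
  have cong: "set_integrable lebesgue ?S (\<lambda>x. \<bar>det (matrix (?h' x))\<bar> *\<^sub>R ?f (?h x))
      \<longleftrightarrow> set_integrable lebesgue ?S (\<lambda>x. v (?J (complexify x)))"
    by (rule set_integrable_cong) (use Jv in auto)
  have CV: "set_integrable lebesgue ?S (\<lambda>x. \<bar>det (matrix (?h' x))\<bar> *\<^sub>R ?f (?h x)) \<and>
      integral ?S (\<lambda>x. \<bar>det (matrix (?h' x))\<bar> *\<^sub>R ?f (?h x)) = b \<longleftrightarrow>
    set_integrable lebesgue (?h ` ?S) ?f \<and> integral (?h ` ?S) ?f = b" for b
    by (rule has_absolute_integral_change_of_variables[OF S' _ inj']) (rule der)
  have Jint: "set_integrable lebesgue ?S (\<lambda>x. v (?J (complexify x))) \<longleftrightarrow> set_integrable lebesgue S ?J"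
    using set_lebesgue_integrable_realify_iff(1)[of S ?J] by (simp only: vint)
  have fint: "set_integrable lebesgue (?h ` ?S) ?f \<longleftrightarrow> set_integrable lebesgue (h ` S) f"
    by (simp only: img vint set_lebesgue_integrable_realify_iff(1))
  \<comment> \<open>\<open>CV\<close> speaks of integrability together with a given value; inserting
    the value of either side as \<open>b\<close> separates the two.\<close>
  show iff: "set_integrable lebesgue S ?J \<longleftrightarrow> set_integrable lebesgue (h ` S) f"
    using CV[of "integral ?S (\<lambda>x. \<bar>det (matrix (?h' x))\<bar> *\<^sub>R ?f (?h x))"] CV[of "integral (?h ` ?S) ?f"]
    unfolding cong Jint fint by blast
  assume fi: "set_integrable lebesgue (h ` S) f"
  then have 1: "set_integrable lebesgue (?h ` ?S) ?f"
    using fint by blast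
  from fi have 2: "set_integrable lebesgue ?S (\<lambda>x. v (?J (complexify x)))"
    using iff Jint by blast
  have "integral ?S (\<lambda>x. \<bar>det (matrix (?h' x))\<bar> *\<^sub>R ?f (?h x)) = integral (?h ` ?S) ?f"
    using CV 1 by blast
  moreover have "integral ?S (\<lambda>x. \<bar>det (matrix (?h' x))\<bar> *\<^sub>R ?f (?h x)) = integral ?S (\<lambda>x. v (?J (complexify x)))"
    by (rule integral_cong) (rule Jv)
  ultimately have "(LINT x:?S|lebesgue. v (?J (complexify x))) = (LINT x:?h ` ?S|lebesgue. ?f x)"
    using set_lebesgue_integral_eq_integral(2)[OF 1] set_lebesgue_integral_eq_integral(2)[OF 2] by simp
  then have "(LINT z:S|lebesgue. v (?J z)) = (LINT x:h ` S|lebesgue. v (f x))"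
    unfolding img set_lebesgue_integrable_realify_iff(2)[where F = "\<lambda>z. v (?J z)"]
      set_lebesgue_integrable_realify_iff(2)[where F = "\<lambda>z. v (f z)"] .
  then have "w (LINT z:S|lebesgue. v (?J z)) = w (LINT x:h ` S|lebesgue. v (f x))" by simp
  moreover have "w (LINT z:T|lebesgue. v (F z)) = (LINT z:T|lebesgue. F z)"
    if "set_integrable lebesgue T F" for T and F :: "complex^'n \<Rightarrow> complex"
  proof -
    have bw: "bounded_linear w" and bv: "bounded_linear v"
      using v w by (simp_all add: linear_conv_bounded_linear)
    have "(\<integral>z. indicator T z *\<^sub>R v (F z) \<partial>lebesgue) = v (\<integral>z. indicator T z *\<^sub>R F z \<partial>lebesgue)"
      using integral_bounded_linear[OF bv that[unfolded set_integrable_def]] by (simp add: linear_cmul[OF v])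
    then show ?thesis by (simp add: set_lebesgue_integral_def wv)
  qed
  ultimately show "(LINT z:S|lebesgue. ?J z) = (LINT w:h ` S|lebesgue. f w)"
    using fi iff by simp
qed

text \<open>Sard's theorem in equal dimensions: where the complex determinant vanishes so does the
  real one, and the real rank drops.\<close>

lemma negligible_image_crit:
  fixes h :: "complex^'n \<Rightarrow> complex^'n"
  assumes h: "holomorphic_map_on h D"
  shows "negligible (h ` crit D h)"
proof -
  let ?h = "\<lambda>x. realify (h (complexify x))" and ?S = "realify ` crit D h"
  let ?h' = "\<lambda>x y. realify (jac_matrix h (complexify x) *v complexify y)"
  have "negligible (?h ` ?S)"
  proof (rule baby_Sard)
    fix x assume "x \<in> ?S"
    then have x: "complexify x \<in> D" "cjacobian h (complexify x) = 0" by (auto simp: crit_def)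
    have "((\<lambda>x. h (complexify x)) has_derivative (\<lambda>y. jac_matrix h (complexify x) *v complexify y)) (at x)"
      by (rule has_derivative_compose[OF linear_imp_has_derivative[OF linear_complexify] jac_matrix_has_derivative[OF h x(1)]])
    from has_derivative_compose[OF this linear_imp_has_derivative[OF linear_realify]]
    show "(?h has_derivative ?h' x) (at x within ?S)" by (rule has_derivative_at_withinI)
    have "det (matrix (?h' x)) = 0"
      using det_real_matrix[of "jac_matrix h (complexify x)"] x
      by (simp add: real_matrix_def cjacobian_eq_det_jac_matrix[OF h])
    then show "rank (matrix (?h' x)) < CARD('n bit0)"
      using det_eq_0_rank by blast
  qed simp
  then have "realify ` h ` crit D h \<in> null_sets lebesgue"
    by (simp add: negligible_iff_null_sets image_image)
  then have "realify ` h ` crit D h \<in> null_sets (distr lebesgue lebesgue (realify :: complex^'n \<Rightarrow> _))"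
    by (simp add: lebesgue_realify(2))
  then have "realify -` (realify ` h ` crit D h) \<in> null_sets lebesgue"
    using null_sets_distr_iff[OF lebesgue_realify(1)] by auto
  then show ?thesis
    by (simp add: negligible_iff_null_sets inj_vimage_image_eq[OF inj_realify])
qed

subsection \<open>Local inverses\<close>

lemma bounded_linear_matrix_vector: "bounded_linear (\<lambda>v. A *v v)" for A :: "complex^'n^'m"
proof -
  have "linear (\<lambda>z. A *v z)"
    by (rule linearI) (simp_all add: matrix_vector_right_distrib scaleR_eq_vector_smult vector_scalar_commute)
  then show ?thesis by (simp add: linear_conv_bounded_linear)
qed

lemma holomorphic_map_onI:
  assumes "\<And>z. z \<in> S \<Longrightarrow> (F has_derivative (\<lambda>v. A z *v v)) (at z)"
  shows "holomorphic_map_on F S"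
  unfolding holomorphic_map_on_def
  using assms matrix_vector_mul_linear_gen by blast

text \<open>The inverse function theorem applies because the derivative varies continuously; the
  derivative of the inverse is multiplication by an inverse complex matrix, hence complex
  linear.\<close>

lemma holomorphic_local_inverse:
  fixes h :: "complex^'n \<Rightarrow> complex^'n"
  assumes S: "open S" and h: "holomorphic_map_on h S" and z0: "z0 \<in> S" "cjacobian h z0 \<noteq> 0"
  obtains U V \<rho> where "open U" "U \<subseteq> S" "z0 \<in> U" "open V" "homeomorphism U V h \<rho>"
    "holomorphic_map_on \<rho> V" "\<And>z. z \<in> U \<Longrightarrow> cjacobian h z \<noteq> 0"
proof -
  define h' where "h' = (\<lambda>z. Blinfun (\<lambda>v. jac_matrix h z *v v))"
  have h': "blinfun_apply (h' z) = (\<lambda>v. jac_matrix h z *v v)" for z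
    unfolding h'_def by (rule bounded_linear_Blinfun_apply[OF bounded_linear_matrix_vector])
  have cont: "continuous_on S h'"
  proof (rule continuous_on_blinfun_componentwise)
    fix b :: "complex^'n"
    show "continuous_on S (\<lambda>z. blinfun_apply (h' z) b)"
      unfolding h' by (rule continuous_on_matrix_vector_mult)
        (rule holomorphic_fun_on_imp_continuous_on[OF holomorphic_jac_matrix[OF h S]])
  qed
  have "invertible (jac_matrix h z0)"
    using z0 by (simp add: invertible_det_nz cjacobian_eq_det_jac_matrix[OF h])
  then obtain B where B: "B ** jac_matrix h z0 = mat 1"
    unfolding invertible_def by blast
  have invf: "Blinfun (\<lambda>v. B *v v) o\<^sub>L h' z0 = id_blinfun"
    by (rule blinfun_eqI)
       (simp add: h' bounded_linear_Blinfun_apply[OF bounded_linear_matrix_vector] matrix_vector_mul_assoc B)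
  have der: "(h has_derivative blinfun_apply (h' z)) (at z)" if "z \<in> S" for z
    unfolding h' by (rule jac_matrix_has_derivative[OF h that])
  obtain U V \<rho> \<rho>' where UV: "open U" "U \<subseteq> S" "z0 \<in> U" "open V" "h z0 \<in> V" "homeomorphism U V h \<rho>"
    and \<rho>': "\<And>y. y \<in> V \<Longrightarrow> (\<rho> has_derivative (\<rho>' y)) (at y)"
      "\<And>y. y \<in> V \<Longrightarrow> \<rho>' y = inv (blinfun_apply (h' (\<rho> y)))"
      "\<And>y. y \<in> V \<Longrightarrow> bij (blinfun_apply (h' (\<rho> y)))"
    by (rule inverse_function_theorem[OF S der cont z0(1) invf]) (assumption | rule that)+
  have inv: "invertible (jac_matrix h (\<rho> y))" if "y \<in> V" for y
    using \<rho>'(3)[OF that] det_nz_iff_inj_gen[of "\<lambda>v. jac_matrix h (\<rho> y) *v v"]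
    by (simp add: h' bij_def invertible_det_nz)
  have "holomorphic_map_on \<rho> V"
  proof (rule holomorphic_map_onI)
    fix y assume y: "y \<in> V"
    obtain C where C: "jac_matrix h (\<rho> y) ** C = mat 1" "C ** jac_matrix h (\<rho> y) = mat 1"
      using inv[OF y] unfolding invertible_def by blast
    have "inv (\<lambda>v. jac_matrix h (\<rho> y) *v v) = (\<lambda>v. C *v v)"
      by (rule inv_unique_comp) (simp_all add: fun_eq_iff matrix_vector_mul_assoc C)
    moreover have "matrix (\<rho>' y) = C" if "\<rho>' y = (\<lambda>v. C *v v)"
      by (simp add: that)
    ultimately show "(\<rho> has_derivative (\<lambda>v. matrix (\<rho>' y) *v v)) (at y)"
      using \<rho>'(1,2)[OF y] by (simp add: h')
  qed
  moreover have "cjacobian h z \<noteq> 0" if "z \<in> U" for z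
  proof -
    have "h z \<in> V" "\<rho> (h z) = z" using UV(6) that by (auto simp: homeomorphism_def)
    then show ?thesis
      using inv[of "h z"] UV(2) that by (auto simp: invertible_det_nz cjacobian_eq_det_jac_matrix[OF h])
  qed
  ultimately show thesis using that[OF UV(1-4,6)] by blast
qed

lemma open_holomorphic_image:
  fixes h :: "complex^'n \<Rightarrow> complex^'n"
  assumes S: "open S" and h: "holomorphic_map_on h S" and nz: "\<And>z. z \<in> S \<Longrightarrow> cjacobian h z \<noteq> 0"
  shows "open (h ` S)"
proof (subst open_subopen, rule ballI)
  fix w assume "w \<in> h ` S"
  then obtain z where z: "z \<in> S" "w = h z" by blast
  obtain U V \<rho> where UV: "U \<subseteq> S" "z \<in> U" "open V" "homeomorphism U V h \<rho>"
    using holomorphic_local_inverse[OF S h z(1) nz[OF z(1)]] by metis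
  have "h ` U = V" using UV(4) by (rule homeomorphism_image1)
  then show "\<exists>T. open T \<and> w \<in> T \<and> T \<subseteq> h ` S" using UV z by (intro exI[of _ V]) auto
qed

lemma cjacobian_right_inverse:
  assumes U: "open U" "w \<in> U" and \<rho>: "holomorphic_map_on \<rho> U" and inv: "\<And>w. w \<in> U \<Longrightarrow> h (\<rho> w) = w"
    and h: "holomorphic_map_on h S" "\<rho> w \<in> S"
  shows "cjacobian h (\<rho> w) * cjacobian \<rho> w = 1"
proof -
  have "((h \<circ> \<rho>) has_derivative (\<lambda>v. mat 1 *v v)) (at w)"
    by (rule has_derivative_transform_within_open[of "\<lambda>w. w" _ _ UNIV U]) (use U inv in auto)
  from cjacobian_eq[OF this] have "cjacobian (h \<circ> \<rho>) w = 1" by simp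
  then show ?thesis using cjacobian_compose[OF \<rho> U(2) h] by simp
qed

section \<open>Regular values and local inverses of a proper holomorphic map\<close>

locale proper_hol =
  fixes D G :: "(complex^'n) set" and p :: "complex^'n \<Rightarrow> complex^'n" and m :: nat
  assumes D: "cdomain D" and G: "cdomain G" and proper: "proper_holomorphic D G p"
    and mult: "has_multiplicity D G p m"
begin

lemma open_D: "open D" and open_G: "open G"
  using D G by (auto simp: cdomain_def)

lemma p_holo: "holomorphic_map_on p D" and p_in: "\<And>z. z \<in> D \<Longrightarrow> p z \<in> G"
  using proper by (auto simp: proper_holomorphic_def)

lemma compact_preimage:
  assumes "compact K" "K \<subseteq> G"
  shows "compact {z\<in>D. p z \<in> K}"
proof -
  have "compactin (top_of_set D) {z \<in> topspace (top_of_set D). p z \<in> K}"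
    using proper assms by (intro compactin_proper_map_preimage[of _ "top_of_set G"])
      (auto simp: proper_holomorphic_def compactin_subtopology)
  then show ?thesis by (simp add: compactin_subtopology)
qed

definition "regular = G - p ` crit D p"

text \<open>In general larger than the part of \<open>D\<close> over \<open>regular\<close>, since a
  noncritical point may share its fibre with a critical one; the surplus lies over the critical
  values, a null set.\<close>

definition "noncrit = D - crit D p"

lemma closedin_crit: "closedin (top_of_set D) (crit D p)"
proof -
  have "continuous_on D (cjacobian p)"
    by (rule holomorphic_fun_on_imp_continuous_on[OF holomorphic_cjacobian[OF p_holo open_D]])
  from continuous_closedin_preimage[OF this, of "{0}"] show ?thesis
    by (simp add: crit_def vimage_def Int_def)
qed

text \<open>Proper maps are closed, so the critical values form a relatively closed subset of
  \<open>G\<close>.\<close>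

lemma open_regular: "open regular"
proof -
  have "closed_map (top_of_set D) (top_of_set G) p"
    using proper by (simp add: proper_holomorphic_def proper_map_def)
  then have "closedin (top_of_set G) (p ` crit D p)"
    using closedin_crit by (simp add: closed_map_def)
  then have "openin (top_of_set G) regular"
    by (simp add: regular_def openin_diff)
  then show ?thesis using open_G openin_open_trans by blast
qed

lemma open_noncrit: "open noncrit"
proof -
  have "openin (top_of_set D) noncrit"
    using closedin_crit by (simp add: noncrit_def openin_diff)
  then show ?thesis using open_D openin_open_trans by blast
qed

lemma noncrit_iff: "z \<in> noncrit \<longleftrightarrow> z \<in> D \<and> cjacobian p z \<noteq> 0"
  by (auto simp: noncrit_def crit_def)

lemma null_complement_regular: "p ` crit D p \<in> null_sets lebesgue"
  using negligible_image_crit[OF p_holo] by (simp add: negligible_iff_null_sets)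

lemma regular_fibre:
  assumes "w \<in> regular"
  shows "finite {z\<in>D. p z = w}" "card {z\<in>D. p z = w} = m" "\<And>z. z \<in> D \<Longrightarrow> p z = w \<Longrightarrow> z \<in> noncrit"
  using mult assms by (auto simp: has_multiplicity_def regular_def noncrit_def)

text \<open>Inverse branches through the \<open>m\<close> preimages are confined to disjoint balls,
  so their values stay distinct; being \<open>m\<close> in number they exhaust the fibre, which has
  \<open>m\<close> points over every regular value.\<close>

lemma local_inverses_exist:
  assumes w: "w \<in> regular"
  shows "\<exists>U \<rho>. w \<in> U \<and> local_inverses D G p m U \<rho>"
proof -
  let ?F = "\<lambda>w. {z\<in>D. p z = w}"
  obtain e where e: "bij_betw e {1..m} (?F w)"
    using ex_bij_betw_nat_finite_1[OF regular_fibre(1)[OF w]] regular_fibre(2)[OF w] by auto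
  have ek: "e k \<in> noncrit" "p (e k) = w" if "k \<in> {1..m}" for k
    using e regular_fibre(3)[OF w] that by (auto dest!: bij_betwE)
  have "\<forall>k\<in>{1..m}. \<exists>V \<rho>. open V \<and> w \<in> V \<and> holomorphic_map_on \<rho> V \<and> \<rho> w = e k \<and>
      (\<forall>w\<in>V. \<rho> w \<in> D \<and> p (\<rho> w) = w)"
  proof
    fix k assume k: "k \<in> {1..m}"
    then have z: "e k \<in> D" "cjacobian p (e k) \<noteq> 0" using ek noncrit_iff by auto
    obtain U V \<rho> where UV: "open U" "U \<subseteq> D" "e k \<in> U" "open V" "homeomorphism U V p \<rho>" "holomorphic_map_on \<rho> V"
      using holomorphic_local_inverse[OF open_D p_holo z] by metis
    have "w \<in> V" "\<rho> w = e k" "\<forall>w\<in>V. \<rho> w \<in> D \<and> p (\<rho> w) = w"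
      using UV(2,3,5) ek(2)[OF k] unfolding homeomorphism_def by blast+
    then show "\<exists>V \<rho>. open V \<and> w \<in> V \<and> holomorphic_map_on \<rho> V \<and> \<rho> w = e k \<and>
      (\<forall>w\<in>V. \<rho> w \<in> D \<and> p (\<rho> w) = w)"
      using UV by blast
  qed
  then obtain V \<rho> where V: "\<And>k. k \<in> {1..m} \<Longrightarrow> open (V k)" "\<And>k. k \<in> {1..m} \<Longrightarrow> w \<in> V k"
    and \<rho>: "\<And>k. k \<in> {1..m} \<Longrightarrow> holomorphic_map_on (\<rho> k) (V k)" "\<And>k. k \<in> {1..m} \<Longrightarrow> \<rho> k w = e k"
      "\<And>k w. k \<in> {1..m} \<Longrightarrow> w \<in> V k \<Longrightarrow> \<rho> k w \<in> D \<and> p (\<rho> k w) = w"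
    by metis
  have "\<exists>r>0. \<forall>k\<in>{1..m}. \<forall>j\<in>{1..m}. k \<noteq> j \<longrightarrow> 2 * r \<le> dist (e k) (e j)"
  proof -
    \<comment> \<open>The extra element 1 keeps the minimum defined when there are no two distinct
      indices.\<close>
    let ?P = "insert 1 ((\<lambda>(k, j). dist (e k) (e j) / 2) ` {(k, j). k \<in> {1..m} \<and> j \<in> {1..m} \<and> k \<noteq> j})"
    have "finite {(k, j). k \<in> {1..m} \<and> j \<in> {1..m} \<and> k \<noteq> j}"
      by (rule finite_subset[of _ "{1..m} \<times> {1..m}"]) auto
    then have fin: "finite ?P" by simp
    have "Min ?P \<in> ?P" by (rule Min_in[OF fin]) simp
    moreover have "e k \<noteq> e j" if "k \<in> {1..m}" "j \<in> {1..m}" "k \<noteq> j" for k j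
      using inj_onD[OF bij_betw_imp_inj_on[OF e]] that by blast
    then have "x > 0" if "x \<in> ?P" for x
      using that by auto
    ultimately have "Min ?P > 0" by blast
    moreover have "2 * Min ?P \<le> dist (e k) (e j)" if "k \<in> {1..m}" "j \<in> {1..m}" "k \<noteq> j" for k j
    proof -
      have "Min ?P \<le> dist (e k) (e j) / 2"
        by (rule Min_le[OF fin]) (use that in force)
      then show ?thesis by simp
    qed
    ultimately show ?thesis by blast
  qed
  then obtain r where r: "r > 0" "\<And>k j. k \<in> {1..m} \<Longrightarrow> j \<in> {1..m} \<Longrightarrow> k \<noteq> j \<Longrightarrow> 2 * r \<le> dist (e k) (e j)"
    by blast
  define U where "U = regular \<inter> (\<Inter>k\<in>{1..m}. V k \<inter> \<rho> k -` ball (e k) r)"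
  have "open U"
    unfolding U_def
  proof (rule open_Int[OF open_regular], rule open_INT)
    show "\<forall>k\<in>{1..m}. open (V k \<inter> \<rho> k -` ball (e k) r)"
    proof
    fix k assume k: "k \<in> {1..m}"
    show "open (V k \<inter> \<rho> k -` ball (e k) r)"
      by (rule continuous_open_preimage[OF holomorphic_map_on_imp_continuous_on[OF \<rho>(1)[OF k]] V(1)[OF k] open_ball])
    qed
  qed simp
  moreover have "w \<in> U" using w V(2) \<rho>(2) r(1) by (simp add: U_def)
  moreover have "U \<subseteq> G - p ` crit D p" by (auto simp: U_def regular_def)
  moreover have "holomorphic_map_on (\<rho> k) U \<and> (\<forall>w\<in>U. p (\<rho> k w) = w)" if k: "k \<in> {1..m}" for k
  proof -
    have "U \<subseteq> V k" using k by (auto simp: U_def)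
    then show ?thesis using \<rho>(3)[OF k] holomorphic_map_on_subset[OF \<rho>(1)[OF k]] by blast
  qed
  moreover have "bij_betw (\<lambda>k. \<rho> k w') {1..m} (?F w')" if w': "w' \<in> U" for w'
  proof -
    have "inj_on (\<lambda>k. \<rho> k w') {1..m}"
    proof (rule inj_onI, rule ccontr)
      fix k j assume kj: "k \<in> {1..m}" "j \<in> {1..m}" "\<rho> k w' = \<rho> j w'" "k \<noteq> j"
      have "\<rho> k w' \<in> ball (e k) r" "\<rho> j w' \<in> ball (e j) r"
        using w' kj(1,2) by (auto simp: U_def)
      then have "dist (e k) (e j) < 2 * r"
        using dist_triangle[of "e k" "e j" "\<rho> k w'"] kj(3) by (simp add: dist_commute)
      then show False using r(2)[OF kj(1,2,4)] by simp
    qed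
    moreover have sub: "(\<lambda>k. \<rho> k w') ` {1..m} \<subseteq> ?F w'"
      using \<rho>(3) w' by (auto simp: U_def)
    moreover have "w' \<in> regular" using w' by (simp add: U_def)
    then have "finite (?F w')" "card (?F w') = m" by (rule regular_fibre)+
    moreover have "card ((\<lambda>k. \<rho> k w') ` {1..m}) = m"
      using calculation(1) by (simp add: card_image)
    ultimately show ?thesis
      unfolding bij_betw_def using card_subset_eq by metis
  qed
  ultimately have "local_inverses D G p m U \<rho>"
    by (simp add: local_inverses_def)
  with \<open>w \<in> U\<close> show ?thesis by blast
qed

end

subsection \<open>Change of variables along a proper holomorphic map\<close>

lemma set_integrable_complex_of_real:
  assumes "set_integrable M S f"
  shows "set_integrable M S (\<lambda>x. complex_of_real (f x))"
proof -
  have "integrable M (\<lambda>x. complex_of_real (indicator S x *\<^sub>R f x))"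
    using assms unfolding set_integrable_def by (rule integrable_of_real)
  then show ?thesis by (simp add: set_integrable_def scaleR_conv_of_real)
qed

context proper_hol
begin

text \<open>The inverse function theorem gives open sets of injectivity; Lindelof leaves countably
  many of them, and removing the earlier ones makes them disjoint.\<close>

lemma noncrit_cover:
  obtains S :: "nat \<Rightarrow> (complex^'n) set" where
    "\<And>i. S i \<in> sets lebesgue" "\<And>i. p ` S i \<in> sets lebesgue" "\<And>i. inj_on p (S i)"
    "disjoint_family S" "(\<Union>i. S i) = noncrit"
proof -
  define \<F> where "\<F> = {U. open U \<and> U \<subseteq> noncrit \<and> inj_on p U}"
  have "\<Union>\<F> = noncrit"
  proof
    show "noncrit \<subseteq> \<Union>\<F>"
    proof
      fix z assume z: "z \<in> noncrit"
      then have "cjacobian p z \<noteq> 0" by (simp add: noncrit_iff)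
      moreover have "holomorphic_map_on p noncrit"
        using p_holo by (rule holomorphic_map_on_subset) (auto simp: noncrit_def)
      ultimately obtain U V \<rho> where U: "open U" "U \<subseteq> noncrit" "z \<in> U" "homeomorphism U V p \<rho>"
        using holomorphic_local_inverse[OF open_noncrit _ z] by metis
      have "inj_on p U"
        using U(4) by (metis homeomorphism_apply1 inj_on_inverseI)
      then show "z \<in> \<Union>\<F>" using U by (auto simp: \<F>_def)
    qed
  qed (auto simp: \<F>_def)
  moreover have "open U" if "U \<in> insert {} \<F>" for U using that by (auto simp: \<F>_def)
  moreover obtain \<F>' where "\<F>' \<subseteq> insert {} \<F>" "countable \<F>'" "\<Union>\<F>' = \<Union>(insert {} \<F>)"
    using Lindelof[OF calculation(2)] by metis
  ultimately have F': "\<F>' \<subseteq> insert {} \<F>" "countable \<F>'" "\<Union>\<F>' = noncrit" by simp_all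
  \<comment> \<open>The empty set is added so that the enumerated family is nonempty.\<close>
  define U where "U = from_nat_into (insert {} \<F>')"
  have range: "range U = insert {} \<F>'"
    unfolding U_def using F'(2) by (intro range_from_nat_into) auto
  have U: "open (U i)" "U i \<subseteq> noncrit" "inj_on p (U i)" for i
  proof -
    have "U i \<in> insert {} \<F>" using range F'(1) by blast
    then show "open (U i)" "U i \<subseteq> noncrit" "inj_on p (U i)" by (auto simp: \<F>_def)
  qed
  let ?S = "disjointed U"
  have img_open: "open (p ` W)" if "open W" "W \<subseteq> noncrit" for W
  proof (rule open_holomorphic_image[OF that(1)])
    show "holomorphic_map_on p W"
      using p_holo by (rule holomorphic_map_on_subset) (use that in \<open>auto simp: noncrit_def\<close>)
  qed (use that noncrit_iff in auto)
  show thesis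
  proof (rule that[of ?S])
    fix i
    have O: "open (\<Union>j\<in>{0..<i}. U j)" using U by auto
    show "?S i \<in> sets lebesgue"
      unfolding disjointed_def using U(1)[of i] O by (intro sets.Diff) auto
    show "inj_on p (?S i)"
      using U(3)[of i] by (rule inj_on_subset) (auto simp: disjointed_def)
    \<comment> \<open>By injectivity the image of the difference is a difference of images, both
      open, hence measurable.\<close>
    have "p ` ?S i = p ` U i - p ` (U i \<inter> (\<Union>j\<in>{0..<i}. U j))"
      unfolding disjointed_def using U(3)[of i] by (auto simp: inj_on_def)
    moreover have "open (p ` U i)" "open (p ` (U i \<inter> (\<Union>j\<in>{0..<i}. U j)))"
      using U(1,2)[of i] O by (auto intro!: img_open)
    ultimately show "p ` ?S i \<in> sets lebesgue" by (simp add: sets.Diff)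
  next
    show "disjoint_family ?S" by (rule disjoint_family_disjointed)
    show "(\<Union>i. ?S i) = noncrit"
      unfolding UN_disjointed_eq using range F'(3) by auto
  qed
qed

lemma regular_lebesgue [measurable]: "regular \<in> sets lebesgue"
  using open_regular by auto

lemma noncrit_lebesgue [measurable]: "noncrit \<in> sets lebesgue"
  using open_noncrit by auto

lemma AE_regular: "AE w in lebesgue. w \<in> G \<longrightarrow> w \<in> regular"
  by (rule AE_I'[OF null_complement_regular]) (auto simp: regular_def)

text \<open>Over a regular value each fibre point lies in exactly one piece, and each piece contains
  at most one of them. The pieces hit by the fibre thus correspond to its \<open>m\<close> points,
  and the series is a finite sum.\<close>

lemma fibre_sum_cover:
  fixes s :: "complex^'n \<Rightarrow> complex"
  assumes inj: "\<And>i::nat. inj_on p (S i)" and disj: "disjoint_family S" and un: "(\<Union>i. S i) = noncrit"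
    and w: "w \<in> regular"
  defines "t \<equiv> \<lambda>i. indicator (p ` S i) w *\<^sub>R s (inv_into (S i) p w)"
  shows "finite {i. w \<in> p ` S i}" "card {i. w \<in> p ` S i} = m" "summable (\<lambda>i. norm (t i))"
    "(\<Sum>i. t i) = (\<Sum>z | z \<in> D \<and> p z = w. s z)"
proof -
  let ?I = "{i. w \<in> p ` S i}" and ?F = "{z \<in> D. p z = w}"
  have SD: "S i \<subseteq> D" for i using un by (auto simp: noncrit_def)
  have bij: "bij_betw (\<lambda>i. inv_into (S i) p w) ?I ?F"
  proof (rule bij_betwI')
    fix i j assume ij: "i \<in> ?I" "j \<in> ?I"
    show "(inv_into (S i) p w = inv_into (S j) p w) = (i = j)"
    proof
      assume "inv_into (S i) p w = inv_into (S j) p w"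
      then have "inv_into (S i) p w \<in> S i \<inter> S j"
        using ij inv_into_into[of w p "S i"] inv_into_into[of w p "S j"] by simp
      then show "i = j" using disj by (auto simp: disjoint_family_on_def)
    qed simp
  next
    fix i assume i: "i \<in> ?I"
    then show "inv_into (S i) p w \<in> ?F"
      using inv_into_into[of w p "S i"] f_inv_into_f[of w p "S i"] SD[of i] by auto
  next
    fix z assume z: "z \<in> ?F"
    then have "z \<in> noncrit" using regular_fibre(3)[OF w] by blast
    then obtain i where i: "z \<in> S i" using un by blast
    have "p z = w" using z by simp
    then show "\<exists>i\<in>?I. z = inv_into (S i) p w"
      using i inv_into_f_f[OF inj i] by (intro bexI[of _ i]) auto
  qed
  show fin: "finite ?I"
    using bij_betw_finite[OF bij] regular_fibre(1)[OF w] by simp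
  show "card ?I = m"
    using bij_betw_same_card[OF bij] regular_fibre(2)[OF w] by simp
  have zero: "t i = 0" if "i \<notin> ?I" for i using that by (simp add: t_def)
  show "summable (\<lambda>i. norm (t i))"
    by (rule summable_finite[OF fin]) (simp add: zero)
  have "(\<Sum>i. t i) = (\<Sum>i\<in>?I. t i)"
    by (rule suminf_finite[OF fin zero])
  also have "\<dots> = (\<Sum>i\<in>?I. s (inv_into (S i) p w))"
    by (rule sum.cong) (auto simp: t_def)
  also have "\<dots> = (\<Sum>z\<in>?F. s z)"
    by (rule sum.reindex_bij_betw[OF bij])
  finally show "(\<Sum>i. t i) = (\<Sum>z | z \<in> D \<and> p z = w. s z)" .
qed

lemma change_of_variables_cover:
  fixes s :: "complex^'n \<Rightarrow> complex"
  assumes S: "S \<subseteq> noncrit" "S \<in> sets lebesgue" and inj: "inj_on p S"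
    and int: "set_integrable lebesgue S (\<lambda>z. (cmod (cjacobian p z))\<^sup>2 *\<^sub>R s z)"
  shows "set_integrable lebesgue (p ` S) (\<lambda>w. s (inv_into S p w))"
    "(LINT w:p ` S|lebesgue. s (inv_into S p w)) = (LINT z:S|lebesgue. (cmod (cjacobian p z))\<^sup>2 *\<^sub>R s z)"
proof -
  have SD: "S \<subseteq> D" using S(1) by (auto simp: noncrit_def)
  note CV = change_of_variables_holomorphic[OF p_holo SD S(2) inj, of "\<lambda>w. s (inv_into S p w)"]
  have eq: "(cmod (cjacobian p z))\<^sup>2 *\<^sub>R s (inv_into S p (p z)) = (cmod (cjacobian p z))\<^sup>2 *\<^sub>R s z" if "z \<in> S" for z
    using inv_into_f_f[OF inj that] by simp
  have c1: "set_integrable lebesgue S (\<lambda>z. (cmod (cjacobian p z))\<^sup>2 *\<^sub>R s (inv_into S p (p z))) \<longleftrightarrow>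
      set_integrable lebesgue S (\<lambda>z. (cmod (cjacobian p z))\<^sup>2 *\<^sub>R s z)"
    by (rule set_integrable_cong) (use eq in auto)
  have c2: "(LINT z:S|lebesgue. (cmod (cjacobian p z))\<^sup>2 *\<^sub>R s (inv_into S p (p z)))
      = (LINT z:S|lebesgue. (cmod (cjacobian p z))\<^sup>2 *\<^sub>R s z)"
    by (rule set_lebesgue_integral_cong[OF S(2)]) (use eq in auto)
  show 1: "set_integrable lebesgue (p ` S) (\<lambda>w. s (inv_into S p w))"
    using CV(1) c1 int by blast
  show "(LINT w:p ` S|lebesgue. s (inv_into S p w)) = (LINT z:S|lebesgue. (cmod (cjacobian p z))\<^sup>2 *\<^sub>R s z)"
    using CV(2)[OF 1] c2 by simp
qed

text \<open>Change of variables on each injectivity piece, summed over the pieces. The partial sums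
  of the L^1 norms are bounded by an integral over \<open>noncrit\<close>, which justifies
  exchanging sum and integral.\<close>

lemma fibre_integral:
  fixes s :: "complex^'n \<Rightarrow> complex"
  assumes int: "set_integrable lebesgue noncrit (\<lambda>z. (cmod (cjacobian p z))\<^sup>2 *\<^sub>R s z)"
  shows "set_integrable lebesgue regular (\<lambda>w. \<Sum>z | z \<in> D \<and> p z = w. s z)"
    and "(LINT w:regular|lebesgue. \<Sum>z | z \<in> D \<and> p z = w. s z)
      = (LINT z:noncrit|lebesgue. (cmod (cjacobian p z))\<^sup>2 *\<^sub>R s z)"
proof -
  obtain S :: "nat \<Rightarrow> (complex^'n) set" where S: "\<And>i. S i \<in> sets lebesgue" "\<And>i. p ` S i \<in> sets lebesgue"
      "\<And>i. inj_on p (S i)" "disjoint_family S" "(\<Union>i. S i) = noncrit"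
    using noncrit_cover by blast
  let ?J = "\<lambda>z. (cmod (cjacobian p z))\<^sup>2"
  define t where "t = (\<lambda>i w. indicator (p ` S i) w *\<^sub>R s (inv_into (S i) p w))"
  have Sn: "S i \<subseteq> noncrit" for i using S(5) by blast
  have intS: "set_integrable lebesgue (S i) (\<lambda>z. ?J z *\<^sub>R s z)" for i
    using int S(1) Sn by (rule set_integrable_subset)
  \<comment> \<open>The same change of variables for the modulus of \<open>s\<close>, taken as a
    complex function, computes the L^1 norms of the terms.\<close>
  have intSn: "set_integrable lebesgue (S i) (\<lambda>z. ?J z *\<^sub>R complex_of_real (cmod (s z)))" for i
  proof -
    have "set_integrable lebesgue (S i) (\<lambda>z. complex_of_real (norm (?J z *\<^sub>R s z)))"
      by (rule set_integrable_complex_of_real[OF set_integrable_norm[OF intS]])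
    then show ?thesis by (simp add: scaleR_conv_of_real norm_mult norm_power)
  qed
  note CV = change_of_variables_cover[OF Sn S(1,3) intS]
  note CVn = change_of_variables_cover[OF Sn S(1,3) intSn]
  have t_int: "integrable lebesgue (t i)" for i
    using CV(1)[of i] by (simp add: t_def set_integrable_def)
  have t_eq: "(\<integral>w. t i w \<partial>lebesgue) = (LINT z:S i|lebesgue. ?J z *\<^sub>R s z)" for i
    using CV(2)[of i] by (simp add: t_def set_lebesgue_integral_def)
  have t_norm: "(\<integral>w. norm (t i w) \<partial>lebesgue) = (LINT z:S i|lebesgue. ?J z * cmod (s z))" for i
  proof -
    have "(\<integral>w. norm (t i w) \<partial>lebesgue) = (LINT w:p ` S i|lebesgue. cmod (s (inv_into (S i) p w)))"
      by (simp add: set_lebesgue_integral_def t_def)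
    also have "complex_of_real \<dots> = (LINT z:S i|lebesgue. complex_of_real (?J z * cmod (s z)))"
      using CVn(2)[of i] by (simp add: set_integral_complex_of_real[symmetric] scaleR_conv_of_real)
    finally show ?thesis by (simp only: set_integral_complex_of_real of_real_eq_iff)
  qed
  have nint: "set_integrable lebesgue noncrit (\<lambda>z. ?J z * cmod (s z))"
    using set_integrable_norm[OF int] by simp
  have summ: "summable (\<lambda>i. \<integral>w. norm (t i w) \<partial>lebesgue)"
  proof (rule bounded_imp_summable)
    show "0 \<le> (\<integral>w. norm (t i w) \<partial>lebesgue)" for i by simp
    fix n
    have nn: "set_integrable lebesgue (S i) (\<lambda>z. ?J z * cmod (s z))" for i
      using nint S(1) Sn by (rule set_integrable_subset)
    have "(\<Sum>i\<le>n. \<integral>w. norm (t i w) \<partial>lebesgue) = (LINT z:(\<Union>i\<in>{..n}. S i)|lebesgue. ?J z * cmod (s z))"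
      unfolding t_norm
      by (rule set_integral_finite_Union[symmetric])
         (use S(1,4) nn in \<open>auto simp: disjoint_family_on_def\<close>)
    also have "\<dots> \<le> (LINT z:noncrit|lebesgue. ?J z * cmod (s z))"
      unfolding set_lebesgue_integral_def
    proof (rule integral_mono)
      show "integrable lebesgue (\<lambda>z. indicator (\<Union>i\<in>{..n}. S i) z *\<^sub>R (?J z * cmod (s z)))"
        using set_integrable_subset[OF nint, of "\<Union>i\<in>{..n}. S i"] S(1) Sn
        unfolding set_integrable_def by blast
      show "integrable lebesgue (\<lambda>z. indicator noncrit z *\<^sub>R (?J z * cmod (s z)))"
        using nint unfolding set_integrable_def .
      show "indicator (\<Union>i\<in>{..n}. S i) z *\<^sub>R (?J z * cmod (s z)) \<le> indicator noncrit z *\<^sub>R (?J z * cmod (s z))" for z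
        using Sn by (auto simp: indicator_def)
    qed
    finally show "(\<Sum>i\<le>n. \<integral>w. norm (t i w) \<partial>lebesgue) \<le> (LINT z:noncrit|lebesgue. ?J z * cmod (s z))" .
  qed
  have pS: "p ` S i \<subseteq> G" for i using Sn[of i] p_in by (auto simp: noncrit_def)
  \<comment> \<open>The pointwise identity holds over regular values; critical values form a null
    set, and off \<open>G\<close> every term is zero.\<close>
  have AEr: "AE w in lebesgue. summable (\<lambda>i. norm (t i w)) \<and>
      (\<Sum>i. t i w) = indicator regular w *\<^sub>R (\<Sum>z | z \<in> D \<and> p z = w. s z)"
    using AE_regular
  proof eventually_elim
    case (elim w)
    show ?case
    proof (cases "w \<in> G")
      case True
      with elim have "w \<in> regular" by simp
      then show ?thesis
        using fibre_sum_cover(3,4)[OF S(3,4,5), of w s] by (simp add: t_def)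
    next
      case False
      then have "w \<notin> p ` S i" for i using pS[of i] by blast
      then have "t i w = 0" for i by (simp add: t_def)
      moreover have "w \<notin> regular" using False by (auto simp: regular_def)
      ultimately show ?thesis by simp
    qed
  qed
  have 1: "integrable lebesgue (\<lambda>w. \<Sum>i. t i w)"
    by (rule integrable_suminf[OF t_int _ summ]) (use AEr in auto)
  have 2: "(\<integral>w. (\<Sum>i. t i w) \<partial>lebesgue) = (\<Sum>i. \<integral>w. t i w \<partial>lebesgue)"
    by (rule integral_suminf[OF t_int _ summ]) (use AEr in auto)
  have meas: "(\<lambda>w. indicator regular w *\<^sub>R (\<Sum>z | z \<in> D \<and> p z = w. s z)) \<in> borel_measurable lebesgue"
    by (rule borel_measurable_AE[OF borel_measurable_integrable[OF 1]]) (use AEr in auto)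
  show "set_integrable lebesgue regular (\<lambda>w. \<Sum>z | z \<in> D \<and> p z = w. s z)"
    unfolding set_integrable_def
    by (rule integrable_cong_AE_imp[OF 1 meas]) (use AEr in auto)
  have "(LINT w:regular|lebesgue. \<Sum>z | z \<in> D \<and> p z = w. s z) = (\<integral>w. (\<Sum>i. t i w) \<partial>lebesgue)"
    unfolding set_lebesgue_integral_def
    by (rule integral_cong_AE[OF meas borel_measurable_integrable[OF 1]]) (use AEr in auto)
  also have "\<dots> = (\<Sum>i. LINT z:S i|lebesgue. ?J z *\<^sub>R s z)"
    unfolding 2 t_eq ..
  also have "\<dots> = (LINT z:(\<Union>i. S i)|lebesgue. ?J z *\<^sub>R s z)"
    using S int by (intro lebesgue_integral_countable_add[symmetric]) (auto simp: disjoint_family_on_def)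
  finally show "(LINT w:regular|lebesgue. \<Sum>z | z \<in> D \<and> p z = w. s z)
      = (LINT z:noncrit|lebesgue. ?J z *\<^sub>R s z)"
    using S(5) by simp
qed

text \<open>Here integrability travels from \<open>G\<close> to \<open>D\<close>. A regular value
  lies in exactly \<open>m\<close> of the images of the pieces, so the partial sums of the L^1 norms
  are at most \<open>m\<close> times the integral of \<open>cmod (u w)\<close>.\<close>

lemma set_integrable_pullback:
  fixes u :: "complex^'n \<Rightarrow> complex"
  assumes int: "set_integrable lebesgue G u"
  shows "set_integrable lebesgue noncrit (\<lambda>z. (cmod (cjacobian p z))\<^sup>2 *\<^sub>R u (p z))"
proof -
  obtain S :: "nat \<Rightarrow> (complex^'n) set" where S: "\<And>i. S i \<in> sets lebesgue" "\<And>i. p ` S i \<in> sets lebesgue"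
      "\<And>i. inj_on p (S i)" "disjoint_family S" "(\<Union>i. S i) = noncrit"
    using noncrit_cover by blast
  let ?J = "\<lambda>z. (cmod (cjacobian p z))\<^sup>2"
  have Sn: "S i \<subseteq> noncrit" for i using S(5) by blast
  have SD: "S i \<subseteq> D" for i using Sn by (auto simp: noncrit_def)
  have pS: "p ` S i \<subseteq> G" for i using SD[of i] p_in by auto
  have intp: "set_integrable lebesgue (p ` S i) u" for i
    using int S(2) pS by (rule set_integrable_subset)
  have intn: "set_integrable lebesgue G (\<lambda>w. cmod (u w))"
    using set_integrable_norm[OF int] .
  have intpn: "set_integrable lebesgue (p ` S i) (\<lambda>w. complex_of_real (cmod (u w)))" for i
    by (rule set_integrable_complex_of_real[OF set_integrable_norm[OF intp]])
  note CV = change_of_variables_holomorphic[OF p_holo SD S(1,3)]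
  have intS: "set_integrable lebesgue (S i) (\<lambda>z. ?J z *\<^sub>R u (p z))" for i
    using CV(1) intp by blast
  define t where "t = (\<lambda>i z. indicator (S i) z *\<^sub>R (?J z *\<^sub>R u (p z)))"
  have t_int: "integrable lebesgue (t i)" for i
    using intS[of i] by (simp add: t_def set_integrable_def)
  have t_norm: "(\<integral>z. norm (t i z) \<partial>lebesgue) = (LINT w:p ` S i|lebesgue. cmod (u w))" for i
  proof -
    have "(\<integral>z. norm (t i z) \<partial>lebesgue) = (LINT z:S i|lebesgue. ?J z * cmod (u (p z)))"
      by (simp add: set_lebesgue_integral_def t_def mult.assoc)
    also have "complex_of_real \<dots> = (LINT w:p ` S i|lebesgue. complex_of_real (cmod (u w)))"
      using CV(2)[OF intpn, of i] by (simp add: set_integral_complex_of_real[symmetric] scaleR_conv_of_real)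
    finally show ?thesis by (simp only: set_integral_complex_of_real of_real_eq_iff)
  qed
  have summ: "summable (\<lambda>i. \<integral>z. norm (t i z) \<partial>lebesgue)"
  proof (rule bounded_imp_summable)
    show "0 \<le> (\<integral>z. norm (t i z) \<partial>lebesgue)" for i by simp
    fix n
    have nn: "integrable lebesgue (\<lambda>w. indicator (p ` S i) w *\<^sub>R cmod (u w))" for i
      using set_integrable_norm[OF intp] by (simp add: set_integrable_def)
    have "(\<Sum>i\<le>n. \<integral>z. norm (t i z) \<partial>lebesgue) = (\<integral>w. (\<Sum>i\<le>n. indicator (p ` S i) w *\<^sub>R cmod (u w)) \<partial>lebesgue)"
      unfolding t_norm set_lebesgue_integral_def
      by (rule Bochner_Integration.integral_sum[symmetric]) (rule nn)
    also have "\<dots> \<le> (\<integral>w. real m * (indicator G w *\<^sub>R cmod (u w)) \<partial>lebesgue)"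
    proof (rule integral_mono_AE)
      show "integrable lebesgue (\<lambda>w. \<Sum>i\<le>n. indicator (p ` S i) w *\<^sub>R cmod (u w))"
        by (intro Bochner_Integration.integrable_sum nn)
      show "integrable lebesgue (\<lambda>w. real m * (indicator G w *\<^sub>R cmod (u w)))"
        using intn by (simp add: set_integrable_def)
      show "AE w in lebesgue. (\<Sum>i\<le>n. indicator (p ` S i) w *\<^sub>R cmod (u w)) \<le> real m * (indicator G w *\<^sub>R cmod (u w))"
        using AE_regular
      proof eventually_elim
        case (elim w)
        show ?case
        proof (cases "w \<in> G")
          case True
          then have "w \<in> regular" using elim by simp
          note F = fibre_sum_cover(1,2)[OF S(3,4,5) this]
          have "(\<Sum>i\<le>n. indicator (p ` S i) w *\<^sub>R cmod (u w)) = real (card ({..n} \<inter> {i. w \<in> p ` S i})) * cmod (u w)"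
            by (simp add: indicator_def of_bool_def if_distrib[of "\<lambda>x. x * _"] sum.If_cases cong: if_cong)
          also have "\<dots> \<le> real m * cmod (u w)"
            using card_mono[OF F(1), of "{..n} \<inter> {i. w \<in> p ` S i}"] F(2) by (intro mult_right_mono) auto
          finally show ?thesis using True by simp
        next
          case False
          then have "w \<notin> p ` S i" for i using pS by blast
          then show ?thesis by (simp add: indicator_def)
        qed
      qed
    qed
    finally show "(\<Sum>i\<le>n. \<integral>z. norm (t i z) \<partial>lebesgue) \<le> (\<integral>w. real m * (indicator G w *\<^sub>R cmod (u w)) \<partial>lebesgue)" .
  qed
  have pt: "summable (\<lambda>i. norm (t i z)) \<and> (\<Sum>i. t i z) = indicator noncrit z *\<^sub>R (?J z *\<^sub>R u (p z))" for z
  proof (cases "z \<in> noncrit")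
    case True
    then obtain i where i: "z \<in> S i" using S(5) by blast
    have zero: "t j z = 0" if "j \<notin> {i}" for j
    proof -
      have "z \<notin> S j" using i S(4) that by (auto simp: disjoint_family_on_def)
      then show ?thesis by (simp add: t_def)
    qed
    have "summable (\<lambda>i. norm (t i z))" by (rule summable_finite[of "{i}"]) (use zero in auto)
    moreover have "(\<Sum>i. t i z) = (\<Sum>i\<in>{i}. t i z)" by (rule suminf_finite) (use zero in auto)
    ultimately show ?thesis using True i by (simp add: t_def)
  next
    case False
    then have "z \<notin> S i" for i using Sn[of i] by blast
    then have "t i z = 0" for i by (simp add: t_def)
    then show ?thesis using False by simp
  qed
  have "integrable lebesgue (\<lambda>z. \<Sum>i. t i z)"
    by (rule integrable_suminf[OF t_int _ summ]) (use pt in auto)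
  then show ?thesis using pt by (simp add: set_integrable_def)
qed

end

subsection \<open>The mollifier as an approximate identity\<close>

text \<open>The \<open>itself\<close> argument records the dimension. The value enters as a nonzero
  factor, divided out in \<open>trace_extension\<close>, and as the positive lower bound in
  \<open>noncrit_nonempty\<close>.\<close>

definition bump_mass :: "'n::finite itself \<Rightarrow> real" where
  "bump_mass _ = (\<integral>x. bump 1 (x :: complex^'n) \<partial>lborel)"

lemma bump_nonneg: "0 \<le> l \<Longrightarrow> 0 \<le> bump l x"
  by (simp add: bump_def)

lemma cjacobian_ident: "cjacobian (\<lambda>z. z) z = 1"
  using cjacobian_eq[of "\<lambda>z. z" "mat 1" z] by simp

lemma holomorphic_map_on_ident: "holomorphic_map_on (\<lambda>z. z) S"
  by (rule holomorphic_map_onI[of _ _ "\<lambda>_. mat 1"]) simp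

lemma exists_radius:
  assumes "(l::real) > 0"
  obtains r where "r > 0" "1 < l * r\<^sup>2"
proof (rule that[of "2 / sqrt l"])
  show "1 < l * (2 / sqrt l)\<^sup>2" using assms by (simp add: power_divide)
qed (use assms in simp)

lemma bump_integrable:
  assumes "l > 0"
  shows "integrable lborel (\<lambda>x :: complex^'n. bump l (x - w))"
proof -
  obtain r where r: "r > 0" "1 < l * r\<^sup>2" using exists_radius[OF assms] .
  have "set_integrable lborel UNIV (\<lambda>x :: complex^'n. bump l (x - w))"
    by (rule set_integrable_compact_support[of "cball w r"])
       (use bump_shift_eq_0[OF r] in \<open>auto intro!: continuous_intros\<close>)
  then show ?thesis by (simp add: set_integrable_def)
qed

text \<open>Parameter independence of the mollified trace, for the identity map and the constant
  function 1, takes the place of a substitution; translation invariance handles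
  \<open>w\<close>.\<close>

lemma integral_bump:
  fixes w :: "complex^'n"
  assumes "l > 0"
  shows "(\<integral>x. bump l (x - w) \<partial>lborel) = bump_mass TYPE('n)"
proof -
  have mt: "mtrace UNIV (\<lambda>z. z) (\<lambda>_. 1) l (0 :: complex^'n) = of_real (\<integral>x. bump l (x :: complex^'n) \<partial>lborel)" for l
    by (simp add: mtrace_def cjacobian_ident set_lebesgue_integral_def)
  obtain r1 where r1: "r1 > 0" "1 < l * r1\<^sup>2" using exists_radius[OF assms] .
  have r2: "(2::real) > 0" "1 < 1 * (2::real)\<^sup>2" by simp_all
  \<comment> \<open>A common radius, admissible both for \<open>l\<close> and for the parameter
    1.\<close>
  define r where "r = max r1 2"
  have r: "r > 0" "1 < l * r\<^sup>2" "1 < 1 * r\<^sup>2"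
  proof -
    show "r > 0" using r1(1) by (simp add: r_def)
    have "r1\<^sup>2 \<le> r\<^sup>2" "2\<^sup>2 \<le> r\<^sup>2" 
      using r1(1) by (auto simp only: r_def intro!: power_mono)
    then have "l * r1\<^sup>2 \<le> l * r\<^sup>2" "1 * 2\<^sup>2 \<le> 1 * r\<^sup>2" using assms by simp_all
    then show "1 < l * r\<^sup>2" "1 < 1 * r\<^sup>2" using r1(2) r2(2) by linarith+
  qed
  have "{z \<in> UNIV. z \<in> cball (0 :: complex^'n) r} = cball 0 r" by blast
  then have "compact {z \<in> UNIV. z \<in> cball (0 :: complex^'n) r}" by (simp only: compact_cball)
  from mtrace_parameter_independent[OF open_UNIV holomorphic_map_on_ident holomorphic_fun_on_const this r, of 1]
  have "(\<integral>x. bump l (x :: complex^'n) \<partial>lborel) = bump_mass TYPE('n)"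
    by (simp add: mt bump_mass_def)
  moreover have "(\<integral>x. bump l (x - w) \<partial>lborel) = (\<integral>x. bump l x \<partial>distr lborel borel ((+) (- w)))"
    by (subst integral_distr) (auto intro!: borel_measurable_continuous_onI continuous_intros)
  ultimately show ?thesis by (simp add: lborel_distr_plus)
qed

lemma bump_mass_pos: "bump_mass TYPE('n::finite) > 0"
proof -
  have int: "integrable lborel (\<lambda>x :: complex^'n. bump 1 x)"
    using bump_integrable[of 1 0] by simp
  have "bump_mass TYPE('n) \<noteq> 0"
  proof
    assume "bump_mass TYPE('n) = 0"
    then have "AE x :: complex^'n in lborel. bump 1 x = 0"
      using integral_nonneg_eq_0_iff_AE[OF int] by (simp add: bump_mass_def bump_nonneg)
    then have "negligible (ball (0 :: complex^'n) 1)"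
    proof -
      assume *: "AE x :: complex^'n in lborel. bump 1 x = 0"
      have "bump 1 x \<noteq> 0" if "x \<in> ball (0 :: complex^'n) 1" for x :: "complex^'n"
      proof -
        have "(norm x)\<^sup>2 < 1" using that by (simp add: abs_square_less_1[of "norm x", simplified])
        then show ?thesis by (simp add: bump_def)
      qed
      then have "AE x :: complex^'n in lborel. x \<notin> ball 0 1"
        using * by (auto elim: eventually_mono)
      then have "ball (0 :: complex^'n) 1 \<in> null_sets lborel"
        by (subst AE_iff_null_sets) auto
      then show ?thesis
        by (simp add: negligible_iff_null_sets null_sets_completionI)
    qed
    then show False using open_not_negligible[of "ball (0 :: complex^'n) 1"] by simp
  qed
  moreover have "bump_mass TYPE('n) \<ge> 0"
    by (simp add: bump_mass_def bump_nonneg)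
  ultimately show ?thesis by simp
qed

text \<open>For large \<open>l\<close> the bump is supported in a small ball inside
  \<open>V\<close>, so the values of \<open>f\<close> on the rest of \<open>R\<close> do not enter,
  and continuity at \<open>w\<close> bounds the error by a small multiple of the mass.\<close>

lemma approximate_identity:
  fixes f :: "complex^'n \<Rightarrow> complex"
  assumes V: "open V" "w \<in> V" "V \<subseteq> R" and f: "continuous_on V f"
  shows "((\<lambda>l. LINT x:R|lebesgue. f x * of_real (bump l (x - w))) \<longlongrightarrow> f w * of_real (bump_mass TYPE('n))) at_top"
proof (rule tendstoI)
  fix e :: real assume e: "e > 0"
  let ?c = "bump_mass TYPE('n)"
  \<comment> \<open>The factor 2 makes the final bound \<open>e / 2\<close>, strictly below
    \<open>e\<close>.\<close>
  define e' where "e' = e / (2 * ?c)"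
  have e': "e' > 0" using e bump_mass_pos[where 'n = 'n] by (simp add: e'_def)
  obtain d1 where d1: "d1 > 0" "cball w d1 \<subseteq> V" using V open_contains_cball by blast
  have "continuous (at w) f" using f V continuous_on_eq_continuous_at by blast
  then obtain d2 where d2: "d2 > 0" "\<And>x. dist x w < d2 \<Longrightarrow> dist (f x) (f w) < e'"
    unfolding continuous_at_eps_delta using e' by blast
  define d where "d = min d1 (d2 / 2)"
  have d: "d > 0" "cball w d \<subseteq> V" "\<And>x. x \<in> cball w d \<Longrightarrow> cmod (f x - f w) \<le> e'"
  proof -
    show "d > 0" "cball w d \<subseteq> V" using d1 d2(1) by (auto simp: d_def)
    show "cmod (f x - f w) \<le> e'" if "x \<in> cball w d" for x
    proof -
      have "dist x w < d2" using that d2(1) by (auto simp: d_def dist_commute)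
      from d2(2)[OF this] show ?thesis by (simp add: dist_norm)
    qed
  qed
  have "eventually (\<lambda>l. l > 1 / d\<^sup>2) at_top" by (rule eventually_gt_at_top)
  then show "eventually (\<lambda>l. dist (LINT x:R|lebesgue. f x * of_real (bump l (x - w))) (f w * of_real ?c) < e) at_top"
  proof eventually_elim
    case (elim l)
    have l: "1 < l * d\<^sup>2" "l > 0"
    proof -
      show "1 < l * d\<^sup>2" using elim d(1) by (simp add: pos_divide_less_eq)
      have "0 < 1 / d\<^sup>2" using d(1) by simp
      then show "l > 0" using elim by linarith
    qed
    have zero: "bump l (x - w) = 0" if "x \<notin> cball w d" for x
      using bump_shift_eq_0[OF d(1) l(1) that] .
    have eq: "indicator R x *\<^sub>R (f x * of_real (bump l (x - w))) = indicator (cball w d) x *\<^sub>R (f x * of_real (bump l (x - w)))" for x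
      using zero[of x] d(2) V(3) by (auto simp: indicator_def)
    have int: "integrable lborel (\<lambda>x. indicator (cball w d) x *\<^sub>R (f x * of_real (bump l (x - w))))"
      by (rule borel_integrable_compact)
         (auto intro!: continuous_intros continuous_on_subset[OF f d(2)])
    have int2: "integrable lborel (\<lambda>x. f w * complex_of_real (bump l (x - w)))"
      by (intro integrable_mult_right integrable_of_real bump_integrable l)
    have "(LINT x:R|lebesgue. f x * of_real (bump l (x - w))) = (\<integral>x. indicator (cball w d) x *\<^sub>R (f x * of_real (bump l (x - w))) \<partial>lborel)"
      unfolding set_lebesgue_integral_def eq
      by (rule integral_completion) (rule borel_measurable_integrable[OF int])
    moreover have "f w * of_real ?c = (\<integral>x. f w * complex_of_real (bump l (x - w)) \<partial>lborel)"
      by (simp add: integral_bump[OF l(2)])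
    ultimately have "dist (LINT x:R|lebesgue. f x * of_real (bump l (x - w))) (f w * of_real ?c)
      = cmod (\<integral>x. indicator (cball w d) x *\<^sub>R (f x * of_real (bump l (x - w))) - f w * complex_of_real (bump l (x - w)) \<partial>lborel)"
      by (simp only: dist_norm Bochner_Integration.integral_diff[OF int int2])
    also have "\<dots> \<le> (\<integral>x. cmod (indicator (cball w d) x *\<^sub>R (f x * of_real (bump l (x - w))) - f w * complex_of_real (bump l (x - w))) \<partial>lborel)"
      by (rule integral_norm_bound)
    also have "\<dots> \<le> (\<integral>x. e' * bump l (x - w) \<partial>lborel)"
    proof (rule integral_mono)
      show "integrable lborel (\<lambda>x. cmod (indicator (cball w d) x *\<^sub>R (f x * of_real (bump l (x - w))) - f w * complex_of_real (bump l (x - w))))"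
        using int int2 by (intro integrable_norm Bochner_Integration.integrable_diff)
      show "integrable lborel (\<lambda>x. e' * bump l (x - w))"
        using bump_integrable[OF l(2), of w] by simp
      fix x
      show "cmod (indicator (cball w d) x *\<^sub>R (f x * of_real (bump l (x - w))) - f w * complex_of_real (bump l (x - w))) \<le> e' * bump l (x - w)"
      proof (cases "x \<in> cball w d")
        case True
        have "cmod (f x * of_real (bump l (x - w)) - f w * complex_of_real (bump l (x - w))) = cmod (f x - f w) * bump l (x - w)"
          using bump_nonneg[of l "x - w"] l(2)
          by (simp only: left_diff_distrib[symmetric] norm_mult norm_of_real) simp
        also have "\<dots> \<le> e' * bump l (x - w)"
          using d(3)[OF True] bump_nonneg[of l "x - w"] l(2) by (intro mult_right_mono) auto
        finally show ?thesis using True by simp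
      next
        case False
        then show ?thesis using zero[OF False] by simp
      qed
    qed
    also have "\<dots> = e' * ?c" by (simp add: integral_bump[OF l(2)])
    also have "\<dots> < e" using e bump_mass_pos[where 'n = 'n] by (simp add: e'_def)
    finally show ?case .
  qed
qed

subsection \<open>A proper holomorphic map has a regular point\<close>

lemma mat_vector_mult: "mat x *v v = x *s v" for v :: "'a::comm_semiring_1^'n"
proof -
  have "mat x $ i $ j * v $ j = (if j = i then x * v $ i else 0)" for i j
    by (simp add: mat_def)
  then show ?thesis by (simp add: vec_eq_iff matrix_vector_mult_def)
qed

text \<open>The determinant is an entire function of \<open>x\<close> that is nonzero at a real
  number exceeding an operator bound of \<open>A\<close>, so a zero at 0 is isolated.\<close>

lemma det_shift_nonzero:
  fixes A :: "complex^'n^'n"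
  obtains e where "e > 0" "\<And>x. 0 < cmod x \<Longrightarrow> cmod x < e \<Longrightarrow> det (A + mat x) \<noteq> 0"
proof -
  let ?f = "\<lambda>x. det (A + mat x)"
  have hol: "?f holomorphic_on UNIV"
  proof -
    have "(\<lambda>x. (A + mat x) $ i $ j) holomorphic_on UNIV" for i j
      by (cases "i = j") (auto simp: mat_def intro!: holomorphic_intros)
    then show ?thesis unfolding det_def by (intro holomorphic_intros)
  qed
  obtain B where B: "\<And>v. norm (A *v v) \<le> B * norm v"
    using bounded_linear.bounded[OF bounded_linear_matrix_vector[of A]] by (metis mult.commute)
  have nz: "?f (of_real (\<bar>B\<bar> + 1)) \<noteq> 0"
  proof
    define x where "x = complex_of_real (\<bar>B\<bar> + 1)"
    assume "?f (complex_of_real (\<bar>B\<bar> + 1)) = 0"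
    then have "?f x = 0" by (simp only: x_def)
    then have "\<not> inj (\<lambda>v. (A + mat x) *v v)"
      using det_nz_iff_inj_gen[of "\<lambda>v. (A + mat x) *v v"] by simp
    then obtain a b where ab: "(A + mat x) *v a = (A + mat x) *v b" "a \<noteq> b" unfolding inj_def by blast
    then have "(A + mat x) *v (a - b) = 0" by (simp add: matrix_vector_mult_diff_distrib)
    then have "A *v (a - b) + x *s (a - b) = 0"
      by (simp only: matrix_vector_mult_add_rdistrib mat_vector_mult)
    then have "A *v (a - b) = - (x *s (a - b))"
      by (simp only: eq_neg_iff_add_eq_0)
    then have "norm (x *s (a - b)) \<le> B * norm (a - b)"
      using B[of "a - b"] by (simp only: norm_minus_cancel)
    then have "(\<bar>B\<bar> + 1) * norm (a - b) \<le> B * norm (a - b)"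
      by (simp only: norm_vector_smult norm_of_real x_def)
    then show False using ab(2) by (simp add: mult_le_cancel_right)
  qed
  show thesis
  proof (cases "?f 0 = 0")
    case True
    obtain r where "0 < r" "\<And>z. z \<in> ball 0 r - {0} \<Longrightarrow> ?f z \<noteq> 0"
      using isolated_zeros[OF hol open_UNIV connected_UNIV UNIV_I True UNIV_I nz] by metis
    then show thesis by (intro that[of r]) auto
  next
    case False
    have "isCont ?f 0"
      using holomorphic_on_imp_continuous_on[OF hol] by (simp add: continuous_on_eq_continuous_at)
    from continuous_at_avoid[OF this False] obtain e where "e > 0" "\<And>y. dist 0 y < e \<Longrightarrow> ?f y \<noteq> 0"
      by blast
    then show thesis by (intro that[of e]) auto
  qed
qed

context proper_hol
begin

lemma regular_meets_open:
  assumes "open V" "V \<noteq> {}" "V \<subseteq> G"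
  shows "V \<inter> regular \<noteq> {}"
proof
  assume "V \<inter> regular = {}"
  then have "V \<subseteq> p ` crit D p" using assms(3) by (auto simp: regular_def)
  then have "negligible V" using negligible_image_crit[OF p_holo] negligible_subset by blast
  then show False using open_not_negligible assms by blast
qed

text \<open>If the Jacobian determinant vanished identically, the constant mollified trace of the
  perturbed maps \<open>p + \<epsilon>(z - z\<^sub>0)\<close> would tend to 0 with \<open>\<epsilon>\<close>, although it is bounded below by the
  contribution of the regular preimage \<open>z\<^sub>0\<close>.\<close>

lemma noncrit_nonempty: "noncrit \<noteq> {}"
proof
  assume "noncrit = {}"
  then have J0: "cjacobian p z = 0" if "z \<in> D" for z using that noncrit_iff by blast
  obtain z0 where z0: "z0 \<in> D" using D by (auto simp: cdomain_def)
  define w0 where "w0 = p z0"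
  obtain r where r: "r > 0" "cball w0 r \<subseteq> G"
    using p_in[OF z0] open_G open_contains_cball unfolding w0_def by blast
  define K where "K = {z\<in>D. p z \<in> cball w0 r}"
  \<comment> \<open>\<open>S\<close> is open, as the mollified trace requires, and lies in the
    compact set \<open>K\<close> inside \<open>D\<close>, which supplies the uniform bounds.\<close>
  define S where "S = D \<inter> p -` ball w0 r"
  have K: "compact K" unfolding K_def by (rule compact_preimage) (use r in auto)
  have cp: "continuous_on D p" by (rule holomorphic_map_on_imp_continuous_on[OF p_holo])
  have S: "open S" unfolding S_def
    by (rule continuous_open_preimage[OF cp open_D open_ball])
  have SK: "S \<subseteq> K" "S \<subseteq> D" "K \<subseteq> D" by (auto simp: S_def K_def)
  have z0S: "z0 \<in> S" using z0 r by (simp add: S_def w0_def)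
  define h where "h = (\<lambda>e z. p z + complex_of_real e *s (z - z0))"
  have dh: "(h e has_derivative (\<lambda>v. (jac_matrix p z + mat (complex_of_real e)) *v v)) (at z)" if "z \<in> D" for e z
  proof -
    have "bounded_linear (\<lambda>v. complex_of_real e *s v :: complex^'n)"
      unfolding scaleR_eq_vector_smult[symmetric] by (rule bounded_linear_scaleR_right)
    moreover have "((\<lambda>z. z - z0) has_derivative (\<lambda>v. v)) (at z)"
      by (auto intro!: derivative_eq_intros)
    ultimately have "((\<lambda>z. complex_of_real e *s (z - z0)) has_derivative (\<lambda>v. complex_of_real e *s v)) (at z)"
      by (rule bounded_linear.has_derivative)
    from has_derivative_add[OF jac_matrix_has_derivative[OF p_holo that] this]
    show ?thesis
      by (simp add: h_def matrix_vector_mult_add_rdistrib mat_vector_mult)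
  qed
  have hh: "holomorphic_map_on (h e) S" for e
    using dh SK(2) by (intro holomorphic_map_onI) blast
  have ch: "continuous_on K (h e)" for e
    unfolding h_def scaleR_eq_vector_smult[symmetric]
    by (intro continuous_intros continuous_on_subset[OF cp SK(3)])
  have Jh: "cjacobian (h e) z = det (jac_matrix p z + mat (complex_of_real e))" if "z \<in> D" for e z
    by (rule cjacobian_eq[OF dh[OF that]])
  have hz0: "h e z0 = w0" for e by (simp add: h_def w0_def)
  obtain M where M: "M > 0" "\<And>z. z \<in> K \<Longrightarrow> norm (z - z0) \<le> M"
  proof -
    have "bounded ((\<lambda>z. z - z0) ` K)"
      by (intro compact_imp_bounded compact_continuous_image K continuous_intros)
    then show thesis using that unfolding bounded_pos by auto
  qed
  obtain C where C: "C > 0" "\<And>e z. 0 \<le> e \<Longrightarrow> e \<le> 1 \<Longrightarrow> z \<in> K \<Longrightarrow> cmod (det (jac_matrix p z + mat (complex_of_real e))) \<le> C"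
  proof -
    have "continuous_on ({0..1} \<times> K) (\<lambda>(e, z). det (jac_matrix p z + mat (complex_of_real e)))"
    proof -
      have cj: "continuous_on ({0..1::real} \<times> K) (\<lambda>x. jac_matrix p (snd x) $ i $ j)" for i j
        by (rule continuous_on_compose2[OF continuous_on_subset[OF
              holomorphic_fun_on_imp_continuous_on[OF holomorphic_jac_matrix[OF p_holo open_D]] SK(3)]])
           (auto intro!: continuous_intros)
      have ce: "continuous_on ({0..1::real} \<times> K) (\<lambda>x. mat (complex_of_real (fst x)) $ i $ j)" for i j :: 'n
        by (cases "i = j") (auto simp: mat_def intro!: continuous_intros)
      show ?thesis
        unfolding det_def split_def vector_add_component by (intro continuous_intros cj ce)
    qed
    then have "bounded ((\<lambda>(e, z). det (jac_matrix p z + mat (complex_of_real e))) ` ({0..1} \<times> K))"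
      by (intro compact_imp_bounded compact_continuous_image compact_Times K) auto
    then obtain C where "C > 0" "\<forall>x\<in>(\<lambda>(e, z). det (jac_matrix p z + mat (complex_of_real e))) ` ({0..1} \<times> K). cmod x \<le> C"
      unfolding bounded_pos by blast
    then show thesis by (intro that[of C]) auto
  qed
  \<comment> \<open>Admissible perturbations move values on \<open>K\<close> by at most
    \<open>r / 2\<close>, so points of \<open>K\<close> with perturbed value in
    \<open>cball w0 R\<close> are mapped by \<open>p\<close> to within \<open>3 * r / 4\<close> of
    \<open>w0\<close> and lie in \<open>S\<close>. The parameter \<open>l0\<close> is the same for
    all perturbations, so the limit can be taken under the integral.\<close>
  define R where "R = r / 4"
  define l0 where "l0 = 2 / R\<^sup>2"
  have R: "R > 0" and l0: "l0 > 0" "1 < l0 * R\<^sup>2" using r by (simp_all add: R_def l0_def)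
  have comp: "compact {z\<in>S. h e z \<in> cball w0 R}" if e: "0 \<le> e" "e * M \<le> r / 2" for e
  proof -
    have "z \<in> S" if "z \<in> K" "h e z \<in> cball w0 R" for z
    proof -
      have "norm (h e z - p z) \<le> e * M"
      proof -
        have "h e z - p z = complex_of_real e *s (z - z0)" by (simp only: h_def add_diff_cancel_left')
        then have "norm (h e z - p z) = e * norm (z - z0)"
          using e(1) by (simp only: norm_vector_smult norm_of_real abs_of_nonneg)
        then show ?thesis using mult_left_mono[OF M(2)[OF that(1)] e(1)] by simp
      qed
      then have "dist (p z) (h e z) \<le> r / 2" using e(2) by (simp add: dist_norm norm_minus_commute)
      moreover have "dist w0 (p z) \<le> dist w0 (h e z) + dist (h e z) (p z)" by (rule dist_triangle)
      ultimately have "dist w0 (p z) < r" using that(2) r(1) by (simp add: R_def dist_commute)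
      then show ?thesis using that(1) by (simp add: S_def K_def)
    qed
    then have "{z\<in>S. h e z \<in> cball w0 R} = K \<inter> h e -` cball w0 R" using SK(1) by auto
    moreover have "closedin (top_of_set K) (K \<inter> h e -` cball w0 R)"
      by (rule continuous_closedin_preimage[OF ch]) simp
    ultimately show ?thesis using closedin_compact[OF K] by simp
  qed
  \<comment> \<open>Taking the Jacobian of the perturbed map as \<open>g\<close> makes the integrand
    nonnegative, so the part near \<open>z0\<close> bounds the integral from below.\<close>
  define I where "I = (\<lambda>e. mtrace S (h e) (cjacobian (h e)) l0 w0)"
  have lower: "Re (I e) \<ge> bump_mass TYPE('n)"
    if e: "0 \<le> e" "e * M \<le> r / 2" "cjacobian (h e) z0 \<noteq> 0" for e
  proof -
    have hJ: "holomorphic_fun_on (cjacobian (h e)) S" by (rule holomorphic_cjacobian[OF hh S])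
    obtain U V \<rho> where UV: "open U" "U \<subseteq> S" "z0 \<in> U" "open V" "homeomorphism U V (h e) \<rho>"
      using holomorphic_local_inverse[OF S hh z0S e(3)] by metis
    have img: "h e ` U = V" using UV(5) by (rule homeomorphism_image1)
    have inj: "inj_on (h e) U" using UV(5) by (metis homeomorphism_apply1 inj_on_inverseI)
    have "w0 \<in> V" using hz0[of e] UV(3) img by blast
    then obtain d where d: "d > 0" "cball w0 d \<subseteq> V" using UV(4) open_contains_cball by blast
    \<comment> \<open>Parameter independence permits raising the parameter until the bump is
      supported in \<open>V\<close>; the part over \<open>U\<close> is then the whole mass.\<close>
    define l where "l = l0 + 2 / d\<^sup>2"
    have l: "l > 0" "1 < l * R\<^sup>2" "1 < l * d\<^sup>2"
    proof -
      show "l > 0" using l0 d by (simp add: l_def add_pos_nonneg)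
      have "0 \<le> 2 / d\<^sup>2 * R\<^sup>2" by simp
      then show "1 < l * R\<^sup>2" using l0(2) unfolding l_def distrib_right by linarith
      have "2 / d\<^sup>2 * d\<^sup>2 = 2" using d(1) by simp
      moreover have "0 \<le> l0 * d\<^sup>2" using l0(1) by simp
      ultimately show "1 < l * d\<^sup>2" unfolding l_def distrib_right by linarith
    qed
    let ?q = "\<lambda>z. (cmod (cjacobian (h e) z))\<^sup>2 * bump l (h e z - w0)"
    have eq: "cjacobian (h e) z * cnj (cjacobian (h e) z) * complex_of_real (bump l (h e z - w0)) = complex_of_real (?q z)" for z
      by (simp only: of_real_mult complex_norm_square)
    have int: "set_integrable lborel S (\<lambda>z. complex_of_real (?q z))"
      using mtrace_set_integrable[OF S hh hJ comp[OF e(1,2)] R l(2)] unfolding eq .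
    have intq: "set_integrable lborel S ?q"
    proof -
      have "integrable lborel (\<lambda>z. Re (indicator S z *\<^sub>R complex_of_real (?q z)))"
        using int unfolding set_integrable_def by (rule integrable_Re)
      then show ?thesis by (simp add: set_integrable_def)
    qed
    have "I e = mtrace S (h e) (cjacobian (h e)) l w0"
      unfolding I_def by (rule mtrace_parameter_independent[OF S hh hJ comp[OF e(1,2)] R l0(2) l(2)])
    also have "\<dots> = complex_of_real (LINT z:S|lborel. ?q z)"
      unfolding mtrace_def eq by (rule set_integral_complex_of_real)
    finally have Ie: "Re (I e) = (LINT z:S|lborel. ?q z)" by simp
    have intU: "set_integrable lborel U ?q"
      using intq by (rule set_integrable_subset) (use UV in auto)
    have "(LINT z:U|lborel. ?q z) \<le> (LINT z:S|lborel. ?q z)"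
      unfolding set_lebesgue_integral_def
    proof (rule integral_mono)
      show "integrable lborel (\<lambda>z. indicator U z *\<^sub>R ?q z)" using intU unfolding set_integrable_def .
      show "integrable lborel (\<lambda>z. indicator S z *\<^sub>R ?q z)" using intq unfolding set_integrable_def .
      have "0 \<le> ?q z" for z using bump_nonneg[of l "h e z - w0"] l(1) by simp
      then show "indicator U z *\<^sub>R ?q z \<le> indicator S z *\<^sub>R ?q z" for z
        using UV(2) by (auto simp: indicator_def simp del: mult_nonneg_nonneg)
    qed
    moreover have "(LINT z:U|lborel. ?q z) = bump_mass TYPE('n)"
    proof -
      have zero: "bump l (w - w0) = 0" if "w \<notin> V" for w
        using bump_shift_eq_0[OF d(1) l(3)] that d(2) by blast
      have bl: "integrable lebesgue (\<lambda>w. complex_of_real (bump l (w - w0)))"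
        by (rule integrable_completion[THEN iffD2])
           (auto intro!: borel_measurable_continuous_onI continuous_intros integrable_of_real bump_integrable l)
      have ind: "indicator V w *\<^sub>R complex_of_real (bump l (w - w0)) = complex_of_real (bump l (w - w0))" for w
        using zero[of w] by (auto simp: indicator_def)
      have "set_integrable lebesgue (h e ` U) (\<lambda>w. complex_of_real (bump l (w - w0)))"
        unfolding img set_integrable_def ind by (rule bl)
      from change_of_variables_holomorphic(2)[OF hh UV(2) _ inj this] UV(1)
      have "(LINT z:U|lebesgue. (cmod (cjacobian (h e) z))\<^sup>2 *\<^sub>R complex_of_real (bump l (h e z - w0)))
          = (LINT w:V|lebesgue. complex_of_real (bump l (w - w0)))"
        unfolding img by simp
      also have "\<dots> = (\<integral>w. complex_of_real (bump l (w - w0)) \<partial>lborel)"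
        unfolding set_lebesgue_integral_def ind
        by (rule integral_completion) (auto intro!: borel_measurable_continuous_onI continuous_intros)
      also have "\<dots> = complex_of_real (bump_mass TYPE('n))"
        by (simp add: integral_bump[OF l(1)])
      finally have "complex_of_real (LINT z:U|lebesgue. ?q z) = complex_of_real (bump_mass TYPE('n))"
        by (simp add: set_integral_complex_of_real[symmetric] scaleR_conv_of_real)
      moreover have "(LINT z:U|lebesgue. ?q z) = (LINT z:U|lborel. ?q z)"
        unfolding set_lebesgue_integral_def
        by (rule integral_completion, rule borel_measurable_integrable) (use intU in \<open>simp add: set_integrable_def\<close>)
      ultimately show ?thesis by simp
    qed
    ultimately show ?thesis using Ie by simp
  qed
  obtain e1 where e1: "e1 > 0" "\<And>x. 0 < cmod x \<Longrightarrow> cmod x < e1 \<Longrightarrow> det (jac_matrix p z0 + mat x) \<noteq> 0"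
    using det_shift_nonzero by blast
  \<comment> \<open>Staying below \<open>e1\<close> keeps the Jacobian at \<open>z0\<close> nonzero,
    1 is the range in which \<open>C\<close> is a bound, and \<open>r / 2 / M\<close> limits the
    displacement to \<open>r / 2\<close>.\<close>
  define e0 where "e0 = min (e1 / 2) (min 1 (r / 2 / M))"
  have e0: "0 < e0" "e0 < e1" "e0 \<le> 1" "e0 \<le> r / 2 / M" using e1 r M by (auto simp: e0_def)
  define e where "e = (\<lambda>n. e0 * inverse (real (Suc n)))"
  have e: "0 < e n" "e n \<le> e0" for n
  proof -
    have "inverse (real (Suc n)) \<le> 1" by (simp add: field_simps)
    then have "e0 * inverse (real (Suc n)) \<le> e0 * 1" using e0(1) by (intro mult_left_mono) auto
    then show "0 < e n" "e n \<le> e0" using e0(1) by (simp_all add: e_def)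
  qed
  have elim: "e \<longlonglongrightarrow> 0"
    unfolding e_def using tendsto_mult_left[OF LIMSEQ_inverse_real_of_nat, of e0] by simp
  have eM: "e n * M \<le> r / 2" for n
  proof -
    have "e n * M \<le> e0 * M" using e(2)[of n] M(1) by (intro mult_right_mono) auto
    also have "\<dots> \<le> r / 2" using e0(4) M(1) pos_le_divide_eq[of M e0 "r / 2"] by blast
    finally show ?thesis .
  qed
  have "bump_mass TYPE('n) \<le> Re (I (e n))" for n
  proof (rule lower)
    show "cjacobian (h (e n)) z0 \<noteq> 0"
      unfolding Jh[OF z0] by (rule e1(2)) (use e[of n] e0 in auto)
  qed (use e[of n] eM in auto)
  \<comment> \<open>Dominated convergence on \<open>K\<close>: the perturbed Jacobians are bounded
    by \<open>C\<close> and tend to that of \<open>p\<close>, which is zero by assumption.\<close>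
  moreover have "(\<lambda>n. I (e n)) \<longlonglongrightarrow> 0"
  proof -
    define q where "q = (\<lambda>n z. indicator S z *\<^sub>R (cjacobian (h (e n)) z * cnj (cjacobian (h (e n)) z) * complex_of_real (bump l0 (h (e n) z - w0))))"
    have bl: "\<bar>bump l0 x\<bar> \<le> l0 ^ CARD('n)" for x :: "complex^'n"
    proof -
      have "(max 0 (1 - l0 * (norm x)\<^sup>2))\<^sup>2 \<le> 1"
        using l0(1) by (intro power_le_one) auto
      then have "l0 ^ CARD('n) * (max 0 (1 - l0 * (norm x)\<^sup>2))\<^sup>2 \<le> l0 ^ CARD('n) * 1"
        using l0(1) by (intro mult_left_mono) auto
      then show ?thesis using l0(1) by (simp add: bump_def)
    qed
    have "(\<lambda>n. \<integral>z. q n z \<partial>lborel) \<longlonglongrightarrow> (\<integral>z. 0 \<partial>(lborel :: (complex^'n) measure))"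
    proof (rule integral_dominated_convergence[where w = "\<lambda>z. indicator K z *\<^sub>R (C\<^sup>2 * l0 ^ CARD('n))"])
      show "q n \<in> borel_measurable lborel" for n
        unfolding q_def
        by (rule borel_measurable_integrable)
           (rule mtrace_set_integrable[OF S hh holomorphic_cjacobian[OF hh S] comp[OF less_imp_le[OF e(1)] eM] R l0(2), unfolded set_integrable_def])
      show "integrable lborel (\<lambda>z. indicator K z *\<^sub>R (C\<^sup>2 * l0 ^ CARD('n)))"
        by (rule borel_integrable_compact[OF K]) (rule continuous_on_const)
      have qn: "cmod (q n z) \<le> indicator S z * ((cmod (cjacobian (h (e n)) z))\<^sup>2 * l0 ^ CARD('n))" for n z
        using mult_left_mono[OF bl, of "(cmod (cjacobian (h (e n)) z))\<^sup>2"]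
        by (auto simp: q_def norm_mult power2_eq_square indicator_def)
      show "AE z in lborel. (\<lambda>n. q n z) \<longlonglongrightarrow> 0"
      proof (rule AE_I2)
        fix z
        show "(\<lambda>n. q n z) \<longlonglongrightarrow> 0"
        proof (cases "z \<in> S")
          case True
          then have zD: "z \<in> D" using SK by blast
          have "(\<lambda>n. cjacobian (h (e n)) z) \<longlonglongrightarrow> det (jac_matrix p z + mat (complex_of_real 0))"
          proof -
            have "(\<lambda>n. mat (complex_of_real (e n)) $ i $ j) \<longlonglongrightarrow> mat (complex_of_real 0) $ i $ j" for i j :: 'n
              using tendsto_of_real[OF elim, where 'a = complex] by (cases "i = j") (auto simp: mat_def)
            note m = this
            show ?thesis
              unfolding Jh[OF zD] det_def vector_add_component
              by (intro tendsto_sum tendsto_mult[OF tendsto_const] tendsto_prod tendsto_add[OF tendsto_const m])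
          qed
          moreover have "det (jac_matrix p z + mat (complex_of_real 0)) = 0"
            using J0[OF zD] cjacobian_eq_det_jac_matrix[OF p_holo zD] by simp
          ultimately have "(\<lambda>n. cjacobian (h (e n)) z) \<longlonglongrightarrow> 0" by simp
          then have "(\<lambda>n. indicator S z * ((cmod (cjacobian (h (e n)) z))\<^sup>2 * l0 ^ CARD('n))) \<longlonglongrightarrow> indicator S z * ((cmod 0)\<^sup>2 * l0 ^ CARD('n))"
            by (intro tendsto_intros)
          then have "(\<lambda>n. indicator S z * ((cmod (cjacobian (h (e n)) z))\<^sup>2 * l0 ^ CARD('n))) \<longlonglongrightarrow> 0"
            by simp
          then show ?thesis
            by (rule Lim_null_comparison[rotated]) (use qn in auto)
        qed (simp add: q_def)
      qed
      show "AE z in lborel. norm (q n z) \<le> indicator K z *\<^sub>R (C\<^sup>2 * l0 ^ CARD('n))" for n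
      proof (rule AE_I2)
        fix z
        show "norm (q n z) \<le> indicator K z *\<^sub>R (C\<^sup>2 * l0 ^ CARD('n))"
        proof (cases "z \<in> S")
          case True
          then have z: "z \<in> K" "z \<in> D" using SK by blast+
          have "cmod (cjacobian (h (e n)) z) \<le> C"
            unfolding Jh[OF z(2)] using e[of n] e0(3) z(1) by (intro C(2)) auto
          then have "(cmod (cjacobian (h (e n)) z))\<^sup>2 * l0 ^ CARD('n) \<le> C\<^sup>2 * l0 ^ CARD('n)"
            using l0(1) by (intro mult_right_mono power_mono) auto
          then show ?thesis using qn[of n z] True z(1) by simp
        next
          case False
          then show ?thesis using C l0(1) by (simp add: q_def)
        qed
      qed
    qed simp
    then show ?thesis by (simp add: I_def mtrace_def set_lebesgue_integral_def q_def)
  qed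
  then have "(\<lambda>n. Re (I (e n))) \<longlonglongrightarrow> 0" using tendsto_Re by fastforce
  ultimately have "bump_mass TYPE('n) \<le> 0"
    by (intro LIMSEQ_le_const) auto
  then show False using bump_mass_pos[where 'n = 'n] by simp
qed

end

subsection \<open>Holomorphic extension of the trace\<close>

context proper_hol
begin

text \<open>The open image of the noncritical set meets the regular values because critical values
  form a null set; a fibre there is nonempty and has \<open>m\<close> points.\<close>

lemma multiplicity_pos: "m > 0"
proof -
  obtain z where z: "z \<in> noncrit" using noncrit_nonempty by blast
  have "holomorphic_map_on p noncrit"
    using p_holo by (rule holomorphic_map_on_subset) (auto simp: noncrit_def)
  then have "open (p ` noncrit)"
    using open_noncrit noncrit_iff by (intro open_holomorphic_image) auto
  moreover have "p ` noncrit \<subseteq> G" using p_in by (auto simp: noncrit_def)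
  ultimately have "p ` noncrit \<inter> regular \<noteq> {}" using z by (intro regular_meets_open) auto
  then obtain z' where "z' \<in> noncrit" "p z' \<in> regular" by blast
  then have "z' \<in> {z\<in>D. p z = p z'}" by (simp add: noncrit_def)
  then show ?thesis
    using regular_fibre(1,2)[OF \<open>p z' \<in> regular\<close>] card_gt_0_iff by blast
qed

text \<open>Dividing by \<open>J = cjacobian p\<close> is dictated by the change of variables: the
  squared modulus of \<open>J\<close> times \<open>g / J\<close> is \<open>g * cnj J\<close>, the
  density in \<open>mtrace\<close>. Over critical values, where division by zero gives 0, the sum
  carries no meaning.\<close>

definition fibre_sum :: "(complex^'n \<Rightarrow> complex) \<Rightarrow> complex^'n \<Rightarrow> complex" where
  "fibre_sum g w = (\<Sum>z | z \<in> D \<and> p z = w. g z / cjacobian p z)"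

lemma fibre_sum_local_inverses:
  assumes "local_inverses D G p m U \<rho>" "w \<in> U"
  shows "fibre_sum g w = (\<Sum>k=1..m. g (\<rho> k w) / cjacobian p (\<rho> k w))"
proof -
  have "bij_betw (\<lambda>k. \<rho> k w) {1..m} {z \<in> D. p z = w}"
    using assms by (simp add: local_inverses_def)
  from sum.reindex_bij_betw[OF this, of "\<lambda>z. g z / cjacobian p z"] show ?thesis
    by (simp add: fibre_sum_def)
qed

lemma local_inverses_in:
  assumes "local_inverses D G p m U \<rho>" "w \<in> U" "k \<in> {1..m}"
  shows "\<rho> k w \<in> noncrit" "p (\<rho> k w) = w"
proof -
  have "w \<in> regular" using assms by (auto simp: local_inverses_def regular_def)
  moreover have "bij_betw (\<lambda>k. \<rho> k w) {1..m} {z \<in> D. p z = w}"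
    using assms(1,2) unfolding local_inverses_def by blast
  then have "\<rho> k w \<in> {z \<in> D. p z = w}"
    using assms(3) by (rule bij_betw_apply)
  ultimately show "\<rho> k w \<in> noncrit" "p (\<rho> k w) = w" using regular_fibre(3) by auto
qed

text \<open>For large \<open>l\<close> the change of variables turns the trace into the integral of
  the fibre sum against the bump. Local inverses make the fibre sum continuous near
  \<open>w\<close>, so the approximate identity applies.\<close>

lemma mtrace_tendsto:
  assumes g: "holomorphic_fun_on g D" and w: "w \<in> regular"
  shows "((\<lambda>l. mtrace D p g l w) \<longlongrightarrow> fibre_sum g w * of_real (bump_mass TYPE('n))) at_top"
proof -
  let ?J = "cjacobian p"
  obtain U \<rho> where U: "w \<in> U" "local_inverses D G p m U \<rho>" using local_inverses_exist[OF w] by blast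
  have oU: "open U" "U \<subseteq> regular" using U(2) by (auto simp: local_inverses_def regular_def)
  have cont: "continuous_on U (fibre_sum g)"
  proof -
    have "continuous_on U (\<lambda>w. \<Sum>k=1..m. g (\<rho> k w) / ?J (\<rho> k w))"
    proof (intro continuous_intros)
      fix k assume k: "k \<in> {1..m}"
      have c\<rho>: "continuous_on U (\<rho> k)"
        using U(2) k by (auto simp: local_inverses_def intro: holomorphic_map_on_imp_continuous_on)
      have im: "\<rho> k ` U \<subseteq> D" "\<And>w. w \<in> U \<Longrightarrow> ?J (\<rho> k w) \<noteq> 0"
        using local_inverses_in[OF U(2) _ k] noncrit_iff by blast+
      show "continuous_on U (\<lambda>w. g (\<rho> k w))"
        by (rule continuous_on_compose2[OF holomorphic_fun_on_imp_continuous_on[OF g] c\<rho> im(1)])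
      show "continuous_on U (\<lambda>w. ?J (\<rho> k w))"
        by (rule continuous_on_compose2[OF holomorphic_fun_on_imp_continuous_on[OF holomorphic_cjacobian[OF p_holo open_D]] c\<rho> im(1)])
      show "\<forall>w\<in>U. ?J (\<rho> k w) \<noteq> 0" using im(2) by blast
    qed
    then show ?thesis
      by (rule continuous_on_cong[THEN iffD1, rotated 2]) (simp_all add: fibre_sum_local_inverses[OF U(2)])
  qed
  obtain r where r: "r > 0" "cball w r \<subseteq> regular"
    using w open_regular open_contains_cball by blast
  have K: "compact {z\<in>D. p z \<in> cball w r}"
    by (rule compact_preimage) (use r in \<open>auto simp: regular_def\<close>)
  have ev: "eventually (\<lambda>l. (LINT \<zeta>:regular|lebesgue. fibre_sum g \<zeta> * of_real (bump l (\<zeta> - w))) = mtrace D p g l w) at_top"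
    using eventually_gt_at_top[of "1 / r\<^sup>2"]
  proof eventually_elim
    case (elim l)
    have l: "1 < l * r\<^sup>2" using elim r(1) by (simp add: pos_divide_less_eq)
    let ?q = "\<lambda>z. g z * cnj (?J z) * of_real (bump l (p z - w))"
    define s where "s = (\<lambda>z. g z / ?J z * of_real (bump l (p z - w)))"
    have int: "set_integrable lborel D ?q"
      by (rule mtrace_set_integrable[OF open_D p_holo g K r(1) l])
    then have intl: "set_integrable lebesgue D ?q"
      unfolding set_integrable_def by (subst integrable_completion) auto
    have sq: "(cmod (?J z))\<^sup>2 *\<^sub>R s z = ?q z" if "z \<in> noncrit" for z
    proof -
      have "?J z \<noteq> 0" using that noncrit_iff by blast
      then show ?thesis
        by (simp add: s_def scaleR_conv_of_real complex_norm_square del: of_real_power)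
    qed
    have ints: "set_integrable lebesgue noncrit (\<lambda>z. (cmod (?J z))\<^sup>2 *\<^sub>R s z)"
    proof -
      have "set_integrable lebesgue noncrit ?q"
        using intl by (rule set_integrable_subset) (auto simp: noncrit_def open_noncrit[unfolded noncrit_def])
      then show ?thesis
        by (rule set_integrable_cong[THEN iffD1, rotated 3]) (use sq in auto)
    qed
    have "mtrace D p g l w = (LINT z:D|lebesgue. ?q z)"
      unfolding mtrace_def set_lebesgue_integral_def
      by (rule integral_completion[symmetric]) (rule borel_measurable_integrable[OF int[unfolded set_integrable_def]])
    also have "\<dots> = (LINT z:noncrit|lebesgue. (cmod (?J z))\<^sup>2 *\<^sub>R s z)"
      unfolding set_lebesgue_integral_def
    proof (rule Bochner_Integration.integral_cong[OF refl])
      fix z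
      \<comment> \<open>At critical points the factor \<open>cnj (?J z)\<close> vanishes, so passing
        from \<open>D\<close> to \<open>noncrit\<close> loses nothing.\<close>
      show "indicator D z *\<^sub>R ?q z = indicator noncrit z *\<^sub>R ((cmod (?J z))\<^sup>2 *\<^sub>R s z)"
      proof (cases "z \<in> noncrit")
        case True
        then show ?thesis using sq[OF True] by (simp add: noncrit_def)
      next
        case False
        then show ?thesis using noncrit_iff[of z] by (cases "z \<in> D") auto
      qed
    qed
    also have "\<dots> = (LINT \<zeta>:regular|lebesgue. \<Sum>z | z \<in> D \<and> p z = \<zeta>. s z)"
      by (rule fibre_integral(2)[OF ints, symmetric])
    also have "\<dots> = (LINT \<zeta>:regular|lebesgue. fibre_sum g \<zeta> * of_real (bump l (\<zeta> - w)))"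
    proof -
      have "(\<Sum>z | z \<in> D \<and> p z = \<zeta>. s z) = fibre_sum g \<zeta> * of_real (bump l (\<zeta> - w))" for \<zeta>
        unfolding fibre_sum_def sum_distrib_right s_def by (rule sum.cong) auto
      then show ?thesis by simp
    qed
    finally show ?case by simp
  qed
  show ?thesis
    by (rule Lim_transform_eventually[OF approximate_identity[OF oU(1) U(1) oU(2) cont] ev])
qed

text \<open>The parameters \<open>l\<close> that work at \<open>w\<close> depend on the distance of
  \<open>w\<close> to the boundary of \<open>G\<close>. The limit in \<open>l\<close> is globally
  defined, and near each point it is eventually constant, equal to one holomorphic mollified
  trace.\<close>

lemma trace_extension:
  assumes g: "holomorphic_fun_on g D"
  obtains F where "holomorphic_fun_on F G" "\<And>w. w \<in> regular \<Longrightarrow> F w = fibre_sum g w"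
    "\<And>w. w \<notin> G \<Longrightarrow> F w = 0"
proof -
  let ?c = "complex_of_real (bump_mass TYPE('n))"
  have c: "?c \<noteq> 0" using bump_mass_pos[where 'n = 'n] by simp
  define F where "F = (\<lambda>w. if w \<in> G then Lim at_top (\<lambda>l. mtrace D p g l w) / ?c else 0)"
  have loc: "\<exists>r>0. \<exists>l. ball w0 r \<subseteq> G \<and> (\<forall>w\<in>ball w0 r. Lim at_top (\<lambda>l. mtrace D p g l w) = mtrace D p g l w)
      \<and> holomorphic_fun_on (mtrace D p g l) (ball w0 r)" if w0: "w0 \<in> G" for w0
  proof -
    obtain R where R: "R > 0" "cball w0 R \<subseteq> G"
      using open_contains_cball[THEN iffD1, OF open_G, rule_format, OF w0] by blast
    \<comment> \<open>One half of \<open>R\<close> bounds the bump, the other half is the radius of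
      the ball of centres.\<close>
    define r where "r = R / 2"
    have r: "r > 0" "R - r = r" using R(1) by (simp_all add: r_def)
    define l where "l = 2 / r\<^sup>2"
    have l: "1 < l * r\<^sup>2" using r(1) by (simp add: l_def)
    have K: "compact {z\<in>D. p z \<in> cball w0 R}" by (rule compact_preimage) (use R in auto)
    have "Lim at_top (\<lambda>l. mtrace D p g l w) = mtrace D p g l w" if w: "w \<in> ball w0 r" for w
    proof -
      have "cball w r \<subseteq> cball w0 R"
      proof
        fix x assume "x \<in> cball w r"
        then show "x \<in> cball w0 R" using w dist_triangle[of w0 x w] by (simp add: r_def)
      qed
      then have Kw: "compact {z\<in>D. p z \<in> cball w r}" by (intro compact_preimage) (use R in auto)
      have "eventually (\<lambda>l'. mtrace D p g l w = mtrace D p g l' w) at_top"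
        using eventually_gt_at_top[of "1 / r\<^sup>2"]
      proof eventually_elim
        case (elim l')
        then have "1 < l' * r\<^sup>2" using r(1) by (simp add: pos_divide_less_eq)
        then show ?case by (rule mtrace_parameter_independent[OF open_D p_holo g Kw r(1) l])
      qed
      then have "((\<lambda>l. mtrace D p g l w) \<longlongrightarrow> mtrace D p g l w) at_top"
        by (rule Lim_transform_eventually[OF tendsto_const])
      then show ?thesis by (rule tendsto_Lim[rotated]) simp
    qed
    moreover have "holomorphic_fun_on (mtrace D p g l) (ball w0 r)"
      using mtrace_holomorphic[OF open_D p_holo g K r(1) l] r(2) by simp
    moreover have "ball w0 r \<subseteq> G" using R r by (auto simp: r_def)
    ultimately show ?thesis using r(1) by (intro exI[of _ r] exI[of _ l] conjI ballI) simp_all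
  qed
  have "holomorphic_fun_on F G"
    unfolding holomorphic_fun_on_def
  proof
    fix w0 assume w0: "w0 \<in> G"
    obtain r l where rl: "r > 0" "ball w0 r \<subseteq> G"
      "\<And>w. w \<in> ball w0 r \<Longrightarrow> Lim at_top (\<lambda>l. mtrace D p g l w) = mtrace D p g l w"
      "holomorphic_fun_on (mtrace D p g l) (ball w0 r)" using loc[OF w0] by blast
    have "holomorphic_fun_on (\<lambda>w. mtrace D p g l w * (1 / ?c)) (ball w0 r)"
      by (rule holomorphic_fun_on_mult[OF rl(4) holomorphic_fun_on_const])
    then have "holomorphic_fun_on F (ball w0 r)"
      by (rule holomorphic_fun_on_transform) (use rl(2,3) in \<open>auto simp: F_def\<close>)
    then show "\<exists>f'. (F has_derivative f') (at w0) \<and> Vector_Spaces.linear (*s) (*) f'"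
      using rl(1) by (simp add: holomorphic_fun_on_def)
  qed
  moreover have "F w = fibre_sum g w" if w: "w \<in> regular" for w
  proof -
    have "Lim at_top (\<lambda>l. mtrace D p g l w) = fibre_sum g w * ?c"
      by (rule tendsto_Lim[OF _ mtrace_tendsto[OF g w]]) simp
    then show ?thesis using w c by (simp add: F_def regular_def)
  qed
  moreover have "F w = 0" if "w \<notin> G" for w using that by (simp add: F_def)
  ultimately show thesis using that by blast
qed

end

subsection \<open>Isometries with an adjoint between inner product spaces of functions\<close>

locale function_inner_product =
  fixes ip :: "('a \<Rightarrow> complex) \<Rightarrow> ('a \<Rightarrow> complex) \<Rightarrow> complex" and V :: "('a \<Rightarrow> complex) set"
  assumes zero_closed: "0 \<in> V"
    and add_closed: "\<And>f h. f \<in> V \<Longrightarrow> h \<in> V \<Longrightarrow> f + h \<in> V"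
    and scale_closed: "\<And>c f. f \<in> V \<Longrightarrow> fscale c f \<in> V"
    and add_left: "\<And>f g h. f \<in> V \<Longrightarrow> g \<in> V \<Longrightarrow> h \<in> V \<Longrightarrow> ip (f + g) h = ip f h + ip g h"
    and scale_left: "\<And>c f h. f \<in> V \<Longrightarrow> h \<in> V \<Longrightarrow> ip (fscale c f) h = c * ip f h"
    and conj_sym: "\<And>f h. f \<in> V \<Longrightarrow> h \<in> V \<Longrightarrow> ip h f = cnj (ip f h)"
    and nonneg: "\<And>f. f \<in> V \<Longrightarrow> 0 \<le> Re (ip f f)"
    and definite: "\<And>f. f \<in> V \<Longrightarrow> Re (ip f f) = 0 \<Longrightarrow> f = 0"
begin

lemma uminus_closed: "f \<in> V \<Longrightarrow> - f \<in> V"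
  using scale_closed[of f "-1"] by (simp add: fscale_def fun_Compl_def)

lemma diff_closed: "f \<in> V \<Longrightarrow> h \<in> V \<Longrightarrow> f - h \<in> V"
  using add_closed[of f "- h"] uminus_closed by simp

lemma uminus_left: "f \<in> V \<Longrightarrow> h \<in> V \<Longrightarrow> ip (- f) h = - ip f h"
  using scale_left[of f h "-1"] by (simp add: fscale_def fun_Compl_def)

lemma diff_left: "f \<in> V \<Longrightarrow> g \<in> V \<Longrightarrow> h \<in> V \<Longrightarrow> ip (f - g) h = ip f h - ip g h"
  using add_left[of f "- g" h] uminus_closed uminus_left by simp

lemma diff_right: "f \<in> V \<Longrightarrow> g \<in> V \<Longrightarrow> h \<in> V \<Longrightarrow> ip h (f - g) = ip h f - ip h g"
  using conj_sym[of "f - g" h] conj_sym[of f h] conj_sym[of g h] diff_closed diff_left by simp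

lemma eqI: "f \<in> V \<Longrightarrow> h \<in> V \<Longrightarrow> ip (f - h) (f - h) = 0 \<Longrightarrow> f = h"
  using definite[of "f - h"] diff_closed by simp

lemma Pythagoras:
  assumes "f \<in> V" "h \<in> V" "ip h f = 0"
  shows "Re (ip (f - h) (f - h)) = Re (ip f f) + Re (ip h h)"
proof -
  have "ip f h = 0" using conj_sym[OF assms(2,1)] assms(3) by simp
  then have "ip (f - h) (f - h) = ip f f + ip h h"
    using assms by (simp add: diff_left diff_right diff_closed)
  then show ?thesis by simp
qed

end

text \<open>With an explicit adjoint \<open>Q\<close> the projection is \<open>T (Q g)\<close>, so
  its existence is a matter of algebra.\<close>

locale isometry_with_adjoint =
  U: function_inner_product ip V + W: function_inner_product ip' W
  for ip :: "('a \<Rightarrow> complex) \<Rightarrow> ('a \<Rightarrow> complex) \<Rightarrow> complex" and V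
    and ip' :: "('b \<Rightarrow> complex) \<Rightarrow> ('b \<Rightarrow> complex) \<Rightarrow> complex" and W +
  fixes T :: "('a \<Rightarrow> complex) \<Rightarrow> ('b \<Rightarrow> complex)" and Q :: "('b \<Rightarrow> complex) \<Rightarrow> ('a \<Rightarrow> complex)"
  assumes linear: "linear_operator_on V W T"
    and isometric: "\<And>f h. f \<in> V \<Longrightarrow> h \<in> V \<Longrightarrow> ip' (T f) (T h) = ip f h"
    and adjoint_closed: "\<And>g. g \<in> W \<Longrightarrow> Q g \<in> V"
    and adjoint: "\<And>g h. g \<in> W \<Longrightarrow> h \<in> V \<Longrightarrow> ip' g (T h) = ip (Q g) h"
begin

lemma image_in: "f \<in> V \<Longrightarrow> T f \<in> W"
  using linear by (auto simp: linear_operator_on_def)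

lemma image_add: "f \<in> V \<Longrightarrow> h \<in> V \<Longrightarrow> T (f + h) = T f + T h"
  using linear by (auto simp: linear_operator_on_def)

lemma image_scale: "f \<in> V \<Longrightarrow> T (fscale c f) = fscale c (T f)"
  using linear by (auto simp: linear_operator_on_def)

lemma image_diff: "f \<in> V \<Longrightarrow> h \<in> V \<Longrightarrow> T (f - h) = T f - T h"
proof -
  assume "f \<in> V" "h \<in> V"
  then have "T (f + fscale (-1) h) = T f + fscale (-1) (T h)"
    by (simp add: image_add image_scale U.scale_closed)
  moreover have "f + fscale (-1) h = f - h" "T f + fscale (-1) (T h) = T f - T h"
    by (auto simp: fscale_def)
  ultimately show ?thesis by simp
qed

lemma norm_image: "f \<in> V \<Longrightarrow> ip_norm ip' (T f) = ip_norm ip f"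
  by (simp add: ip_norm_def isometric)

lemma inj: "inj_on T V"
proof (rule inj_onI)
  fix f h assume fh: "f \<in> V" "h \<in> V" "T f = T h"
  have "ip (f - h) (f - h) = ip' (T f - T h) (T f - T h)"
    using isometric[of "f - h" "f - h"] fh(1,2) by (simp add: image_diff U.diff_closed)
  also have "\<dots> = 0"
    using W.diff_left[of "T f" "T f" "T f - T h"] fh image_in W.zero_closed by simp
  finally show "f = h" using U.eqI fh by blast
qed

lemma isometric_isomorphism_image: "isometric_isomorphism ip V ip' (T ` V) T"
  using linear inj isometric unfolding isometric_isomorphism_def linear_operator_on_def
  by (auto simp: bij_betw_def)

lemma residual_orthogonal:
  assumes "g \<in> W" "h \<in> T ` V"
  shows "ip' (g - T (Q g)) h = 0"
proof -
  obtain h' where h': "h' \<in> V" "h = T h'" using assms(2) by blast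
  note Qg = adjoint_closed[OF assms(1)]
  have "ip' (g - T (Q g)) h = ip' g (T h') - ip' (T (Q g)) (T h')"
    unfolding h'(2) by (rule W.diff_left[OF assms(1) image_in[OF Qg] image_in[OF h'(1)]])
  also have "\<dots> = 0" by (simp add: adjoint[OF assms(1) h'(1)] isometric[OF Qg h'(1)])
  finally show ?thesis .
qed

lemma orthogonal_projection_adjoint: "orthogonal_projection ip' W (T ` V) (\<lambda>g. T (Q g))"
  using residual_orthogonal adjoint_closed by (auto simp: orthogonal_projection_def)

text \<open>The difference of two candidates lies in the image and is orthogonal to it, hence to
  itself.\<close>

lemma orthogonal_projection_unique:
  assumes P: "orthogonal_projection ip' W (T ` V) P" and g: "g \<in> W"
  shows "P g = T (Q g)"
proof -
  obtain f where f: "f \<in> V" "P g = T f" using P g by (auto simp: orthogonal_projection_def)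
  have PW: "P g \<in> W" "T (Q g) \<in> W" using f g image_in adjoint_closed by auto
  define d where "d = P g - T (Q g)"
  have "d = T (f - Q g)" using f g adjoint_closed by (simp add: d_def image_diff)
  then have d: "d \<in> T ` V" "d \<in> W" using f g adjoint_closed U.diff_closed image_in by auto
  have "ip' (g - P g) d = 0" using P g d(1) unfolding orthogonal_projection_def by blast
  moreover have "ip' (g - T (Q g)) d = 0" using residual_orthogonal g d(1) .
  moreover have "d = (g - T (Q g)) - (g - P g)" by (simp add: d_def)
  then have "ip' d d = ip' (g - T (Q g)) d - ip' (g - P g) d"
    using W.diff_left[OF W.diff_closed[OF g PW(2)] W.diff_closed[OF g PW(1)] d(2)] by simp
  ultimately have "ip' d d = 0" by simp
  then show ?thesis using W.eqI PW unfolding d_def by blast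
qed

text \<open>By Pythagoras no element of the image is closer to \<open>l\<close> than
  \<open>T (Q l)\<close>; if a sequence in the image tends to \<open>l\<close>, that distance is
  0.\<close>

lemma closed_subspace_image: "closed_subspace_of ip' W (T ` V)"
proof -
  have "module (fscale :: complex \<Rightarrow> ('b \<Rightarrow> complex) \<Rightarrow> _)"
    using vector_space_fscale by (simp add: module_iff_vector_space)
  note subspace_def = module.subspace_def[OF this]
  have "T 0 = 0" using image_diff[of 0 0] U.zero_closed by simp
  then have "0 \<in> T ` V" using U.zero_closed by force
  moreover have "x + y \<in> T ` V" if "x \<in> T ` V" "y \<in> T ` V" for x y
    using that U.add_closed by (auto simp flip: image_add)
  moreover have "fscale c x \<in> T ` V" if "x \<in> T ` V" for c x
    using that U.scale_closed by (auto simp flip: image_scale)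
  ultimately have "module.subspace fscale (T ` V)"
    by (simp add: subspace_def)
  moreover have "T ` V \<subseteq> W" using image_in by blast
  moreover have "l \<in> T ` V"
    if l: "l \<in> W" and f: "range f \<subseteq> T ` V" and lim: "(\<lambda>k. ip_norm ip' (f k - l)) \<longlonglongrightarrow> 0"
    for f :: "nat \<Rightarrow> 'b \<Rightarrow> complex" and l
  proof -
    define d where "d = l - T (Q l)"
    have Tl: "Q l \<in> V" "T (Q l) \<in> W" using l adjoint_closed image_in by auto
    have d: "d \<in> W" using l Tl W.diff_closed by (simp add: d_def)
    have "Re (ip' d d) \<le> Re (ip' (f k - l) (f k - l))" for k
    proof -
      have "f k \<in> T ` V" using f by blast
      then obtain h where h: "h \<in> V" "f k = T h" by blast
      have e: "f k - T (Q l) = T (h - Q l)" using h Tl by (simp add: image_diff)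
      then have "f k - T (Q l) \<in> T ` V" "f k - T (Q l) \<in> W"
        using h Tl U.diff_closed image_in by auto
      moreover have "ip' d (f k - T (Q l)) = 0"
        unfolding d_def by (rule residual_orthogonal[OF l calculation(1)])
      ultimately have "Re (ip' (f k - T (Q l) - d) (f k - T (Q l) - d))
          = Re (ip' (f k - T (Q l)) (f k - T (Q l))) + Re (ip' d d)" "0 \<le> Re (ip' (f k - T (Q l)) (f k - T (Q l)))"
        using d W.Pythagoras W.nonneg by blast+
      moreover have "f k - T (Q l) - d = f k - l" by (simp add: d_def)
      ultimately show ?thesis by simp
    qed
    then have "sqrt (Re (ip' d d)) \<le> ip_norm ip' (f k - l)" for k
      by (simp add: ip_norm_def)
    then have "sqrt (Re (ip' d d)) \<le> 0"
      using lim by (intro LIMSEQ_le_const) auto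
    then have "Re (ip' d d) = 0" using W.nonneg[OF d] by simp
    then have "d = 0" using W.definite[OF d] by simp
    then show ?thesis using Tl by (auto simp: d_def)
  qed
  ultimately show ?thesis unfolding closed_subspace_of_def by blast
qed

lemma complete_image:
  assumes "ip_complete ip V"
  shows "ip_complete ip' (T ` V)"
  unfolding ip_complete_def
proof (intro allI impI, elim conjE)
  fix f :: "nat \<Rightarrow> 'b \<Rightarrow> complex"
  assume f: "range f \<subseteq> T ` V" and cau: "\<forall>e>0. \<exists>N. \<forall>i\<ge>N. \<forall>j\<ge>N. ip_norm ip' (f i - f j) < e"
  have "\<exists>h. h \<in> V \<and> f k = T h" for k using f by (metis imageE range_subsetD)
  then obtain h where h: "\<And>k. h k \<in> V" "\<And>k. f k = T (h k)" by metis
  have n: "ip_norm ip' (f i - T l) = ip_norm ip (h i - l)" if "l \<in> V" for i l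
    using norm_image[of "h i - l"] h that by (simp add: image_diff U.diff_closed)
  have "ip_norm ip' (f i - f j) = ip_norm ip (h i - h j)" for i j
    using n[OF h(1)] h(2) by simp
  then have "range h \<subseteq> V \<and> (\<forall>e>0. \<exists>N. \<forall>i\<ge>N. \<forall>j\<ge>N. ip_norm ip (h i - h j) < e)"
    using cau h(1) by auto
  then obtain l where "l \<in> V" "(\<lambda>k. ip_norm ip (h k - l)) \<longlonglongrightarrow> 0"
    using assms[unfolded ip_complete_def, rule_format, of h] by blast
  then show "\<exists>l\<in>T ` V. (\<lambda>k. ip_norm ip' (f k - l)) \<longlonglongrightarrow> 0"
    using n by auto
qed

end

subsection \<open>The weighted Bergman inner product\<close>

text \<open>The bound is |f| |h| <= |f|^2 + |h|^2 under the weight. The weight will also be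
  \<open>\<phi> \<circ> p\<close>, with \<open>\<phi>\<close> merely Lebesgue measurable, so
  measurability is drawn from the integrability of
  \<open>(cmod (f z))\<^sup>2 * \<psi> z\<close>.\<close>

lemma bergman_product_integrable:
  fixes S :: "(complex^'n) set"
  assumes S: "open S" and pos: "\<And>z. z \<in> S \<Longrightarrow> 0 < \<psi> z" and f: "f \<in> bergman S \<psi>" and h: "h \<in> bergman S \<psi>"
  shows "integrable (lebesgue_on S) (\<lambda>z. f z * cnj (h z) * complex_of_real (\<psi> z))"
proof (rule Bochner_Integration.integrable_bound)
  have meas: "g \<in> borel_measurable (lebesgue_on S)" if "g \<in> bergman S \<psi>" for g
    using that S by (intro continuous_imp_measurable_on_sets_lebesgue holomorphic_fun_on_imp_continuous_on)
      (auto simp: bergman_def)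
  have int: "integrable (lebesgue_on S) (\<lambda>z. (cmod (g z))\<^sup>2 * \<psi> z)" if "g \<in> bergman S \<psi>" for g
    using that by (simp add: bergman_def)
  show "integrable (lebesgue_on S) (\<lambda>z. (cmod (f z))\<^sup>2 * \<psi> z + (cmod (h z))\<^sup>2 * \<psi> z)"
    using int f h by simp
  have fh: "f \<in> borel_measurable (lebesgue_on S)" "h \<in> borel_measurable (lebesgue_on S)"
    "(\<lambda>z. (cmod (f z))\<^sup>2 * \<psi> z) \<in> borel_measurable (lebesgue_on S)"
    using meas int f h by auto
  \<comment> \<open>\<open>\<psi>\<close> alone need not be measurable where \<open>f\<close> vanishes; there both sides are 0.\<close>
  have eq: "f z * cnj (h z) * complex_of_real (\<psi> z)
      = complex_of_real ((cmod (f z))\<^sup>2 * \<psi> z) * (f z * cnj (h z) / of_real ((cmod (f z))\<^sup>2))" for z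
    by (cases "f z = 0") (simp_all del: of_real_power)
  show "(\<lambda>z. f z * cnj (h z) * complex_of_real (\<psi> z)) \<in> borel_measurable (lebesgue_on S)"
    unfolding eq
  proof (intro borel_measurable_times borel_measurable_divide fh(1))
    show "(\<lambda>z. cnj (h z)) \<in> borel_measurable (lebesgue_on S)"
      by (rule measurable_compose[OF fh(2) borel_measurable_continuous_onI]) (intro continuous_intros)
    have r: "(\<lambda>z. complex_of_real (u z)) \<in> borel_measurable (lebesgue_on S)"
      if "u \<in> borel_measurable (lebesgue_on S)" for u
      by (rule measurable_compose[OF that borel_measurable_continuous_onI]) (intro continuous_intros)
    show "(\<lambda>z. complex_of_real ((cmod (f z))\<^sup>2 * \<psi> z)) \<in> borel_measurable (lebesgue_on S)"
      by (rule r[OF fh(3)])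
    show "(\<lambda>z. complex_of_real ((cmod (f z))\<^sup>2)) \<in> borel_measurable (lebesgue_on S)"
      by (rule r) (use fh(1) in measurable)
  qed
  show "AE z in lebesgue_on S. norm (f z * cnj (h z) * complex_of_real (\<psi> z))
      \<le> norm ((cmod (f z))\<^sup>2 * \<psi> z + (cmod (h z))\<^sup>2 * \<psi> z)"
  proof (rule AE_I2)
    fix z assume "z \<in> space (lebesgue_on S)"
    then have p: "0 < \<psi> z" using pos by simp
    have "0 \<le> (cmod (f z) - cmod (h z))\<^sup>2" by simp
    then have "cmod (f z) * cmod (h z) \<le> (cmod (f z))\<^sup>2 + (cmod (h z))\<^sup>2"
      using mult_nonneg_nonneg[OF norm_ge_zero[of "f z"] norm_ge_zero[of "h z"]]
      unfolding power2_diff by linarith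
    then have "cmod (f z) * cmod (h z) * \<psi> z \<le> ((cmod (f z))\<^sup>2 + (cmod (h z))\<^sup>2) * \<psi> z"
      using p by (intro mult_right_mono) auto
    then show "norm (f z * cnj (h z) * complex_of_real (\<psi> z))
        \<le> norm ((cmod (f z))\<^sup>2 * \<psi> z + (cmod (h z))\<^sup>2 * \<psi> z)"
      using p by (simp add: norm_mult distrib_right)
  qed
qed

text \<open>Definiteness is the substantial point: a member of norm 0 vanishes almost everywhere on
  \<open>S\<close>, so its nonzero set is open and null, hence empty; off \<open>S\<close> members
  are zero by convention.\<close>

lemma function_inner_product_bergman:
  fixes S :: "(complex^'n) set"
  assumes S: "open S" and pos: "\<And>z. z \<in> S \<Longrightarrow> 0 < \<psi> z"
  shows "function_inner_product (bergman_inner S \<psi>) (bergman S \<psi>)"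
proof
  have int: "integrable (lebesgue_on S) (\<lambda>z. f z * cnj (h z) * complex_of_real (\<psi> z))"
    if "f \<in> bergman S \<psi>" "h \<in> bergman S \<psi>" for f h
    by (rule bergman_product_integrable[OF S pos that])
  have sq: "f z * cnj (f z) * complex_of_real (\<psi> z) = of_real ((cmod (f z))\<^sup>2 * \<psi> z)" for f :: "complex^'n \<Rightarrow> complex" and z
    by (simp add: complex_norm_square del: of_real_power)
  have ipsq: "bergman_inner S \<psi> f f = of_real (\<integral>z. (cmod (f z))\<^sup>2 * \<psi> z \<partial>lebesgue_on S)" for f
    unfolding bergman_inner_def sq by (rule integral_complex_of_real)
  show "0 \<in> bergman S \<psi>"
    using holomorphic_fun_on_const[of 0 S] by (simp add: bergman_def zero_fun_def)
  show "fscale c f \<in> bergman S \<psi>" if f: "f \<in> bergman S \<psi>" for c f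
    using f holomorphic_fun_on_mult[OF holomorphic_fun_on_const[of c S], of f]
      integrable_mult_right[of "(cmod c)\<^sup>2" "lebesgue_on S" "\<lambda>z. (cmod (f z))\<^sup>2 * \<psi> z"]
    by (simp add: bergman_def fscale_def norm_mult power_mult_distrib mult.assoc)
  show "f + h \<in> bergman S \<psi>" if f: "f \<in> bergman S \<psi>" and h: "h \<in> bergman S \<psi>" for f h
  proof -
    have "(cmod ((f + h) z))\<^sup>2 * \<psi> z
        = (cmod (f z))\<^sup>2 * \<psi> z + (cmod (h z))\<^sup>2 * \<psi> z + 2 * Re (f z * cnj (h z) * complex_of_real (\<psi> z))" for z
      unfolding cmod_power2 by (simp add: power2_eq_square algebra_simps)
    moreover have "integrable (lebesgue_on S) (\<lambda>z. (cmod (f z))\<^sup>2 * \<psi> z + (cmod (h z))\<^sup>2 * \<psi> z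
        + 2 * Re (f z * cnj (h z) * complex_of_real (\<psi> z)))"
      using f h int[OF f h] by (intro Bochner_Integration.integrable_add integrable_mult_right integrable_Re)
        (auto simp: bergman_def)
    ultimately have "integrable (lebesgue_on S) (\<lambda>z. (cmod ((f + h) z))\<^sup>2 * \<psi> z)" by simp
    then show ?thesis
      using f h holomorphic_fun_on_add[of f S h] by (simp add: bergman_def plus_fun_def)
  qed
  show "bergman_inner S \<psi> (f + g) h = bergman_inner S \<psi> f h + bergman_inner S \<psi> g h"
    if "f \<in> bergman S \<psi>" "g \<in> bergman S \<psi>" "h \<in> bergman S \<psi>" for f g h
    using Bochner_Integration.integral_add[OF int[OF that(1,3)] int[OF that(2,3)]]
    by (simp add: bergman_inner_def distrib_right)
  show "bergman_inner S \<psi> (fscale c f) h = c * bergman_inner S \<psi> f h" for c f h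
    by (simp add: bergman_inner_def fscale_def mult.assoc)
  show "bergman_inner S \<psi> h f = cnj (bergman_inner S \<psi> f h)" for f h
    unfolding bergman_inner_def by (subst Bochner_Integration.integral_cnj[symmetric]) (simp add: mult_ac)
  show "0 \<le> Re (bergman_inner S \<psi> f f)" for f
    unfolding ipsq Re_complex_of_real
    by (intro Bochner_Integration.integral_nonneg_AE AE_I2) (simp add: less_imp_le pos)
  show "f = 0" if f: "f \<in> bergman S \<psi>" and 0: "Re (bergman_inner S \<psi> f f) = 0" for f
  proof -
    have "(\<integral>z. (cmod (f z))\<^sup>2 * \<psi> z \<partial>lebesgue_on S) = 0" using 0 unfolding ipsq by simp
    moreover have "integrable (lebesgue_on S) (\<lambda>z. (cmod (f z))\<^sup>2 * \<psi> z)" using f by (simp add: bergman_def)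
    moreover have "AE z in lebesgue_on S. 0 \<le> (cmod (f z))\<^sup>2 * \<psi> z"
      by (rule AE_I2) (simp add: less_imp_le pos)
    ultimately have "AE z in lebesgue_on S. (cmod (f z))\<^sup>2 * \<psi> z = 0"
      by (simp add: integral_nonneg_eq_0_iff_AE)
    then have "AE z in lebesgue. z \<in> S \<longrightarrow> (cmod (f z))\<^sup>2 * \<psi> z = 0"
      using S by (subst (asm) AE_restrict_space_iff) auto
    then have ae: "AE z in lebesgue. z \<notin> {z\<in>S. f z \<noteq> 0}"
      by eventually_elim (use pos in force)
    have "open {z\<in>S. f z \<noteq> 0}"
    proof -
      have "open (S \<inter> f -` (- {0}))"
        using f S by (intro continuous_open_preimage holomorphic_fun_on_imp_continuous_on) (auto simp: bergman_def)
      then show ?thesis by (simp add: vimage_def Int_def)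
    qed
    moreover from this have "{z\<in>S. f z \<noteq> 0} \<in> null_sets lebesgue"
      using ae by (subst AE_iff_null_sets) auto
    ultimately have "{z\<in>S. f z \<noteq> 0} = {}"
      using open_not_negligible by (auto simp: negligible_iff_null_sets)
    moreover have "f z = 0" if "z \<notin> S" for z using f that by (simp add: bergman_def)
    ultimately show ?thesis by fastforce
  qed
qed

subsection \<open>The adjoint of the isometry\<close>

lemma integrable_lebesgue_on_iff:
  fixes f :: "'a::euclidean_space \<Rightarrow> 'b::{banach, second_countable_topology}"
  shows "S \<in> sets lebesgue \<Longrightarrow> integrable (lebesgue_on S) f \<longleftrightarrow> set_integrable lebesgue S f"
  by (simp add: integrable_restrict_space set_integrable_def)

lemma integral_lebesgue_on_eq:
  fixes f :: "'a::euclidean_space \<Rightarrow> 'b::{banach, second_countable_topology}"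
  shows "S \<in> sets lebesgue \<Longrightarrow> (\<integral>x. f x \<partial>lebesgue_on S) = (LINT x:S|lebesgue. f x)"
  by (simp add: integral_restrict_space set_lebesgue_integral_def)

locale weighted_proper_hol = proper_hol D G p m
  for D G :: "(complex^'n) set" and p m +
  fixes \<phi> :: "complex^'n \<Rightarrow> real"
  assumes \<phi>: "Linf_loc_pos G \<phi>"
begin

lemma sets_D [measurable]: "D \<in> sets lebesgue" and sets_G [measurable]: "G \<in> sets lebesgue"
  using open_D open_G by auto

lemma weight_pos: "w \<in> G \<Longrightarrow> 0 < \<phi> w" "z \<in> D \<Longrightarrow> 0 < (\<phi> \<circ> p) z"
  using \<phi> p_in by (auto simp: Linf_loc_pos_def)

lemma weight_measurable: "\<phi> \<in> borel_measurable (lebesgue_on G)"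
  using \<phi> by (simp add: Linf_loc_pos_def)

abbreviation "A_G \<equiv> bergman G \<phi>"
abbreviation "A_D \<equiv> bergman D (\<phi> \<circ> p)"
abbreviation "\<Gamma> \<equiv> Gamma_op D p m"
abbreviation "J \<equiv> cjacobian p"
abbreviation "c \<equiv> 1 / complex_of_real (sqrt (real m))"

lemma c_square: "c * c = 1 / of_nat m" "cnj c = c"
proof -
  have "c * c = 1 / complex_of_real (sqrt (real m) * sqrt (real m))"
    by (simp only: of_real_mult) simp
  then show "c * c = 1 / of_nat m" by simp
qed simp

lemma regular_subset: "regular \<subseteq> G" and noncrit_subset: "noncrit \<subseteq> D"
  by (auto simp: regular_def noncrit_def)

lemma
  assumes "\<And>z. z \<in> D \<Longrightarrow> J z = 0 \<Longrightarrow> t z = (0::complex)"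
  shows set_integrable_noncrit_iff: "set_integrable lebesgue noncrit t \<longleftrightarrow> set_integrable lebesgue D t"
    and set_integral_noncrit: "(LINT z:noncrit|lebesgue. t z) = (LINT z:D|lebesgue. t z)"
proof -
  have "indicator noncrit z *\<^sub>R t z = indicator D z *\<^sub>R t z" for z
    using assms[of z] noncrit_iff[of z] by (auto simp: indicator_def)
  then show "set_integrable lebesgue noncrit t \<longleftrightarrow> set_integrable lebesgue D t"
    "(LINT z:noncrit|lebesgue. t z) = (LINT z:D|lebesgue. t z)"
    by (simp_all only: set_integrable_def set_lebesgue_integral_def)
qed

lemma set_integral_regular:
  fixes u :: "complex^'n \<Rightarrow> complex"
  assumes "set_integrable lebesgue G u"
  shows "(LINT w:regular|lebesgue. u w) = (LINT w:G|lebesgue. u w)"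
  unfolding set_lebesgue_integral_def
proof (rule integral_cong_AE)
  have "set_integrable lebesgue regular u"
    by (rule set_integrable_subset[OF assms regular_lebesgue regular_subset])
  then show "(\<lambda>w. indicator regular w *\<^sub>R u w) \<in> borel_measurable lebesgue"
    unfolding set_integrable_def by (rule borel_measurable_integrable)
  show "(\<lambda>w. indicator G w *\<^sub>R u w) \<in> borel_measurable lebesgue"
    using assms unfolding set_integrable_def by (rule borel_measurable_integrable)
  show "AE w in lebesgue. indicator regular w *\<^sub>R u w = indicator G w *\<^sub>R u w"
    using AE_regular by eventually_elim (use regular_subset in \<open>auto simp: indicator_def\<close>)
qed

text \<open>The function \<open>u (p z)\<close> is constant on fibres, so its sum over a regular
  fibre is \<open>m\<close> times the value of \<open>u\<close>.\<close>

lemma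
  fixes u :: "complex^'n \<Rightarrow> complex"
  assumes u: "set_integrable lebesgue G u"
  shows pullback_integrable: "set_integrable lebesgue D (\<lambda>z. (cmod (J z))\<^sup>2 *\<^sub>R u (p z))"
    and pullback_integral: "(LINT z:D|lebesgue. (cmod (J z))\<^sup>2 *\<^sub>R u (p z)) = of_nat m * (LINT w:G|lebesgue. u w)"
proof -
  have z: "(cmod (J z))\<^sup>2 *\<^sub>R u (p z) = 0" if "J z = 0" for z using that by simp
  have int: "set_integrable lebesgue noncrit (\<lambda>z. (cmod (J z))\<^sup>2 *\<^sub>R u (p z))"
    by (rule set_integrable_pullback[OF u])
  show "set_integrable lebesgue D (\<lambda>z. (cmod (J z))\<^sup>2 *\<^sub>R u (p z))"
    by (rule set_integrable_noncrit_iff[THEN iffD1, OF z int])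
  have "(LINT z:D|lebesgue. (cmod (J z))\<^sup>2 *\<^sub>R u (p z)) = (LINT z:noncrit|lebesgue. (cmod (J z))\<^sup>2 *\<^sub>R u (p z))"
    by (rule set_integral_noncrit[OF z, symmetric])
  also have "\<dots> = (LINT w:regular|lebesgue. \<Sum>z | z \<in> D \<and> p z = w. u (p z))"
    by (rule fibre_integral(2)[OF int, symmetric])
  also have "\<dots> = (LINT w:regular|lebesgue. of_nat m * u w)"
  proof (rule set_lebesgue_integral_cong[OF regular_lebesgue], intro allI impI)
    fix w assume w: "w \<in> regular"
    have "(\<Sum>z | z \<in> D \<and> p z = w. u (p z)) = (\<Sum>z | z \<in> D \<and> p z = w. u w)" by (rule sum.cong) auto
    also have "\<dots> = of_nat m * u w" using regular_fibre(2)[OF w] by simp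
    finally show "(\<Sum>z | z \<in> D \<and> p z = w. u (p z)) = of_nat m * u w" .
  qed
  also have "\<dots> = of_nat m * (LINT w:regular|lebesgue. u w)" by (rule set_integral_mult_right)
  finally show "(LINT z:D|lebesgue. (cmod (J z))\<^sup>2 *\<^sub>R u (p z)) = of_nat m * (LINT w:G|lebesgue. u w)"
    using set_integral_regular[OF u] by simp
qed

lemma product_set_integrable:
  assumes "f \<in> A_G" "h \<in> A_G"
  shows "set_integrable lebesgue G (\<lambda>w. f w * cnj (h w) * of_real (\<phi> w))"
  using bergman_product_integrable[OF open_G weight_pos(1) assms]
  by (simp add: integrable_lebesgue_on_iff sets_G)

lemma Gamma_product:
  assumes "z \<in> D"
  shows "\<Gamma> f z * cnj (\<Gamma> h z) * of_real ((\<phi> \<circ> p) z)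
    = (1 / of_nat m) * ((cmod (J z))\<^sup>2 *\<^sub>R (f (p z) * cnj (h (p z)) * of_real (\<phi> (p z))))"
proof -
  have "\<Gamma> f z * cnj (\<Gamma> h z) * of_real ((\<phi> \<circ> p) z)
    = (c * cnj c) * ((J z * cnj (J z)) * (f (p z) * cnj (h (p z)) * of_real (\<phi> (p z))))"
    using assms by (simp add: Gamma_op_def)
  also have "c * cnj c = 1 / of_nat m" using c_square by simp
  also have "J z * cnj (J z) = of_real ((cmod (J z))\<^sup>2)" by (rule complex_norm_square[symmetric])
  finally show ?thesis by (simp add: scaleR_conv_of_real)
qed

lemma Gamma_closed:
  assumes f: "f \<in> A_G"
  shows "\<Gamma> f \<in> A_D"
proof -
  have "holomorphic_fun_on (\<lambda>z. c * f (p z) * J z) D"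
    using f p_in by (intro holomorphic_fun_on_mult holomorphic_fun_on_const holomorphic_cjacobian p_holo open_D
        holomorphic_fun_on_compose[OF p_holo]) (auto simp: bergman_def)
  then have "holomorphic_fun_on (\<Gamma> f) D"
    by (rule holomorphic_fun_on_transform[OF _ open_D]) (simp add: Gamma_op_def)
  moreover have "set_integrable lebesgue D (\<lambda>z. (1 / of_nat m) * ((cmod (J z))\<^sup>2 *\<^sub>R (f (p z) * cnj (f (p z)) * of_real (\<phi> (p z)))))"
    by (intro set_integrable_mult_right pullback_integrable[OF product_set_integrable[OF f f]])
  then have "integrable (lebesgue_on D) (\<lambda>z. (1 / of_nat m) * ((cmod (J z))\<^sup>2 *\<^sub>R (f (p z) * cnj (f (p z)) * of_real (\<phi> (p z)))))"
    by (simp only: integrable_lebesgue_on_iff[OF sets_D])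
  then have "integrable (lebesgue_on D) (\<lambda>z. \<Gamma> f z * cnj (\<Gamma> f z) * of_real ((\<phi> \<circ> p) z))"
    by (rule Bochner_Integration.integrable_cong[THEN iffD1, OF refl, rotated])
       (subst Gamma_product, simp_all)
  then have "integrable (lebesgue_on D) (\<lambda>z. complex_of_real ((cmod (\<Gamma> f z))\<^sup>2 * (\<phi> \<circ> p) z))"
    by (simp only: complex_norm_square of_real_mult)
  ultimately show ?thesis
    unfolding bergman_def complex_of_real_integrable_eq by (simp add: Gamma_op_def)
qed

lemma Gamma_isometric:
  assumes "f \<in> A_G" "h \<in> A_G"
  shows "bergman_inner D (\<phi> \<circ> p) (\<Gamma> f) (\<Gamma> h) = bergman_inner G \<phi> f h"
proof -
  note u = product_set_integrable[OF assms]
  have "bergman_inner D (\<phi> \<circ> p) (\<Gamma> f) (\<Gamma> h)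
      = (LINT z:D|lebesgue. \<Gamma> f z * cnj (\<Gamma> h z) * of_real ((\<phi> \<circ> p) z))"
    unfolding bergman_inner_def by (rule integral_lebesgue_on_eq[OF sets_D])
  also have "\<dots> = (LINT z:D|lebesgue. (1 / of_nat m) * ((cmod (J z))\<^sup>2 *\<^sub>R (f (p z) * cnj (h (p z)) * of_real (\<phi> (p z)))))"
    by (rule set_lebesgue_integral_cong[OF sets_D]) (intro allI impI Gamma_product)
  also have "\<dots> = (1 / of_nat m) * (of_nat m * (LINT w:G|lebesgue. f w * cnj (h w) * of_real (\<phi> w)))"
    by (simp only: set_integral_mult_right pullback_integral[OF u])
  also have "\<dots> = (LINT w:G|lebesgue. f w * cnj (h w) * of_real (\<phi> w))"
    using multiplicity_pos by simp
  also have "\<dots> = bergman_inner G \<phi> f h"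
    unfolding bergman_inner_def by (rule integral_lebesgue_on_eq[OF sets_G, symmetric])
  finally show ?thesis .
qed

lemma Gamma_linear: "linear_operator_on A_G A_D \<Gamma>"
  using Gamma_closed by (auto simp: linear_operator_on_def Gamma_op_def fscale_def fun_eq_iff algebra_simps)

text \<open>\<open>trace_extension\<close> justifies \<open>SOME\<close> for members of
  \<open>A_D\<close>; the value 0 off \<open>G\<close> matches the representation used in
  \<open>bergman\<close>.\<close>

definition "fibre_trace g = (SOME F. holomorphic_fun_on F G \<and> (\<forall>w\<in>regular. F w = fibre_sum g w) \<and> (\<forall>w. w \<notin> G \<longrightarrow> F w = 0))"

lemma fibre_trace:
  assumes "g \<in> A_D"
  shows "holomorphic_fun_on (fibre_trace g) G" "\<And>w. w \<in> regular \<Longrightarrow> fibre_trace g w = fibre_sum g w"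
    "\<And>w. w \<notin> G \<Longrightarrow> fibre_trace g w = 0"
proof -
  have "holomorphic_fun_on g D" using assms by (simp add: bergman_def)
  then have "\<exists>F. holomorphic_fun_on F G \<and> (\<forall>w\<in>regular. F w = fibre_sum g w) \<and> (\<forall>w. w \<notin> G \<longrightarrow> F w = 0)"
    by (rule trace_extension) blast
  from someI_ex[OF this, folded fibre_trace_def]
  show "holomorphic_fun_on (fibre_trace g) G" "\<And>w. w \<in> regular \<Longrightarrow> fibre_trace g w = fibre_sum g w"
    "\<And>w. w \<notin> G \<Longrightarrow> fibre_trace g w = 0" by blast+
qed

text \<open>Cauchy-Schwarz against the constant 1 on a fibre of \<open>m\<close> points; this is the
  source of the square integrability of the trace.\<close>

lemma fibre_sum_square_le:
  assumes w: "w \<in> regular"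
  shows "(cmod (fibre_sum g w))\<^sup>2 \<le> real m * (\<Sum>z | z \<in> D \<and> p z = w. (cmod (g z / J z))\<^sup>2)"
proof -
  let ?A = "{z. z \<in> D \<and> p z = w}" and ?a = "\<lambda>z. cmod (g z / J z)"
  have "cmod (fibre_sum g w) \<le> (\<Sum>z\<in>?A. ?a z)" unfolding fibre_sum_def by (rule norm_sum)
  then have "(cmod (fibre_sum g w))\<^sup>2 \<le> (\<Sum>z\<in>?A. 1 * ?a z)\<^sup>2" by (simp add: power_mono)
  also have "\<dots> \<le> (\<Sum>z\<in>?A. 1\<^sup>2) * (\<Sum>z\<in>?A. (?a z)\<^sup>2)" by (rule Cauchy_Schwarz_ineq_sum)
  also have "(\<Sum>z\<in>?A. 1\<^sup>2) = real m" using regular_fibre(2)[OF w] by simp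
  finally show ?thesis .
qed

lemma fibre_trace_closed:
  assumes g: "g \<in> A_D"
  shows "fibre_trace g \<in> A_G"
proof -
  let ?b = "\<lambda>w. \<Sum>z | z \<in> D \<and> p z = w. (cmod (g z / J z))\<^sup>2 * \<phi> (p z)"
  \<comment> \<open>Multiplied by \<open>(cmod (J z))\<^sup>2\<close> this is |g|^2 times the
    weight, integrable on \<open>D\<close>; \<open>fibre_integral\<close> then yields the integrable
    majorant on \<open>G\<close>.\<close>
  define s where "s = (\<lambda>z. complex_of_real ((cmod (g z / J z))\<^sup>2 * \<phi> (p z)))"
  have "integrable (lebesgue_on D) (\<lambda>z. (cmod (g z))\<^sup>2 * \<phi> (p z))" using g by (simp add: bergman_def)
  then have "set_integrable lebesgue D (\<lambda>z. complex_of_real ((cmod (g z))\<^sup>2 * \<phi> (p z)))"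
    by (simp only: integrable_lebesgue_on_iff[OF sets_D] set_integrable_complex_of_real)
  then have "set_integrable lebesgue noncrit (\<lambda>z. complex_of_real ((cmod (g z))\<^sup>2 * \<phi> (p z)))"
    by (rule set_integrable_subset[OF _ noncrit_lebesgue noncrit_subset])
  then have "set_integrable lebesgue noncrit (\<lambda>z. (cmod (J z))\<^sup>2 *\<^sub>R s z)"
    by (rule set_integrable_cong[THEN iffD1, OF refl refl, rotated])
       (auto simp: s_def scaleR_conv_of_real norm_divide power_divide noncrit_iff)
  from fibre_integral(1)[OF this] have "set_integrable lebesgue regular (\<lambda>w. complex_of_real (?b w))"
    by (simp only: s_def of_real_sum)
  then have "integrable lebesgue (\<lambda>w. complex_of_real (indicator regular w * ?b w))"
    by (simp only: set_integrable_def scaleR_conv_of_real of_real_mult)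
  then have "integrable lebesgue (\<lambda>w. indicator regular w * ?b w)"
    by (simp only: complex_of_real_integrable_eq)
  then have "integrable lebesgue (\<lambda>w. indicator G w *\<^sub>R (real m * (indicator regular w * ?b w)))"
    using sets_G by (intro integrable_mult_indicator integrable_mult_right)
  then have b: "integrable (lebesgue_on G) (\<lambda>w. real m * (indicator regular w * ?b w))"
    by (simp only: integrable_lebesgue_on_iff[OF sets_G] set_integrable_def)
  have "integrable (lebesgue_on G) (\<lambda>w. (cmod (fibre_trace g w))\<^sup>2 * \<phi> w)"
  proof (rule Bochner_Integration.integrable_bound[OF b])
    have "fibre_trace g \<in> borel_measurable (lebesgue_on G)"
      by (intro continuous_imp_measurable_on_sets_lebesgue holomorphic_fun_on_imp_continuous_on fibre_trace(1) g sets_G)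
    then show "(\<lambda>w. (cmod (fibre_trace g w))\<^sup>2 * \<phi> w) \<in> borel_measurable (lebesgue_on G)"
      using weight_measurable by measurable
    have "AE w in lebesgue. w \<in> G \<longrightarrow> norm ((cmod (fibre_trace g w))\<^sup>2 * \<phi> w) \<le> norm (real m * (indicator regular w * ?b w))"
      using AE_regular
    proof eventually_elim
      case (elim w)
      show ?case
      proof
        assume wG: "w \<in> G"
        then have w: "w \<in> regular" and \<phi>w: "0 < \<phi> w" using elim weight_pos(1) by auto
        have "(cmod (fibre_trace g w))\<^sup>2 * \<phi> w \<le> real m * (\<Sum>z | z \<in> D \<and> p z = w. (cmod (g z / J z))\<^sup>2) * \<phi> w"
          using fibre_sum_square_le[OF w, of g] \<phi>w fibre_trace(2)[OF g w] by (simp add: mult_right_mono)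
        also have "\<dots> = real m * ?b w"
        proof -
          have "?b w = (\<Sum>z | z \<in> D \<and> p z = w. (cmod (g z / J z))\<^sup>2 * \<phi> w)" by (rule sum.cong) auto
          then show ?thesis by (simp add: sum_distrib_right)
        qed
        finally show "norm ((cmod (fibre_trace g w))\<^sup>2 * \<phi> w) \<le> norm (real m * (indicator regular w * ?b w))"
          using w \<phi>w by simp
      qed
    qed
    then show "AE w in lebesgue_on G. norm ((cmod (fibre_trace g w))\<^sup>2 * \<phi> w) \<le> norm (real m * (indicator regular w * ?b w))"
      by (subst AE_restrict_space_iff) auto
  qed
  then show ?thesis using fibre_trace(1,3)[OF g] by (simp add: bergman_def)
qed

lemma bergman_G: "function_inner_product (bergman_inner G \<phi>) A_G"
  by (rule function_inner_product_bergman[OF open_G weight_pos(1)])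

lemma bergman_D: "function_inner_product (bergman_inner D (\<phi> \<circ> p)) A_D"
  by (rule function_inner_product_bergman[OF open_D weight_pos(2)])

lemma fibre_trace_adjoint:
  assumes g: "g \<in> A_D" and h: "h \<in> A_G"
  shows "bergman_inner D (\<phi> \<circ> p) g (\<Gamma> h) = bergman_inner G \<phi> (fscale c (fibre_trace g)) h"
proof -
  let ?q = "\<lambda>z. g z * cnj (\<Gamma> h z) * complex_of_real ((\<phi> \<circ> p) z)"
  let ?u = "\<lambda>w. fscale c (fibre_trace g) w * cnj (h w) * complex_of_real (\<phi> w)"
  \<comment> \<open>The integrand divided by \<open>(cmod (J z))\<^sup>2\<close>: the factor
    \<open>cnj (J z)\<close> contained in \<open>cnj (\<Gamma> h z)\<close> leaves
    \<open>1 / J z\<close>.\<close>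
  define s where "s = (\<lambda>z. c * (g z / J z) * cnj (h (p z)) * complex_of_real (\<phi> (p z)))"
  have q0: "?q z = 0" if "z \<in> D" "J z = 0" for z using that by (simp add: Gamma_op_def)
  have intD: "set_integrable lebesgue D ?q"
    using bergman_product_integrable[OF open_D weight_pos(2) g Gamma_closed[OF h]]
    by (simp only: integrable_lebesgue_on_iff[OF sets_D])
  have "fscale c (fibre_trace g) \<in> A_G"
    by (rule function_inner_product.scale_closed[OF bergman_G fibre_trace_closed[OF g]])
  note intG = product_set_integrable[OF this h]
  have sq: "?q z = (cmod (J z))\<^sup>2 *\<^sub>R s z" if z: "z \<in> noncrit" for z
  proof -
    have "z \<in> D" "J z \<noteq> 0" using z noncrit_iff by auto
    then show ?thesis
      by (simp add: s_def Gamma_op_def scaleR_conv_of_real complex_norm_square del: of_real_power)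
  qed
  have "set_integrable lebesgue noncrit ?q"
    by (rule set_integrable_noncrit_iff[THEN iffD2, OF q0 intD])
  then have ints: "set_integrable lebesgue noncrit (\<lambda>z. (cmod (J z))\<^sup>2 *\<^sub>R s z)"
    by (rule set_integrable_cong[THEN iffD1, OF refl refl, rotated]) (rule sq)
  have "bergman_inner D (\<phi> \<circ> p) g (\<Gamma> h) = (LINT z:D|lebesgue. ?q z)"
    unfolding bergman_inner_def by (rule integral_lebesgue_on_eq[OF sets_D])
  also have "\<dots> = (LINT z:noncrit|lebesgue. ?q z)"
    by (rule set_integral_noncrit[OF q0, symmetric])
  also have "\<dots> = (LINT z:noncrit|lebesgue. (cmod (J z))\<^sup>2 *\<^sub>R s z)"
    by (rule set_lebesgue_integral_cong[OF noncrit_lebesgue]) (intro allI impI sq)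
  also have "\<dots> = (LINT w:regular|lebesgue. \<Sum>z | z \<in> D \<and> p z = w. s z)"
    by (rule fibre_integral(2)[OF ints, symmetric])
  also have "\<dots> = (LINT w:regular|lebesgue. ?u w)"
  proof (rule set_lebesgue_integral_cong[OF regular_lebesgue], intro allI impI)
    fix w assume w: "w \<in> regular"
    have "?u w = (\<Sum>z | z \<in> D \<and> p z = w. c * (g z / J z) * cnj (h w) * complex_of_real (\<phi> w))"
      unfolding fscale_def fibre_trace(2)[OF g w] fibre_sum_def by (simp only: sum_distrib_left sum_distrib_right)
    also have "\<dots> = (\<Sum>z | z \<in> D \<and> p z = w. s z)" by (rule sum.cong) (auto simp: s_def)
    finally show "(\<Sum>z | z \<in> D \<and> p z = w. s z) = ?u w" by (rule sym)
  qed
  also have "\<dots> = (LINT w:G|lebesgue. ?u w)" by (rule set_integral_regular[OF intG])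
  also have "\<dots> = bergman_inner G \<phi> (fscale c (fibre_trace g)) h"
    unfolding bergman_inner_def by (rule integral_lebesgue_on_eq[OF sets_G, symmetric])
  finally show ?thesis .
qed

lemma Gamma_isometry_with_adjoint:
  "isometry_with_adjoint (bergman_inner G \<phi>) A_G (bergman_inner D (\<phi> \<circ> p)) A_D \<Gamma> (\<lambda>g. fscale c (fibre_trace g))"
proof (intro isometry_with_adjoint.intro isometry_with_adjoint_axioms.intro)
  show "function_inner_product (bergman_inner G \<phi>) A_G" by (rule bergman_G)
  show "function_inner_product (bergman_inner D (\<phi> \<circ> p)) A_D" by (rule bergman_D)
  show "linear_operator_on A_G A_D \<Gamma>" by (rule Gamma_linear)
  show "bergman_inner D (\<phi> \<circ> p) (\<Gamma> f) (\<Gamma> h) = bergman_inner G \<phi> f h" if "f \<in> A_G" "h \<in> A_G" for f h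
    by (rule Gamma_isometric[OF that])
  show "fscale c (fibre_trace g) \<in> A_G" if "g \<in> A_D" for g
    by (rule function_inner_product.scale_closed[OF bergman_G fibre_trace_closed[OF that]])
  show "bergman_inner D (\<phi> \<circ> p) g (\<Gamma> h) = bergman_inner G \<phi> (fscale c (fibre_trace g)) h"
    if "g \<in> A_D" "h \<in> A_G" for g h
    by (rule fibre_trace_adjoint[OF that])
qed

text \<open>By the chain rule and \<open>p (\<rho> k w) = w\<close>, the Jacobian of
  \<open>\<rho> k \<circ> p\<close> at \<open>z\<close> is \<open>J z / J (\<rho> k (p z))\<close>,
  so the sum over \<open>k\<close> is the fibre sum times \<open>J z\<close>. The factors
  \<open>c\<close> of \<Gamma> and of the adjoint combine to \<open>1 / m\<close>.\<close>

lemma Gamma_fibre_trace_local_inverses: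
  assumes g: "g \<in> A_D" and z: "z \<in> D" and U: "p z \<in> U" "local_inverses D G p m U \<rho>"
  shows "\<Gamma> (fscale c (fibre_trace g)) z
    = 1 / of_nat m * (\<Sum>k=1..m. g ((\<rho> k \<circ> p) z) * cjacobian (\<rho> k \<circ> p) z)"
proof -
  have oU: "open U" "U \<subseteq> regular" using U(2) by (auto simp: local_inverses_def regular_def)
  have "cjacobian (\<rho> k \<circ> p) z = J z / J (\<rho> k (p z))" if k: "k \<in> {1..m}" for k
  proof -
    have \<rho>: "holomorphic_map_on (\<rho> k) U" "\<And>w. w \<in> U \<Longrightarrow> p (\<rho> k w) = w"
      using U(2) k by (auto simp: local_inverses_def)
    have "\<rho> k (p z) \<in> D" using local_inverses_in(1)[OF U(2,1) k] noncrit_subset by blast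
    then have "J (\<rho> k (p z)) * cjacobian (\<rho> k) (p z) = 1"
      by (intro cjacobian_right_inverse[OF oU(1) U(1) \<rho> p_holo])
    then have "cjacobian (\<rho> k) (p z) = 1 / J (\<rho> k (p z))"
      by (auto simp: eq_divide_eq mult.commute)
    then show ?thesis using cjacobian_compose[OF p_holo z \<rho>(1) U(1)] by simp
  qed
  then have "(\<Sum>k=1..m. g ((\<rho> k \<circ> p) z) * cjacobian (\<rho> k \<circ> p) z)
      = (\<Sum>k=1..m. g (\<rho> k (p z)) / J (\<rho> k (p z)) * J z)"
    by (intro sum.cong) auto
  also have "\<dots> = fibre_sum g (p z) * J z"
    by (simp only: fibre_sum_local_inverses[OF U(2,1)] sum_distrib_right)
  also have "fibre_sum g (p z) = fibre_trace g (p z)"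
    using fibre_trace(2)[OF g] U(1) oU(2) by auto
  finally have *: "(\<Sum>k=1..m. g ((\<rho> k \<circ> p) z) * cjacobian (\<rho> k \<circ> p) z) = fibre_trace g (p z) * J z" .
  have "\<Gamma> (fscale c (fibre_trace g)) z = (c * c) * (fibre_trace g (p z) * J z)"
    using z by (simp only: Gamma_op_def fscale_def if_True mult.assoc)
  then show ?thesis unfolding * c_square(1) .
qed

end

text \<open>The Hilbert property appears as closedness in the ambient space together with transfer
  of completeness from \<open>A_G\<close>. The formula is asserted for every orthogonal projection
  and every system of local inverses around \<open>\<pi> z\<close>; separate conjuncts supply a
  projection and such a system near each regular value, so it is not vacuous.\<close>

theorem theorem1:
  fixes D G :: "(complex^'n) set"
    and \<pi> :: "complex^'n \<Rightarrow> complex^'n"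
    and \<phi> :: "complex^'n \<Rightarrow> real"
    and m :: nat
  assumes "cdomain D" and "cdomain G"
    and "proper_holomorphic D G \<pi>"
    and "has_multiplicity D G \<pi> m"
    and "Linf_loc_pos G \<phi>"
  defines "A_G \<equiv> bergman G \<phi>"
    and "A_D \<equiv> bergman D (\<phi> \<circ> \<pi>)"
    and "ip_G \<equiv> bergman_inner G \<phi>"
    and "ip_D \<equiv> bergman_inner D (\<phi> \<circ> \<pi>)"
    and "\<Gamma> \<equiv> Gamma_op D \<pi> m"
  shows "linear_operator_on A_G A_D \<Gamma>
    \<and> closed_subspace_of ip_D A_D (\<Gamma> ` A_G)
    \<and> (ip_complete ip_G A_G \<longrightarrow> ip_complete ip_D (\<Gamma> ` A_G))
    \<and> isometric_isomorphism ip_G A_G ip_D (\<Gamma> ` A_G) \<Gamma>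
    \<and> (\<exists>P. orthogonal_projection ip_D A_D (\<Gamma> ` A_G) P)
    \<and> (\<forall>w \<in> G - \<pi> ` crit D \<pi>. \<exists>U \<rho>. w \<in> U \<and> local_inverses D G \<pi> m U \<rho>)
    \<and> (\<forall>P. orthogonal_projection ip_D A_D (\<Gamma> ` A_G) P \<longrightarrow>
         (\<forall>g\<in>A_D. \<forall>z\<in>D. \<forall>U \<rho>. \<pi> z \<in> U \<and> local_inverses D G \<pi> m U \<rho> \<longrightarrow>
            P g z = 1 / of_nat m *
              (\<Sum>k=1..m. g ((\<rho> k \<circ> \<pi>) z) * cjacobian (\<rho> k \<circ> \<pi>) z)))"
proof -
  interpret weighted_proper_hol D G \<pi> m \<phi>
    using assms(1-5) by unfold_locales
  interpret I: isometry_with_adjoint ip_G A_G ip_D A_D \<Gamma> "\<lambda>g. fscale c (fibre_trace g)"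
    unfolding A_G_def A_D_def ip_G_def ip_D_def \<Gamma>_def by (rule Gamma_isometry_with_adjoint)
  show ?thesis
  proof (intro conjI impI ballI allI)
    show "linear_operator_on A_G A_D \<Gamma>" by (rule I.linear)
    show "closed_subspace_of ip_D A_D (\<Gamma> ` A_G)" by (rule I.closed_subspace_image)
    show "ip_complete ip_D (\<Gamma> ` A_G)" if "ip_complete ip_G A_G" using that by (rule I.complete_image)
    show "isometric_isomorphism ip_G A_G ip_D (\<Gamma> ` A_G) \<Gamma>" by (rule I.isometric_isomorphism_image)
    show "\<exists>P. orthogonal_projection ip_D A_D (\<Gamma> ` A_G) P" using I.orthogonal_projection_adjoint by blast
    show "\<exists>U \<rho>. w \<in> U \<and> local_inverses D G \<pi> m U \<rho>" if "w \<in> G - \<pi> ` crit D \<pi>" for w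
      using that local_inverses_exist by (simp add: regular_def)
    show "P g z = 1 / of_nat m * (\<Sum>k=1..m. g ((\<rho> k \<circ> \<pi>) z) * cjacobian (\<rho> k \<circ> \<pi>) z)"
      if "orthogonal_projection ip_D A_D (\<Gamma> ` A_G) P" "g \<in> A_D" "z \<in> D"
        "\<pi> z \<in> U \<and> local_inverses D G \<pi> m U \<rho>" for P g z U \<rho>
      using I.orthogonal_projection_unique[OF that(1,2)] Gamma_fibre_trace_local_inverses[of g z U \<rho>] that
      by (simp add: A_D_def \<Gamma>_def)
  qed
qed

end
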